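(* Fix $i\in I$ and let $\beta\in Q^+$. The algebra $H_\beta^i$ is zero if and only if $s_i(\beta)\notin Q^+$.
   Context: Let $I$ be a nonempty set and $\cdot:\mathbb{Z}I\otimes\mathbb{Z}I\to\mathbb{Z}$ a symmetric bilinear form with $i\cdot i\in 2\mathbb{Z}_{>0}$ for all $i\in I$ and $c_{i,j}:=2(i\cdot j)/(i\cdot i)\in\mathbb{Z}_{\le 0}$ for $i\neq j$ (and $c_{i,i}=2$). Put $d_i=(i\cdot i)/2$, $Q=\bigoplus_{i\in I}\mathbb{Z}i$, $Q^+=\bigoplus_{i\in I}\mathbb{Z}_{\ge 0}i$, let $\langle i^\vee,-\rangle:Q\to\mathbb{Z}$ be the linear map with $\langle i^\vee,j\rangle=c_{i,j}$, and $s_i(\beta)=\beta-\langle i^\vee,\beta\rangle i$ for $\beta\in Q$. The height of $\beta=\sum n_i i\in Q^+$ is $|\beta|=\sum n_i$, and $I^\beta=\{\nu\in I^{|\beta|}:\sum_k\nu_k=\beta\}$. Components of tuples are numbered from right to left, $\nu=(\nu_n,\dots,\nu_1)$, and the transposition $s_k=(k\ k+1)$ exchanges $\nu_k$ and $\nu_{k+1}$. $K$ is a nonzero commutative ring. For $i,j\in I$ fix $Q_{i,j}(u,v)\in K[u,v]$ with $Q_{i,i}=0$, $Q_{i,j}(u,v)=Q_{j,i}(v,u)$, and for $i\ne j$: if $c_{i,j}<0$, $Q_{i,j}(u,v)\in t_{i,j}u^{-c_{i,j}}+t_{j,i}v^{-c_{j,i}}+\sum_{s,t>0,\ d_is+d_jt=-i\cdot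 j}Ku^sv^t$ with $t_{i,j},t_{j,i}\in K^\times$; if $c_{i,j}=0$, $Q_{i,j}$ is an invertible constant. KLR algebra. For $\beta\in Q^+$ of height $n$, $H_\beta$ is the unital $K$-algebra generated by $1_\nu$ ($\nu\in I^\beta$), $x_1,\dots,x_n$, $\tau_1,\dots,\tau_{n-1}$ with relations: $1_\nu1_{\nu'}=\delta_{\nu,\nu'}1_\nu$, $\sum_\nu1_\nu=1_\beta$ (the unit); $x_k1_\nu=1_\nu x_k$; $\tau_k1_\nu=1_{s_k(\nu)}\tau_k$; $x_kx_\ell=x_\ell x_k$; $\tau_k^21_\nu=Q_{\nu_k,\nu_{k+1}}(x_k,x_{k+1})1_\nu$; $(\tau_kx_\ell-x_{s_k(\ell)}\tau_k)1_\nu$ equals $1_\nu$ if $\ell=k+1,\nu_k=\nu_{k+1}$, equals $-1_\nu$ if $\ell=k,\nu_k=\nu_{k+1}$, and is $0$ otherwise; $\tau_k\tau_\ell=\tau_\ell\tau_k$ if $|k-\ell|>1$; $(\tau_{k+1}\tau_k\tau_{k+1}-\tau_k\tau_{k+1}\tau_k)1_\nu=\delta_{\nu_k,\nu_{k+2}}\frac{Q_{\nu_k,\nu_{k+1}}(x_{k+2},x_{k+1})-Q_{\nu_k,\nu_{k+1}}(x_k,x_{k+1})}{x_{k+2}-x_k}1_\nu$. ($H_0=K$.) Let $1_{\beta-i,i}=\sum_{\nu\in I^\beta,\ \nu_1=i}1_\nu\in H_\beta$ (equal to $0$ if $\beta-i\notin Q^+$), and $H_\beta^i=H_\beta/(1_{\beta-i,i})$,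 the quotient by the two-sided ideal generated by $1_{\beta-i,i}$. *)

theory Defs
  imports
    "HOL-Library.Multiset"
    "HOL-Library.Poly_Mapping"
    "HOL-Combinatorics.Transposition"
    "HOL-Algebra.QuotRing"
begin

section \<open>Root lattice\<close>

text \<open>
  The index set is a type \<open>'i\<close>, and $Q = \bigoplus_{i \in I} \mathbf{Z} i$ is \<^typ>\<open>'i \<Rightarrow>\<^sub>0 int\<close>.
  The letter \<open>Q\<close> is kept for the polynomials $Q_{i,j}$.
\<close>

type_synonym 'i root_lattice = "'i \<Rightarrow>\<^sub>0 int"

abbreviation simple_root :: "'i \<Rightarrow> 'i root_lattice"
  where "simple_root i \<equiv> Poly_Mapping.single i 1"

definition Q_plus :: "'i root_lattice set"
  where "Q_plus = {\<beta>. \<forall>i. 0 \<le> Poly_Mapping.lookup \<beta> i}"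

definition height :: "'i root_lattice \<Rightarrow> nat"
  where "height \<beta> = nat (\<Sum>i\<in>Poly_Mapping.keys \<beta>. Poly_Mapping.lookup \<beta> i)"

type_synonym 'i lattice_form = "'i root_lattice \<Rightarrow> 'i root_lattice \<Rightarrow> int"

definition pairing :: "'i lattice_form \<Rightarrow> 'i \<Rightarrow> 'i \<Rightarrow> int"
  where "pairing form i j = form (simple_root i) (simple_root j)"

text \<open>
  In a Cartan datum (below) both integer divisions are exact.
\<close>

definition cartan :: "'i lattice_form \<Rightarrow> 'i \<Rightarrow> 'i \<Rightarrow> int"
  where "cartan form i j = 2 * pairing form i j div pairing form i i"

definition half_norm :: "'i lattice_form \<Rightarrow> 'i \<Rightarrow> int"
  where "half_norm form i = pairing form i i div 2"

definition coroot :: "'i lattice_form \<Rightarrow> 'i \<Rightarrow> 'i root_lattice \<Rightarrow> int"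
  where "coroot form i \<beta> =
    (\<Sum>j\<in>Poly_Mapping.keys \<beta>. Poly_Mapping.lookup \<beta> j * cartan form i j)"

definition simple_reflection :: "'i lattice_form \<Rightarrow> 'i \<Rightarrow> 'i root_lattice \<Rightarrow> 'i root_lattice"
  where "simple_reflection form i \<beta> = \<beta> - Poly_Mapping.single i (coroot form i \<beta>)"

locale cartan_datum =
  fixes form :: "'i lattice_form"
  assumes form_sym: "form \<alpha> \<beta> = form \<beta> \<alpha>"
    and form_add_left: "form (\<alpha> + \<beta>) \<gamma> = form \<alpha> \<gamma> + form \<beta> \<gamma>"
    and norm_even: "even (pairing form i i)"
    and norm_pos: "pairing form i i > 0"
    and cartan_integral: "pairing form i i dvd 2 * pairing form i j"
    and cartan_nonpos: "i \<noteq> j \<Longrightarrow> cartan form i j \<le> 0"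


section \<open>The polynomials $Q_{i,j}$\<close>

text \<open>
  A polynomial in $K[u,v]$ is a finitely supported function on exponents: the coefficient of
  $u^s v^r$ in \<open>q\<close> is \<open>lookup q (s, r)\<close>.
\<close>

type_synonym 'k bipoly = "nat \<times> nat \<Rightarrow>\<^sub>0 'k"

locale klr_datum = cartan_datum form
  for form :: "'i lattice_form" +
  fixes t :: "'i \<Rightarrow> 'i \<Rightarrow> 'k::comm_ring_1"
    and Q :: "'i \<Rightarrow> 'i \<Rightarrow> 'k bipoly"
  assumes Q_diag: "Q i i = 0"
    and Q_sym: "Poly_Mapping.lookup (Q i j) (s, r) = Poly_Mapping.lookup (Q j i) (r, s)"
    and Q_neg: "\<lbrakk>i \<noteq> j; cartan form i j < 0\<rbrakk> \<Longrightarrow>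
      t i j dvd 1 \<and> t j i dvd 1 \<and>
      (\<exists>R. Poly_Mapping.keys R \<subseteq>
             {(s, r). s > 0 \<and> r > 0 \<and>
                half_norm form i * int s + half_norm form j * int r = - pairing form i j} \<and>
           Q i j = Poly_Mapping.single (nat (- cartan form i j), 0) (t i j)
                 + Poly_Mapping.single (0, nat (- cartan form j i)) (t j i) + R)"
    and Q_zero: "\<lbrakk>i \<noteq> j; cartan form i j = 0\<rbrakk> \<Longrightarrow>
      \<exists>c. c dvd 1 \<and> Q i j = Poly_Mapping.single (0, 0) c"

text \<open>
  Evaluation at a pair of ring elements, and the divided difference
  $(q(u,v) - q(w,v)) / (u - w)$, for coefficients mapped into the ring by \<open>h\<close>.  Both are applied
  below in a free algebra, to elements which commute only modulo the defining relations, so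
  an order of the factors is fixed.  The lemma following them shows that \<open>bipoly_dd\<close> is the
  quotient as soon as the ring is commutative.
\<close>

definition bipoly_eval :: "('k::zero \<Rightarrow> 'a::ring_1) \<Rightarrow> 'k bipoly \<Rightarrow> 'a \<Rightarrow> 'a \<Rightarrow> 'a"
  where "bipoly_eval h q u v =
    (\<Sum>(s, r)\<in>Poly_Mapping.keys q. h (Poly_Mapping.lookup q (s, r)) * u ^ s * v ^ r)"

definition bipoly_dd :: "('k::zero \<Rightarrow> 'a::ring_1) \<Rightarrow> 'k bipoly \<Rightarrow> 'a \<Rightarrow> 'a \<Rightarrow> 'a \<Rightarrow> 'a"
  where "bipoly_dd h q u w v =
    (\<Sum>(s, r)\<in>Poly_Mapping.keys q.
       h (Poly_Mapping.lookup q (s, r)) * (\<Sum>a<s. w ^ (s - Suc a) * u ^ a) * v ^ r)"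

lemma bipoly_dd_eq:
  fixes u w v :: "'a::comm_ring_1"
  shows "(u - w) * bipoly_dd h q u w v = bipoly_eval h q u v - bipoly_eval h q w v"
proof -
  have "(u - w) * (h c * (\<Sum>a<s. w ^ (s - Suc a) * u ^ a) * v ^ r) =
        h c * u ^ s * v ^ r - h c * w ^ s * v ^ r" for c s r
  proof -
    have "(u - w) * (h c * (\<Sum>a<s. w ^ (s - Suc a) * u ^ a) * v ^ r) =
          h c * ((u - w) * (\<Sum>a<s. w ^ (s - Suc a) * u ^ a)) * v ^ r"
      by (simp only: ac_simps)
    also have "\<dots> = h c * (u ^ s - w ^ s) * v ^ r"
      by (simp only: power_diff_sumr2[symmetric])
    finally show ?thesis
      by (simp add: algebra_simps)
  qed
  then show ?thesis
    unfolding bipoly_dd_def bipoly_eval_def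
    by (simp add: sum_distrib_left sum_subtractf[symmetric] case_prod_unfold)
qed


section \<open>Free algebras\<close>

text \<open>
  Words are written additively, so that \<open>'g free_monoid \<Rightarrow>\<^sub>0 'k\<close> with its convolution product
  is the free unital associative algebra on \<open>'g\<close>.
\<close>

datatype 'g free_monoid = Word (letters: "'g list")

instantiation free_monoid :: (type) monoid_add
begin

definition zero_free_monoid :: "'a free_monoid"
  where "0 = Word []"

definition plus_free_monoid :: "'a free_monoid \<Rightarrow> 'a free_monoid \<Rightarrow> 'a free_monoid"
  where "v + w = Word (letters v @ letters w)"

instance
  by standard (simp_all add: zero_free_monoid_def plus_free_monoid_def)

end

type_synonym ('g, 'k) free_alg = "'g free_monoid \<Rightarrow>\<^sub>0 'k"

definition free_algebra :: "'g set \<Rightarrow> ('g, 'k::comm_ring_1) free_alg ring"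
  where "free_algebra G =
    \<lparr>carrier = {p. \<forall>w\<in>Poly_Mapping.keys p. set (letters w) \<subseteq> G},
     mult = (*), one = 1, zero = 0, add = (+)\<rparr>"

abbreviation gen :: "'g \<Rightarrow> ('g, 'k::comm_ring_1) free_alg"
  where "gen g \<equiv> Poly_Mapping.single (Word [g]) 1"

abbreviation scalar :: "'k \<Rightarrow> ('g, 'k::comm_ring_1) free_alg"
  where "scalar c \<equiv> Poly_Mapping.single 0 c"

lemma free_algebra_closed:
  fixes p q :: "('g, 'k::comm_ring_1) free_alg"
  assumes "p \<in> carrier (free_algebra G)" "q \<in> carrier (free_algebra G)"
  shows "p + q \<in> carrier (free_algebra G)" "p - q \<in> carrier (free_algebra G)"
    "- p \<in> carrier (free_algebra G)" "p * q \<in> carrier (free_algebra G)"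
proof -
  have p: "w \<in> Poly_Mapping.keys p \<Longrightarrow> set (letters w) \<subseteq> G"
    and q: "w \<in> Poly_Mapping.keys q \<Longrightarrow> set (letters w) \<subseteq> G" for w
    using assms by (auto simp: free_algebra_def)
  show "p + q \<in> carrier (free_algebra G)" "p - q \<in> carrier (free_algebra G)"
    "- p \<in> carrier (free_algebra G)"
    using p q keys_add[of p q] keys_diff[of p q]
    by (fastforce simp: free_algebra_def)+
  show "p * q \<in> carrier (free_algebra G)"
    using p q keys_mult[of p q]
    by (fastforce simp: free_algebra_def plus_free_monoid_def)
qed

lemma free_algebra_scalar: "scalar c \<in> carrier (free_algebra G)"
  by (auto simp: free_algebra_def zero_free_monoid_def)

lemma free_algebra_zero: "0 \<in> carrier (free_algebra G)"
  by (auto simp: free_algebra_def)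

lemma free_algebra_one: "1 \<in> carrier (free_algebra G)"
  using free_algebra_scalar[of 1] by simp

lemma free_algebra_gen: "g \<in> G \<Longrightarrow> gen g \<in> carrier (free_algebra G)"
  by (auto simp: free_algebra_def)

lemma free_algebra_sum:
  "(\<And>a. a \<in> A \<Longrightarrow> f a \<in> carrier (free_algebra G)) \<Longrightarrow> sum f A \<in> carrier (free_algebra G)"
  by (induction A rule: infinite_finite_induct)
    (auto intro: free_algebra_closed free_algebra_zero)

lemma free_algebra_power:
  "p \<in> carrier (free_algebra G) \<Longrightarrow> p ^ n \<in> carrier (free_algebra G)"
  by (induction n) (auto intro: free_algebra_closed free_algebra_one)

lemma free_algebra_ring: "ring (free_algebra G :: ('g, 'k::comm_ring_1) free_alg ring)"
  (is "ring ?F")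
proof (rule ringI)
  show "abelian_group ?F"
  proof (rule abelian_groupI)
    fix p q :: "('g, 'k) free_alg"
    assume p: "p \<in> carrier ?F" and q: "q \<in> carrier ?F"
    show "p \<oplus>\<^bsub>?F\<^esub> q \<in> carrier ?F"
      using free_algebra_closed(1)[OF p q] by (simp add: free_algebra_def)
    show "\<exists>r\<in>carrier ?F. r \<oplus>\<^bsub>?F\<^esub> p = \<zero>\<^bsub>?F\<^esub>"
      using free_algebra_closed(3)[OF p p] by (intro bexI[of _ "- p"]) (simp_all add: free_algebra_def)
  qed (simp_all add: free_algebra_def add_ac)
  show "Group.monoid ?F"
  proof (rule monoidI)
    fix p q :: "('g, 'k) free_alg"
    assume p: "p \<in> carrier ?F" and q: "q \<in> carrier ?F"
    show "p \<otimes>\<^bsub>?F\<^esub> q \<in> carrier ?F"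
      using free_algebra_closed(4)[OF p q] by (simp add: free_algebra_def)
  next
    show "\<one>\<^bsub>?F\<^esub> \<in> carrier ?F"
      using free_algebra_one[of G] by (simp add: free_algebra_def)
  qed (simp_all add: free_algebra_def mult.assoc)
qed (auto simp: free_algebra_def algebra_simps)


section \<open>KLR algebras\<close>

text \<open>
  A tuple $\nu = (\nu_n, \dots, \nu_1)$, whose components are numbered from right to left, is stored
  as the list \<open>[\<nu>\<^sub>1, \<dots>, \<nu>\<^sub>n]\<close>.
\<close>

definition entry :: "'i list \<Rightarrow> nat \<Rightarrow> 'i"
  where "entry \<nu> k = \<nu> ! (k - 1)"

definition swap_entries :: "nat \<Rightarrow> 'i list \<Rightarrow> 'i list"
  where "swap_entries k \<nu> = \<nu>[k - 1 := entry \<nu> (k + 1), k := entry \<nu> k]"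

definition seqs :: "'i root_lattice \<Rightarrow> 'i list set"
  where "seqs \<beta> = {\<nu>. length \<nu> = height \<beta> \<and> (\<Sum>i\<leftarrow>\<nu>. simple_root i) = \<beta>}"

datatype 'i klr_gen = Gen_e "'i list" | Gen_x nat | Gen_tau nat

definition klr_gens :: "'i root_lattice \<Rightarrow> 'i klr_gen set"
  where "klr_gens \<beta> =
    Gen_e ` seqs \<beta> \<union> Gen_x ` {1..height \<beta>} \<union> Gen_tau ` {1..<height \<beta>}"

abbreviation e_gen :: "'i list \<Rightarrow> ('i klr_gen, 'k::comm_ring_1) free_alg"
  where "e_gen \<nu> \<equiv> gen (Gen_e \<nu>)"

abbreviation x_gen :: "nat \<Rightarrow> ('i klr_gen, 'k::comm_ring_1) free_alg"
  where "x_gen k \<equiv> gen (Gen_x k)"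

abbreviation tau_gen :: "nat \<Rightarrow> ('i klr_gen, 'k::comm_ring_1) free_alg"
  where "tau_gen k \<equiv> gen (Gen_tau k)"

inductive_set klr_relators ::
    "('i \<Rightarrow> 'i \<Rightarrow> 'k::comm_ring_1 bipoly) \<Rightarrow> 'i root_lattice \<Rightarrow> ('i klr_gen, 'k) free_alg set"
  for Q :: "'i \<Rightarrow> 'i \<Rightarrow> 'k::comm_ring_1 bipoly" and \<beta> :: "'i root_lattice"
  where
    idem_orth: "\<lbrakk>\<nu> \<in> seqs \<beta>; \<nu>' \<in> seqs \<beta>\<rbrakk> \<Longrightarrow>
      e_gen \<nu> * e_gen \<nu>' - (if \<nu> = \<nu>' then e_gen \<nu> else 0) \<in> klr_relators Q \<beta>"
  | idem_sum: "(\<Sum>\<nu>\<in>seqs \<beta>. e_gen \<nu>) - 1 \<in> klr_relators Q \<beta>"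
  | x_idem: "\<lbrakk>\<nu> \<in> seqs \<beta>; k \<in> {1..height \<beta>}\<rbrakk> \<Longrightarrow>
      x_gen k * e_gen \<nu> - e_gen \<nu> * x_gen k \<in> klr_relators Q \<beta>"
  | tau_idem: "\<lbrakk>\<nu> \<in> seqs \<beta>; k \<in> {1..<height \<beta>}\<rbrakk> \<Longrightarrow>
      tau_gen k * e_gen \<nu> - e_gen (swap_entries k \<nu>) * tau_gen k \<in> klr_relators Q \<beta>"
  | x_comm: "\<lbrakk>k \<in> {1..height \<beta>}; l \<in> {1..height \<beta>}\<rbrakk> \<Longrightarrow>
      x_gen k * x_gen l - x_gen l * x_gen k \<in> klr_relators Q \<beta>"
  | tau_square: "\<lbrakk>\<nu> \<in> seqs \<beta>; k \<in> {1..<height \<beta>}\<rbrakk> \<Longrightarrow>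
      tau_gen k ^ 2 * e_gen \<nu>
      - bipoly_eval scalar (Q (entry \<nu> k) (entry \<nu> (k + 1))) (x_gen k) (x_gen (k + 1)) * e_gen \<nu>
      \<in> klr_relators Q \<beta>"
  | tau_x: "\<lbrakk>\<nu> \<in> seqs \<beta>; k \<in> {1..<height \<beta>}; l \<in> {1..height \<beta>}\<rbrakk> \<Longrightarrow>
      (tau_gen k * x_gen l - x_gen (Transposition.transpose k (k + 1) l) * tau_gen k) * e_gen \<nu>
      - (if l = k + 1 \<and> entry \<nu> k = entry \<nu> (k + 1) then e_gen \<nu>
         else if l = k \<and> entry \<nu> k = entry \<nu> (k + 1) then - e_gen \<nu>
         else 0)
      \<in> klr_relators Q \<beta>"
  | tau_comm: "\<lbrakk>k \<in> {1..<height \<beta>}; l \<in> {1..<height \<beta>}; \<bar>int k - int l\<bar> > 1\<rbrakk> \<Longrightarrow>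
      tau_gen k * tau_gen l - tau_gen l * tau_gen k \<in> klr_relators Q \<beta>"
  | tau_braid: "\<lbrakk>\<nu> \<in> seqs \<beta>; k \<in> {1..<height \<beta>}; k + 1 \<in> {1..<height \<beta>}\<rbrakk> \<Longrightarrow>
      (tau_gen (k + 1) * tau_gen k * tau_gen (k + 1) - tau_gen k * tau_gen (k + 1) * tau_gen k)
        * e_gen \<nu>
      - (if entry \<nu> k = entry \<nu> (k + 2)
         then bipoly_dd scalar (Q (entry \<nu> k) (entry \<nu> (k + 1)))
                (x_gen (k + 2)) (x_gen k) (x_gen (k + 1)) * e_gen \<nu>
         else 0)
      \<in> klr_relators Q \<beta>"

lemma finite_seqs: "finite (seqs \<beta>)"
proof (rule finite_subset)
  have count: "Poly_Mapping.lookup (\<Sum>j\<leftarrow>\<nu>. simple_root j) i = int (count (mset \<nu>) i)"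
    for \<nu> :: "'a list" and i
    by (induction \<nu>) (auto simp: lookup_add lookup_single when_def)
  show "seqs \<beta> \<subseteq> {\<nu>. set \<nu> \<subseteq> Poly_Mapping.keys \<beta> \<and> length \<nu> = height \<beta>}"
  proof
    fix \<nu> assume "\<nu> \<in> seqs \<beta>"
    then have len: "length \<nu> = height \<beta>" and sum: "(\<Sum>j\<leftarrow>\<nu>. simple_root j) = \<beta>"
      by (auto simp: seqs_def)
    have "i \<in> Poly_Mapping.keys \<beta>" if "i \<in> set \<nu>" for i
      using that count[of \<nu> i] sum by (simp add: in_keys_iff)
    with len show "\<nu> \<in> {\<nu>. set \<nu> \<subseteq> Poly_Mapping.keys \<beta> \<and> length \<nu> = height \<beta>}"
      by auto
  qed
  show "finite {\<nu>. set \<nu> \<subseteq> Poly_Mapping.keys \<beta> \<and> length \<nu> = height \<beta>}"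
    by (rule finite_lists_length_eq) simp
qed

lemma length_swap_entries: "length (swap_entries k \<nu>) = length \<nu>"
  by (simp add: swap_entries_def)

lemma swap_entries_in_seqs:
  assumes "\<nu> \<in> seqs \<beta>" "k \<in> {1..<height \<beta>}"
  shows "swap_entries k \<nu> \<in> seqs \<beta>"
proof -
  have "k - 1 < length \<nu>" "k < length \<nu>"
    using assms by (auto simp: seqs_def)
  then have "mset (swap_entries k \<nu>) = mset \<nu>"
    using assms by (simp add: swap_entries_def entry_def mset_swap)
  then have "mset (map simple_root (swap_entries k \<nu>)) = mset (map simple_root \<nu>)"
    by simp
  then have "(\<Sum>i\<leftarrow>swap_entries k \<nu>. simple_root i) = (\<Sum>i\<leftarrow>\<nu>. simple_root i)"
    by (metis sum_mset_sum_list)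
  then show ?thesis
    using assms by (simp add: seqs_def length_swap_entries)
qed

lemma klr_relators_carrier: "klr_relators Q \<beta> \<subseteq> carrier (free_algebra (klr_gens \<beta>))"
proof
  fix p assume "p \<in> klr_relators Q \<beta>"
  moreover have e: "e_gen \<nu> \<in> carrier (free_algebra (klr_gens \<beta>))" if "\<nu> \<in> seqs \<beta>" for \<nu>
    using that by (intro free_algebra_gen) (auto simp: klr_gens_def)
  moreover have x: "x_gen k \<in> carrier (free_algebra (klr_gens \<beta>))" if "1 \<le> k" "k \<le> height \<beta>" for k
    using that by (intro free_algebra_gen) (auto simp: klr_gens_def)
  moreover have "tau_gen k \<in> carrier (free_algebra (klr_gens \<beta>))" if "1 \<le> k" "k < height \<beta>" for k
    using that by (intro free_algebra_gen) (auto simp: klr_gens_def)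
  moreover have "bipoly_eval scalar q u v \<in> carrier (free_algebra (klr_gens \<beta>))"
    if "u \<in> carrier (free_algebra (klr_gens \<beta>))" "v \<in> carrier (free_algebra (klr_gens \<beta>))"
    for q :: "'b bipoly" and u v
    using that unfolding bipoly_eval_def bipoly_dd_def
    by (auto intro!: free_algebra_sum free_algebra_closed free_algebra_power free_algebra_scalar)
  moreover have "bipoly_dd scalar q u w v \<in> carrier (free_algebra (klr_gens \<beta>))"
    if "u \<in> carrier (free_algebra (klr_gens \<beta>))" "w \<in> carrier (free_algebra (klr_gens \<beta>))" "v \<in> carrier (free_algebra (klr_gens \<beta>))"
    for q :: "'b bipoly" and u w v
    using that unfolding bipoly_eval_def bipoly_dd_def
    by (auto intro!: free_algebra_sum free_algebra_closed free_algebra_power free_algebra_scalar)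
  ultimately show "p \<in> carrier (free_algebra (klr_gens \<beta>))"
    by cases
      (auto intro!: free_algebra_sum free_algebra_closed free_algebra_power free_algebra_zero
         free_algebra_one simp: swap_entries_in_seqs Transposition.transpose_def)
qed

text \<open>
  The scalars are central in the free algebra, so its ring ideals are also $K$-submodules, and the
  ring quotients below are the quotients as $K$-algebras.
\<close>

definition klr_ideal ::
    "('i \<Rightarrow> 'i \<Rightarrow> 'k::comm_ring_1 bipoly) \<Rightarrow> 'i root_lattice \<Rightarrow> ('i klr_gen, 'k) free_alg set"
  where "klr_ideal Q \<beta> = Idl\<^bsub>free_algebra (klr_gens \<beta>)\<^esub> (klr_relators Q \<beta>)"

definition klr_algebra ::
    "('i \<Rightarrow> 'i \<Rightarrow> 'k::comm_ring_1 bipoly) \<Rightarrow> 'i root_lattice \<Rightarrow> ('i klr_gen, 'k) free_alg set ring"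
  where "klr_algebra Q \<beta> = free_algebra (klr_gens \<beta>) Quot klr_ideal Q \<beta>"

definition klr_idem ::
    "('i \<Rightarrow> 'i \<Rightarrow> 'k::comm_ring_1 bipoly) \<Rightarrow> 'i root_lattice \<Rightarrow> 'i \<Rightarrow> ('i klr_gen, 'k) free_alg set"
  where "klr_idem Q \<beta> i =
    klr_ideal Q \<beta> +>\<^bsub>free_algebra (klr_gens \<beta>)\<^esub>
      (\<Sum>\<nu> | \<nu> \<in> seqs \<beta> \<and> \<nu> \<noteq> [] \<and> entry \<nu> 1 = i. e_gen \<nu>)"

definition klr_quotient ::
    "('i \<Rightarrow> 'i \<Rightarrow> 'k::comm_ring_1 bipoly) \<Rightarrow> 'i root_lattice \<Rightarrow> 'i \<Rightarrow>
      ('i klr_gen, 'k) free_alg set set ring"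
  where "klr_quotient Q \<beta> i = klr_algebra Q \<beta> Quot (Idl\<^bsub>klr_algebra Q \<beta>\<^esub> {klr_idem Q \<beta> i})"

end

theory Submission
  imports Defs "HOL-Computational_Algebra.Polynomial"
begin

text \<open>
  For a prefix $(\nu_1, \dots, \nu_l)$ put $D_l(\nu) = \sum_{p \le l} (-1$ if $\nu_p = i$, else
  $-c_{i,\nu_p})$. For the whole word this is the coefficient of $i$ in $s_i(\beta)$, whatever
  $\nu \in I^\beta$ is, so the claim is that $H_\beta^i = 0$ iff this number is negative.

  Let $F_0 = 1$, and let $F_{l+1}(y)$ be $F_l(y) Q_{i,\nu_{l+1}}(y, x_{l+1})$ if $\nu_{l+1} \ne i$
  and the divided difference $(F_l(y) - F_l(x_{l+1})) / (y - x_{l+1})$ if $\nu_{l+1} = i$. As long as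
  no $D_l$ has become negative, $F_l$ is monic in $y$ of degree $D_l$, up to a unit.

  If $D$ is negative: for $\nu_{l+1} = i$ the relation $F_l(x_{l+1}) 1_\nu = 0$ holds in $H_\beta^i$,
  by induction on $l$. It is transported over a strand $j \ne i$ by
  $\tau_l^2 1_\nu = Q_{j,i}(x_l, x_{l+1}) 1_\nu$ and over a strand $i$ by the nil-Hecke relations. On the
  way to the negative value the degree is $0$ at some letter $i$ of the word, and there the relation
  reads $1_\nu = 0$.

  If $D$ is nonnegative: in the polynomial representation $\bigoplus_\nu K[x_1, \dots, x_n]$, set up
  with $i$ as the least colour, the ideals generated by the $F_l(x_{l+1})$ with $\nu_{l+1} = i$ form a
  submodule. It contains every summand with $\nu_1 = i$, because then $F_0 = 1$ is a generator. If all
  letters $i$ stand at the end of $\nu$, all generators are monic of positive degree in distinct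
  variables, so the ideal at $\nu$ is proper.
\<close>

text \<open>The same polynomials serve both directions, as relations in the algebra and as
  generators of ideals in the representation, and degree 0 is the only obstruction. A letter i
  lowers the degree by exactly one and no other letter lowers it. So D can become negative only at a
  letter i where it is 0; and if the letters i come last, D falls by ones to its final value, so a
  nonnegative final value forces D > 0 before each of them.

  Since K may have zero divisors, neither dimension counts nor cancellation in a domain are at hand.
  Properness is drawn from unit leading coefficients, and uniqueness of divided differences from the
  fact that a difference of two variables is not a zero divisor.

  In the algebra the factors commute only modulo the ideal, so there a relation is carried as a
  family of coefficients together with what they commute with. Both directions speak about ideals of
  the free algebra: one exhibits an ideal that misses 1, namely the annihilator of a quotient
  module; the other takes an arbitrary ideal containing the relators and the idempotent and shows
  that it contains 1.\<close>

lemma poly_mapping_single_induct [case_names zero single add]: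
  fixes p :: "'a \<Rightarrow>\<^sub>0 'b::comm_monoid_add"
  assumes zero: "P 0" and single: "\<And>a b. P (Poly_Mapping.single a b)"
    and add: "\<And>p q. P p \<Longrightarrow> P q \<Longrightarrow> P (p + q)"
  shows "P p"
proof (induction p rule: update_induct)
  case const
  then show ?case
    using zero unfolding zero_poly_mapping_def .
next
  case (update p a b)
  have "Poly_Mapping.update a b p = p + Poly_Mapping.single a b"
    using update.hyps(1)
    by (intro poly_mapping_eqI)
      (auto simp: lookup_update lookup_add lookup_single when_def in_keys_iff)
  then show ?case
    using update.IH single add by simp
qed

section \<open>Ring homomorphisms and their effect on polynomials\<close>

definition is_hom :: "('a::comm_ring_1 \<Rightarrow> 'b::comm_ring_1) \<Rightarrow> bool"
  where "is_hom f \<longleftrightarrow> f 0 = 0 \<and> f 1 = 1 \<and> (\<forall>a b. f (a + b) = f a + f b) \<and> (\<forall>a b. f (a * b) = f a * f b)"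

lemma is_homI:
  assumes "f 0 = 0" "f 1 = 1" "\<And>a b. f (a + b) = f a + f b" "\<And>a b. f (a * b) = f a * f b"
  shows "is_hom f"
  using assms by (auto simp: is_hom_def)

lemma is_hom_simps:
  assumes "is_hom f"
  shows "f 0 = 0" "f 1 = 1" "f (a + b) = f a + f b" "f (a * b) = f a * f b"
    "f (- a) = - f a" "f (a - b) = f a - f b" "f (a ^ n) = f a ^ n" "f (sum g S) = (\<Sum>s\<in>S. f (g s))"
proof -
  show 0: "f 0 = 0" "f 1 = 1" and add: "f (a + b) = f a + f b" and mult: "f (a * b) = f a * f b" for a b
    using assms by (auto simp: is_hom_def)
  show minus: "f (- a) = - f a" for a
    using 0 add[of a "- a"] by (simp add: eq_neg_iff_add_eq_0 add.commute)
  show "f (a - b) = f a - f b"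
    using add[of a "- b"] by (simp add: minus)
  show "f (a ^ n) = f a ^ n"
    by (induction n) (simp_all add: 0 mult)
  show "f (sum g S) = (\<Sum>s\<in>S. f (g s))"
    by (induction S rule: infinite_finite_induct) (simp_all add: 0 add)
qed

lemma is_hom_comp: "is_hom f \<Longrightarrow> is_hom g \<Longrightarrow> is_hom (\<lambda>a. g (f a))"
  by (auto simp: is_hom_def)

lemma is_hom_id: "is_hom (\<lambda>a. a)"
  by (simp add: is_hom_def)

lemma is_hom_const_poly: "is_hom (\<lambda>c. [:c:])"
  by (simp add: is_hom_def one_pCons)

lemma map_poly_add_hom:
  assumes "is_hom f"
  shows "map_poly f (p + q) = map_poly f p + map_poly f q"
  by (rule poly_eqI) (simp add: coeff_map_poly is_hom_simps[OF assms])

lemma map_poly_mult_hom: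
  assumes "is_hom f"
  shows "map_poly f (p * q) = map_poly f p * map_poly f q"
  by (rule poly_eqI) (simp add: coeff_map_poly coeff_mult is_hom_simps[OF assms])

lemma is_hom_map_poly: "is_hom f \<Longrightarrow> is_hom (map_poly f)"
  by (intro is_homI) (simp_all add: map_poly_add_hom map_poly_mult_hom is_hom_simps(2))

lemma poly_map_poly_hom:
  assumes "is_hom f"
  shows "poly (map_poly f p) (f a) = f (poly p a)"
  by (induction p) (simp_all add: map_poly_pCons is_hom_simps[OF assms])

text \<open>Synthetic division is a recursion in ring operations, so homomorphisms respect it. This
  is what carries the polynomials F_l from one coefficient ring to another.\<close>

lemma map_poly_synthetic_div:
  assumes "is_hom f"
  shows "map_poly f (synthetic_div p a) = synthetic_div (map_poly f p) (f a)"
  by (induction p)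
    (simp_all add: map_poly_pCons is_hom_simps[OF assms] poly_map_poly_hom[OF assms])

lemma hom_bipoly_eval:
  assumes "is_hom f"
  shows "f (bipoly_eval h q u v) = bipoly_eval (\<lambda>c. f (h c)) q (f u) (f v)"
  by (simp add: bipoly_eval_def is_hom_simps[OF assms] case_prod_unfold)

section \<open>Multivariate polynomials\<close>

type_synonym 'k mpoly = "(nat \<Rightarrow>\<^sub>0 nat) \<Rightarrow>\<^sub>0 'k"

definition Const :: "'k::comm_ring_1 \<Rightarrow> 'k mpoly"
  where "Const c = Poly_Mapping.single 0 c"

definition Var :: "nat \<Rightarrow> 'k::comm_ring_1 mpoly"
  where "Var l = Poly_Mapping.single (Poly_Mapping.single l 1) 1"

definition monom_eval :: "(nat \<Rightarrow> 'b::comm_ring_1) \<Rightarrow> (nat \<Rightarrow>\<^sub>0 nat) \<Rightarrow> 'b"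
  where "monom_eval x m = (\<Prod>l\<in>Poly_Mapping.keys m. x l ^ Poly_Mapping.lookup m l)"

definition mpoly_eval :: "('k::comm_ring_1 \<Rightarrow> 'b::comm_ring_1) \<Rightarrow> (nat \<Rightarrow> 'b) \<Rightarrow> 'k mpoly \<Rightarrow> 'b"
  where "mpoly_eval h x p =
    (\<Sum>m\<in>Poly_Mapping.keys p. h (Poly_Mapping.lookup p m) * monom_eval x m)"

lemma is_hom_Const: "is_hom Const"
  by (simp add: is_hom_def Const_def single_add mult_single)

lemma monom_eval_superset:
  assumes "finite A" "Poly_Mapping.keys m \<subseteq> A"
  shows "monom_eval x m = (\<Prod>l\<in>A. x l ^ Poly_Mapping.lookup m l)"
  unfolding monom_eval_def
  by (rule prod.mono_neutral_left) (use assms in \<open>auto simp: in_keys_iff\<close>)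

lemma monom_eval_add: "monom_eval x (m + m') = monom_eval x m * monom_eval x m'"
proof -
  let ?A = "Poly_Mapping.keys m \<union> Poly_Mapping.keys m'"
  have "Poly_Mapping.keys (m + m') \<subseteq> ?A"
    by (rule keys_add)
  then show ?thesis
    by (simp add: monom_eval_superset[of ?A] lookup_add power_add prod.distrib)
qed

lemma monom_eval_0: "monom_eval x 0 = 1"
  by (simp add: monom_eval_def)

lemma mpoly_eval_single:
  assumes "is_hom h"
  shows "mpoly_eval h x (Poly_Mapping.single m c) = h c * monom_eval x m"
  by (cases "c = 0") (simp_all add: mpoly_eval_def is_hom_simps[OF assms])

lemma mpoly_eval_add:
  assumes "is_hom h"
  shows "mpoly_eval h x (p + q) = mpoly_eval h x p + mpoly_eval h x q"
  unfolding mpoly_eval_def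
  by (rule setsum_keys_plus_distrib) (simp_all add: is_hom_simps[OF assms] algebra_simps)

lemma mpoly_eval_Const: "is_hom h \<Longrightarrow> mpoly_eval h x (Const c) = h c"
  by (simp add: Const_def mpoly_eval_single monom_eval_0)

lemma mpoly_eval_Var: "is_hom h \<Longrightarrow> mpoly_eval h x (Var l) = x l"
  by (simp add: Var_def mpoly_eval_single monom_eval_def is_hom_simps)

lemma mpoly_eval_mult:
  assumes "is_hom h"
  shows "mpoly_eval h x (p * q) = mpoly_eval h x p * mpoly_eval h x q"
proof (induction p rule: poly_mapping_single_induct)
  case (single m c)
  show ?case
  proof (induction q rule: poly_mapping_single_induct)
    case (single m' c')
    then show ?case
      by (simp add: mult_single mpoly_eval_single[OF assms] monom_eval_add is_hom_simps[OF assms])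
  qed (simp_all add: mpoly_eval_def[of _ _ 0] distrib_left mpoly_eval_add[OF assms])
qed (simp_all add: mpoly_eval_def[of _ _ 0] distrib_right mpoly_eval_add[OF assms])

lemma is_hom_mpoly_eval: "is_hom h \<Longrightarrow> is_hom (mpoly_eval h x)"
  using mpoly_eval_Const[of h x 1]
  by (intro is_homI) (auto simp: mpoly_eval_add mpoly_eval_mult is_hom_simps Const_def mpoly_eval_def[of _ _ 0])

lemma mpoly_induct [case_names Const Var add mult]:
  fixes p :: "'k::comm_ring_1 mpoly"
  assumes Const: "\<And>c. P (Const c)" and Var: "\<And>l. P (Var l)"
    and add: "\<And>p q. P p \<Longrightarrow> P q \<Longrightarrow> P (p + q)" and mult: "\<And>p q. P p \<Longrightarrow> P q \<Longrightarrow> P (p * q)"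
  shows "P p"
proof (induction p rule: poly_mapping_single_induct)
  case zero
  then show ?case
    using Const[of 0] by (simp add: Const_def)
next
  case (single m c)
  have power: "P (Poly_Mapping.single (Poly_Mapping.single l n) 1)" for l n
  proof (induction n)
    case 0
    then show ?case
      using Const[of 1] by (simp add: Const_def)
  next
    case (Suc n)
    have "Poly_Mapping.single (Poly_Mapping.single l (Suc n)) 1 =
        Var l * Poly_Mapping.single (Poly_Mapping.single l n) (1 :: 'k)"
      by (simp add: Var_def mult_single single_add[symmetric])
    then show ?case
      using mult[OF Var Suc] by simp
  qed
  have "P (Poly_Mapping.single m 1)"
  proof (induction m rule: poly_mapping_single_induct)
    case zero
    then show ?case
      using Const[of 1] by (simp add: Const_def)
  next
    case (add m m')
    then show ?case
      using mult[OF add] by (simp add: mult_single)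
  qed (rule power)
  from mult[OF Const[of c] this] show ?case
    by (simp add: Const_def mult_single)
qed (rule add)

text \<open>The uniqueness half of the universal property of K[x]: identities between substitutions
  are checked on a single variable.\<close>

lemma mpoly_hom_eqI:
  assumes f: "is_hom f" and g: "is_hom g"
    and "\<And>c. f (Const c) = g (Const c)" "\<And>l. f (Var l) = g (Var l)"
  shows "f p = g p"
  by (induction p rule: mpoly_induct) (simp_all add: assms is_hom_simps[OF f] is_hom_simps[OF g])

section \<open>Differences of variables are not zero divisors\<close>

lemma linear_poly_mult_eq_0:
  fixes p :: "'a::comm_ring_1 poly"
  assumes "[:- b, 1:] * p = 0"
  shows "p = 0"
  using assms synthetic_div_unique_lemma[of b p 0] by (simp add: add.commute)

text \<open>K[x] read as polynomials in x_a. The coefficients keep the type of all variables,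
  although x_a no longer occurs in them, so that substituting x_a for the indeterminate recovers the
  original.\<close>

definition split_var :: "nat \<Rightarrow> 'k::comm_ring_1 mpoly \<Rightarrow> 'k mpoly poly"
  where "split_var a = mpoly_eval (\<lambda>c. [:Const c:]) (\<lambda>l. if l = a then [:0, 1:] else [:Var l:])"

lemma is_hom_split_var: "is_hom (split_var a)"
  unfolding split_var_def
  by (intro is_hom_mpoly_eval is_hom_comp[OF is_hom_Const is_hom_const_poly])

lemma split_var_Var: "split_var a (Var l) = (if l = a then [:0, 1:] else [:Var l:])"
  unfolding split_var_def
  by (intro mpoly_eval_Var is_hom_comp[OF is_hom_Const is_hom_const_poly])

lemma split_var_Const: "split_var a (Const c) = [:Const c:]"
  unfolding split_var_def
  by (intro mpoly_eval_Const is_hom_comp[OF is_hom_Const is_hom_const_poly])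

lemma is_hom_poly: "is_hom (\<lambda>p. poly p a)"
  by (simp add: is_hom_def)

lemma poly_split_var: "poly (split_var a p) (Var a) = p"
  by (rule mpoly_hom_eqI[OF is_hom_comp[OF is_hom_split_var is_hom_poly] is_hom_id])
    (simp_all add: split_var_Var split_var_Const)

text \<open>K[x] need not be a domain, but x_a - x_b is monic of degree one in x_a, and such a
  factor can be cancelled. Identities between operators are therefore provable after clearing
  denominators.\<close>

lemma Var_diff_mult_eq_0:
  assumes "a \<noteq> b" "(Var a - Var b) * p = 0"
  shows "p = 0"
proof -
  have "split_var a ((Var a - Var b) * p) = [:- Var b, 1:] * split_var a p"
    using \<open>a \<noteq> b\<close> by (simp only: is_hom_simps[OF is_hom_split_var]) (simp add: split_var_Var)
  then have "split_var a p = 0"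
    using assms(2) linear_poly_mult_eq_0 by (metis is_hom_simps(1) is_hom_split_var)
  then show ?thesis
    using poly_split_var[of a p] by simp
qed

lemma Var_diff_cancel:
  assumes "a \<noteq> b" "(Var a - Var b) * p = (Var a - Var b) * q"
  shows "p = q"
  using Var_diff_mult_eq_0[OF assms(1), of "p - q"] assms(2) by (simp add: algebra_simps)

section \<open>Transpositions of variables and Demazure operators\<close>

definition swap_vars :: "nat \<Rightarrow> 'k::comm_ring_1 mpoly \<Rightarrow> 'k mpoly"
  where "swap_vars k = mpoly_eval Const (\<lambda>l. Var (Transposition.transpose k (Suc k) l))"

lemma is_hom_swap_vars: "is_hom (swap_vars k)"
  unfolding swap_vars_def by (intro is_hom_mpoly_eval is_hom_Const)

lemmas swap_vars_simps = is_hom_simps[OF is_hom_swap_vars]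

lemma swap_vars_Const [simp]: "swap_vars k (Const c) = Const c"
  unfolding swap_vars_def by (rule mpoly_eval_Const[OF is_hom_Const])

lemma swap_vars_Var: "swap_vars k (Var l) = Var (Transposition.transpose k (Suc k) l)"
  unfolding swap_vars_def by (rule mpoly_eval_Var[OF is_hom_Const])

lemma swap_vars_Var_simps [simp]:
  "swap_vars k (Var k) = Var (Suc k)" "swap_vars k (Var (Suc k)) = Var k"
  "l \<noteq> k \<Longrightarrow> l \<noteq> Suc k \<Longrightarrow> swap_vars k (Var l) = Var l"
  by (simp_all add: swap_vars_Var)

lemma swap_vars_swap_vars [simp]: "swap_vars k (swap_vars k p) = p"
  by (rule mpoly_hom_eqI[OF is_hom_comp[OF is_hom_swap_vars is_hom_swap_vars] is_hom_id]) (simp_all add: swap_vars_Var)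

lemma swap_vars_commute:
  assumes "Suc k < l \<or> Suc l < k"
  shows "swap_vars k (swap_vars l p) = swap_vars l (swap_vars k p)"
  by (rule mpoly_hom_eqI[OF is_hom_comp[OF is_hom_swap_vars is_hom_swap_vars] is_hom_comp[OF is_hom_swap_vars is_hom_swap_vars]])
    (use assms in \<open>auto simp: swap_vars_Var Transposition.transpose_def\<close>)

lemma swap_vars_braid: "swap_vars (Suc k) (swap_vars k (swap_vars (Suc k) p)) = swap_vars k (swap_vars (Suc k) (swap_vars k p))"
proof -
  have h: "is_hom (\<lambda>p. swap_vars a (swap_vars b (swap_vars c p)))" for a b c
    by (intro is_hom_comp[OF is_hom_comp[OF is_hom_swap_vars is_hom_swap_vars] is_hom_swap_vars])
  show ?thesis
    by (rule mpoly_hom_eqI[OF h h]) (auto simp: swap_vars_Var Transposition.transpose_def)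
qed

lemma ex_divided_difference: "\<exists>q. (Var k - Var (Suc k)) * q = swap_vars k p - p"
proof (induction p rule: mpoly_induct)
  case (Const c)
  show ?case
    by (rule exI[of _ 0]) simp
next
  case (Var l)
  consider "l = k" | "l = Suc k" | "l \<noteq> k" "l \<noteq> Suc k" by blast
  then show ?case
  proof cases
    case 1
    then show ?thesis by (intro exI[of _ "- 1"]) simp
  next
    case 2
    then show ?thesis by (intro exI[of _ 1]) simp
  next
    case 3
    then show ?thesis by (intro exI[of _ 0]) simp
  qed
next
  case (add p q)
  then obtain p' q' where "(Var k - Var (Suc k)) * p' = swap_vars k p - p" "(Var k - Var (Suc k)) * q' = swap_vars k q - q"
    by blast
  then show ?case
    by (intro exI[of _ "p' + q'"]) (simp add: swap_vars_simps distrib_left)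
next
  case (mult p q)
  then obtain p' q' where p': "(Var k - Var (Suc k)) * p' = swap_vars k p - p"
    and q': "(Var k - Var (Suc k)) * q' = swap_vars k q - q"
    by blast
  \<comment> \<open>The quotient for a product comes from s(p) s(q) - p q = (s(p) - p) s(q) + p
    (s(q) - q).\<close>
  have "(Var k - Var (Suc k)) * (p' * swap_vars k q + p * q') =
      ((Var k - Var (Suc k)) * p') * swap_vars k q + p * ((Var k - Var (Suc k)) * q')"
    by (simp only: algebra_simps)
  also have "\<dots> = swap_vars k (p * q) - p * q"
    by (simp only: p' q' swap_vars_simps) (simp add: algebra_simps)
  finally show ?case by blast
qed

text \<open>The choice is determined, since x_k - x_{k+1} can be cancelled. The sign makes the value
  at x_{k+1} equal to 1, as the relation between tau_k and x_{k+1} demands.\<close>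

definition demazure :: "nat \<Rightarrow> 'k::comm_ring_1 mpoly \<Rightarrow> 'k mpoly"
  where "demazure k p = (SOME q. (Var k - Var (Suc k)) * q = swap_vars k p - p)"

lemma demazure: "(Var k - Var (Suc k)) * demazure k p = swap_vars k p - p"
  unfolding demazure_def by (rule someI_ex) (rule ex_divided_difference)

lemma demazure_eqI: "(Var k - Var (Suc k)) * q = swap_vars k p - p \<Longrightarrow> demazure k p = q"
  by (rule Var_diff_cancel[of k "Suc k"]) (simp_all add: demazure)

lemma demazure_add: "demazure k (p + q) = demazure k p + demazure k q"
  by (rule demazure_eqI) (simp add: distrib_left demazure swap_vars_simps)

lemma demazure_mult: "demazure k (p * q) = demazure k p * q + swap_vars k p * demazure k q"
proof (rule demazure_eqI)
  have "(Var k - Var (Suc k)) * (demazure k p * q + swap_vars k p * demazure k q) =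
      ((Var k - Var (Suc k)) * demazure k p) * q + swap_vars k p * ((Var k - Var (Suc k)) * demazure k q)"
    by (simp only: algebra_simps)
  then show "(Var k - Var (Suc k)) * (demazure k p * q + swap_vars k p * demazure k q) = swap_vars k (p * q) - p * q"
    by (simp only: demazure swap_vars_simps) (simp add: algebra_simps)
qed

lemma demazure_invariant: "swap_vars k p = p \<Longrightarrow> demazure k p = 0"
  by (rule demazure_eqI) simp

lemma demazure_mult_invariant: "swap_vars k p = p \<Longrightarrow> demazure k (p * q) = p * demazure k q"
  by (simp add: demazure_mult demazure_invariant)

lemma demazure_Const [simp]: "demazure k (Const c) = 0"
  by (simp add: demazure_invariant)

lemma demazure_0 [simp]: "demazure k 0 = 0"
  by (simp add: demazure_invariant swap_vars_simps)

lemma demazure_Var: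
  "demazure k (Var l) = (if l = Suc k then 1 else if l = k then - 1 else 0)"
  by (rule demazure_eqI) auto

text \<open>Numerator and denominator both change sign under the transposition.\<close>

lemma swap_vars_demazure [simp]: "swap_vars k (demazure k p) = demazure k p"
proof (rule Var_diff_cancel[of "Suc k" k])
  have "swap_vars k ((Var k - Var (Suc k)) * demazure k p) = swap_vars k (swap_vars k p - p)"
    by (simp only: demazure)
  then have "(Var (Suc k) - Var k) * swap_vars k (demazure k p) = p - swap_vars k p"
    by (simp add: swap_vars_simps)
  also have "\<dots> = - ((Var k - Var (Suc k)) * demazure k p)"
    by (simp add: demazure)
  finally show "(Var (Suc k) - Var k) * swap_vars k (demazure k p) = (Var (Suc k) - Var k) * demazure k p"
    by (simp add: minus_mult_left del: mult_minus_left)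
qed simp

lemma demazure_demazure [simp]: "demazure k (demazure k p) = 0"
  by (simp add: demazure_invariant)

lemma swap_vars_demazure_commute:
  assumes "Suc k < l \<or> Suc l < k"
  shows "swap_vars l (demazure k p) = demazure k (swap_vars l p)"
proof (rule sym, rule demazure_eqI)
  have "swap_vars l ((Var k - Var (Suc k)) * demazure k p) = swap_vars l (swap_vars k p - p)"
    by (simp only: demazure)
  then show "(Var k - Var (Suc k)) * swap_vars l (demazure k p) = swap_vars k (swap_vars l p) - swap_vars l p"
    using assms by (auto simp: swap_vars_simps swap_vars_commute[OF assms])
qed

lemma demazure_commute:
  assumes "Suc k < l \<or> Suc l < k"
  shows "demazure l (demazure k p) = demazure k (demazure l p)"
proof (rule demazure_eqI)
  have inv: "swap_vars k (Var l - Var (Suc l)) = Var l - Var (Suc l)"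
    using assms by (auto simp: swap_vars_simps)
  have "(Var l - Var (Suc l)) * demazure k (demazure l p) = demazure k (swap_vars l p - p)"
    by (simp only: demazure_mult_invariant[OF inv, symmetric] demazure)
  also have "\<dots> = demazure k (swap_vars l p) - demazure k p"
    using demazure_add[of k "swap_vars l p - p" p] by simp
  finally show "(Var l - Var (Suc l)) * demazure k (demazure l p) = swap_vars l (demazure k p) - demazure k p"
    by (simp add: swap_vars_demazure_commute[OF assms])
qed

section \<open>Operators of the polynomial representation\<close>

lemma swap_vars_bipoly_eval:
  "swap_vars k (bipoly_eval Const q u v) = bipoly_eval Const q (swap_vars k u) (swap_vars k v)"
  by (simp add: hom_bipoly_eval[OF is_hom_swap_vars])

lemma bipoly_eval_swap:
  fixes u v :: "'a::comm_ring_1"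
  assumes "\<And>s r. Poly_Mapping.lookup q (s, r) = Poly_Mapping.lookup q' (r, s)"
  shows "bipoly_eval h q u v = bipoly_eval h q' v u"
proof -
  have keys: "Poly_Mapping.keys q' = prod.swap ` Poly_Mapping.keys q"
    by (rule Set.set_eqI) (auto simp: in_keys_iff assms pair_in_swap_image)
  show ?thesis
    unfolding bipoly_eval_def keys
    by (subst sum.reindex) (auto simp: assms mult_ac intro!: sum.cong)
qed

text \<open>\<open>lt\<close> orients each pair of distinct colours. Only the crossing that follows
  the orientation carries the polynomial \<open>Q\<close>; the opposite crossing merely exchanges
  the variables, so that the two compose to multiplication by \<open>Q\<close>.\<close>

locale klr_rep = klr_datum form t Q
  for form :: "'i lattice_form" and t :: "'i \<Rightarrow> 'i \<Rightarrow> 'k::comm_ring_1" and Q +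
  fixes i :: 'i and lt :: "'i \<Rightarrow> 'i \<Rightarrow> bool"
  assumes lt_tournament: "a \<noteq> b \<Longrightarrow> lt a b \<longleftrightarrow> \<not> lt b a"
    and lt_least: "a \<noteq> i \<Longrightarrow> lt i a"
begin

definition edge_factor :: "'i \<Rightarrow> 'i \<Rightarrow> 'k mpoly \<Rightarrow> 'k mpoly \<Rightarrow> 'k mpoly"
  where "edge_factor a b u v = (if lt a b then bipoly_eval Const (Q a b) u v else 1)"

lemma swap_vars_edge_factor: "swap_vars k (edge_factor a b u v) = edge_factor a b (swap_vars k u) (swap_vars k v)"
  by (simp add: edge_factor_def swap_vars_bipoly_eval swap_vars_simps)

lemma edge_factor_mult:
  "a \<noteq> b \<Longrightarrow> edge_factor a b u v * edge_factor b a v u = bipoly_eval Const (Q a b) u v"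
  using lt_tournament[of a b] bipoly_eval_swap[OF Q_sym, of Const a b u v]
  by (auto simp: edge_factor_def)

definition tau_op :: "nat \<Rightarrow> 'i \<Rightarrow> 'i \<Rightarrow> 'k mpoly \<Rightarrow> 'k mpoly"
  where "tau_op k a b f =
    (if a = b then demazure k f else edge_factor a b (Var (Suc k)) (Var k) * swap_vars k f)"

lemma tau_op_add: "tau_op k a b (f + g) = tau_op k a b f + tau_op k a b g"
  by (simp add: tau_op_def demazure_add swap_vars_simps distrib_left)

lemma tau_op_0 [simp]: "tau_op k a b 0 = 0"
  by (simp add: tau_op_def swap_vars_simps)

lemma tau_op_Const: "tau_op k a b (Const c * f) = Const c * tau_op k a b f"
  by (simp add: tau_op_def demazure_mult_invariant swap_vars_simps)

lemma tau_op_square: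
  "tau_op k b a (tau_op k a b f) = bipoly_eval Const (Q a b) (Var k) (Var (Suc k)) * f"
proof (cases "a = b")
  case True
  then show ?thesis
    by (simp add: tau_op_def Q_diag bipoly_eval_def)
next
  case False
  then show ?thesis
    by (simp add: tau_op_def swap_vars_simps swap_vars_edge_factor edge_factor_mult[symmetric] mult_ac)
qed

lemma tau_op_Var:
  "tau_op k a b (Var l * f) = Var (Transposition.transpose k (Suc k) l) * tau_op k a b f +
    (if l = Suc k \<and> a = b then f else if l = k \<and> a = b then - f else 0)"
  by (auto simp: tau_op_def demazure_mult demazure_Var swap_vars_simps swap_vars_Var)

lemma tau_op_commute:
  assumes "Suc k < l \<or> Suc l < k"
  shows "tau_op k a b (tau_op l c d f) = tau_op l c d (tau_op k a b f)"
proof -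
  have k: "swap_vars k (edge_factor c d (Var (Suc l)) (Var l)) = edge_factor c d (Var (Suc l)) (Var l)"
    and l: "swap_vars l (edge_factor a b (Var (Suc k)) (Var k)) = edge_factor a b (Var (Suc k)) (Var k)"
    using assms by (auto simp: swap_vars_edge_factor)
  have l': "Suc l < k \<or> Suc k < l"
    using assms by auto
  show ?thesis
    by (auto simp: tau_op_def demazure_mult_invariant k l swap_vars_simps swap_vars_commute[OF assms]
        demazure_commute[OF assms] swap_vars_demazure_commute[OF assms] swap_vars_demazure_commute[OF l'])
qed

end

section \<open>Braid relations\<close>

lemma swap_vars_Suc_cross:
  "(Var k - Var (Suc (Suc k))) * swap_vars (Suc k) (demazure k f) = swap_vars (Suc k) (swap_vars k f) - swap_vars (Suc k) f"
  "(Var k - Var (Suc (Suc k))) * swap_vars k (demazure (Suc k) f) = swap_vars k (swap_vars (Suc k) f) - swap_vars k f"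
  "(Var k - Var (Suc k)) * swap_vars (Suc k) (swap_vars k (demazure (Suc k) f)) =
    swap_vars (Suc k) (swap_vars k (swap_vars (Suc k) f)) - swap_vars (Suc k) (swap_vars k f)"
  "(Var (Suc k) - Var (Suc (Suc k))) * swap_vars k (swap_vars (Suc k) (demazure k f)) =
    swap_vars k (swap_vars (Suc k) (swap_vars k f)) - swap_vars k (swap_vars (Suc k) f)"
proof -
  \<comment> \<open>Each identity is the defining equation of \<open>demazure\<close> with
    transpositions applied; the denominator is permuted along.\<close>
  have "swap_vars (Suc k) ((Var k - Var (Suc k)) * demazure k f) = swap_vars (Suc k) (swap_vars k f - f)"
    by (simp only: demazure)
  then show 1: "(Var k - Var (Suc (Suc k))) * swap_vars (Suc k) (demazure k f) = swap_vars (Suc k) (swap_vars k f) - swap_vars (Suc k) f"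
    by (simp add: swap_vars_simps)
  have "swap_vars k ((Var (Suc k) - Var (Suc (Suc k))) * demazure (Suc k) f) = swap_vars k (swap_vars (Suc k) f - f)"
    by (simp only: demazure)
  then show 2: "(Var k - Var (Suc (Suc k))) * swap_vars k (demazure (Suc k) f) = swap_vars k (swap_vars (Suc k) f) - swap_vars k f"
    by (simp add: swap_vars_simps)
  have "swap_vars (Suc k) ((Var k - Var (Suc (Suc k))) * swap_vars k (demazure (Suc k) f)) =
      swap_vars (Suc k) (swap_vars k (swap_vars (Suc k) f) - swap_vars k f)"
    by (simp only: 2)
  then show "(Var k - Var (Suc k)) * swap_vars (Suc k) (swap_vars k (demazure (Suc k) f)) =
      swap_vars (Suc k) (swap_vars k (swap_vars (Suc k) f)) - swap_vars (Suc k) (swap_vars k f)"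
    by (simp add: swap_vars_simps)
  have "swap_vars k ((Var k - Var (Suc (Suc k))) * swap_vars (Suc k) (demazure k f)) =
      swap_vars k (swap_vars (Suc k) (swap_vars k f) - swap_vars (Suc k) f)"
    by (simp only: 1)
  then show "(Var (Suc k) - Var (Suc (Suc k))) * swap_vars k (swap_vars (Suc k) (demazure k f)) =
      swap_vars k (swap_vars (Suc k) (swap_vars k f)) - swap_vars k (swap_vars (Suc k) f)"
    by (simp add: swap_vars_simps)
qed

text \<open>The product s_k s_{k+1} conjugates s_k into s_{k+1} and takes x_k - x_{k+1} to x_{k+1} -
  x_{k+2}; the second identity is the mirror image.\<close>

lemma demazure_swap_vars:
  "demazure (Suc k) (swap_vars k (swap_vars (Suc k) f)) = swap_vars k (swap_vars (Suc k) (demazure k f))"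
  "demazure k (swap_vars (Suc k) (swap_vars k f)) = swap_vars (Suc k) (swap_vars k (demazure (Suc k) f))"
  by (rule demazure_eqI, simp add: swap_vars_Suc_cross swap_vars_braid)+

lemma demazure_braid:
  "demazure (Suc k) (demazure k (demazure (Suc k) f)) = demazure k (demazure (Suc k) (demazure k f))"
proof -
  define x y z :: "'a mpoly" where "x = Var k" and "y = Var (Suc k)" and "z = Var (Suc (Suc k))"
  note xyz = x_def[symmetric] y_def[symmetric] z_def[symmetric]
  define s r where "s = swap_vars k f" and "r = swap_vars (Suc k) f"
  let ?A = "demazure (Suc k) (demazure k (demazure (Suc k) f))"
  let ?B = "demazure k (demazure (Suc k) (demazure k f))"
  \<comment> \<open>Minus the alternating sum of the six permuted copies of f. Both triple operators
    turn out to be this sum divided by (x - y)(x - z)(y - z).\<close>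
  let ?w = "swap_vars k (swap_vars (Suc k) (swap_vars k f)) - swap_vars k (swap_vars (Suc k) f) - swap_vars (Suc k) (swap_vars k f) + swap_vars k f + swap_vars (Suc k) f - f"
  have "(x - y) * ((x - z) * ((y - z) * ?A)) =
     (x - y) * ((x - z) * (swap_vars (Suc k) (demazure k (demazure (Suc k) f)) - demazure k (demazure (Suc k) f)))"
    unfolding x_def y_def z_def by (simp only: demazure)
  also have "\<dots> = (x - y) * ((x - z) * swap_vars (Suc k) (demazure k (demazure (Suc k) f)))
      - (x - z) * ((x - y) * demazure k (demazure (Suc k) f))"
    by (simp only: algebra_simps)
  also have "\<dots> = (x - y) * (swap_vars (Suc k) (swap_vars k (demazure (Suc k) f)) - demazure (Suc k) f)
      - (x - z) * (swap_vars k (demazure (Suc k) f) - demazure (Suc k) f)"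
    unfolding x_def y_def z_def by (simp only: demazure swap_vars_Suc_cross swap_vars_demazure)
  also have "\<dots> = (x - y) * swap_vars (Suc k) (swap_vars k (demazure (Suc k) f)) - (x - z) * swap_vars k (demazure (Suc k) f)
      + (y - z) * demazure (Suc k) f"
    by (simp add: algebra_simps)
  also have "\<dots> = ?w"
    unfolding x_def y_def z_def by (simp only: demazure swap_vars_Suc_cross swap_vars_braid) simp
  finally have A: "(x - y) * ((x - z) * ((y - z) * ?A)) = ?w" .
  have "(x - y) * ((x - z) * ((y - z) * ?B)) = (y - z) * ((x - z) * ((x - y) * ?B))"
    by (simp only: algebra_simps)
  also have "\<dots> =
     (y - z) * ((x - z) * (swap_vars k (demazure (Suc k) (demazure k f)) - demazure (Suc k) (demazure k f)))"
    unfolding x_def y_def z_def by (simp only: demazure)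
  also have "\<dots> = (y - z) * ((x - z) * swap_vars k (demazure (Suc k) (demazure k f)))
      - (x - z) * ((y - z) * demazure (Suc k) (demazure k f))"
    by (simp only: algebra_simps)
  also have "\<dots> = (y - z) * (swap_vars k (swap_vars (Suc k) (demazure k f)) - demazure k f)
      - (x - z) * (swap_vars (Suc k) (demazure k f) - demazure k f)"
    unfolding x_def y_def z_def by (simp only: demazure swap_vars_Suc_cross swap_vars_demazure)
  also have "\<dots> = (y - z) * swap_vars k (swap_vars (Suc k) (demazure k f)) - (x - z) * swap_vars (Suc k) (demazure k f)
      + (x - y) * demazure k f"
    by (simp add: algebra_simps)
  also have "\<dots> = ?w"
    unfolding x_def y_def z_def by (simp only: demazure swap_vars_Suc_cross swap_vars_braid) simp
  finally have "(x - y) * ((x - z) * ((y - z) * ?A)) = (x - y) * ((x - z) * ((y - z) * ?B))"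
    using A by simp
  then have "(x - z) * ((y - z) * ?A) = (x - z) * ((y - z) * ?B)"
    unfolding x_def y_def by (rule Var_diff_cancel[rotated]) simp
  then have "(y - z) * ?A = (y - z) * ?B"
    unfolding x_def z_def by (rule Var_diff_cancel[rotated]) simp
  then show ?thesis
    unfolding y_def z_def by (rule Var_diff_cancel[rotated]) simp
qed

context klr_rep
begin

text \<open>The cases are the coincidences among the three colours. The correction appears only when
  the outer colours agree and the middle one differs; for three equal colours
  \<open>Q a a = 0\<close>.\<close>

lemma tau_op_braid:
  "tau_op (Suc k) a b (tau_op k a c (tau_op (Suc k) b c f)) -
    tau_op k b c (tau_op (Suc k) a c (tau_op k a b f)) =
    (if a = c then bipoly_dd Const (Q a b) (Var (Suc (Suc k))) (Var k) (Var (Suc k)) * f else 0)"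
proof -
  define x y z :: "'k mpoly" where "x = Var k" and "y = Var (Suc k)" and "z = Var (Suc (Suc k))"
  have swap_vars_xyz: "swap_vars k x = y" "swap_vars k y = x" "swap_vars k z = z"
    "swap_vars (Suc k) x = x" "swap_vars (Suc k) y = z" "swap_vars (Suc k) z = y"
    by (simp_all add: x_def y_def z_def)
  note tau = tau_op_def x_def[symmetric] y_def[symmetric] z_def[symmetric]
  consider "a = b" "b = c" | "a = b" "b \<noteq> c" | "b = c" "a \<noteq> b" | "a = c" "a \<noteq> b"
    | "a \<noteq> b" "b \<noteq> c" "a \<noteq> c"
    by blast
  then show ?thesis
  proof cases
    case 1
    then show ?thesis
      by (simp add: tau_op_def demazure_braid Q_diag bipoly_dd_def)
  next
    case 2
    \<comment> \<open>The two crossings of c with the equal colours contribute a product symmetric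
      in y and z, which passes through the divided difference.\<close>
    have inv: "swap_vars (Suc k) (edge_factor a c y x * edge_factor a c z x) =
        edge_factor a c y x * edge_factor a c z x"
      by (simp add: swap_vars_simps swap_vars_edge_factor swap_vars_xyz mult.commute)
    show ?thesis
      using 2 demazure_mult_invariant[OF inv, of "swap_vars k (swap_vars (Suc k) f)"]
      by (simp add: tau swap_vars_simps swap_vars_edge_factor swap_vars_xyz demazure_swap_vars mult.assoc)
  next
    case 3
    have inv: "swap_vars k (edge_factor a c z y * edge_factor a c z x) =
        edge_factor a c z y * edge_factor a c z x"
      by (simp add: swap_vars_simps swap_vars_edge_factor swap_vars_xyz mult.commute)
    show ?thesis
      using 3 demazure_mult_invariant[OF inv, of "swap_vars (Suc k) (swap_vars k f)"]
      by (simp add: tau swap_vars_simps swap_vars_edge_factor swap_vars_xyz demazure_swap_vars mult.assoc)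
  next
    case 4
    \<comment> \<open>The middle operator is a divided difference, and conjugation makes its
      denominator x - z. The terms with the fully reversed f agree on both sides and cancel; Q(x, y)
      f - Q(z, y) f is left over, and dividing it by x - z gives the correction.\<close>
    define g where "g = edge_factor b a z y * swap_vars (Suc k) f"
    define h where "h = edge_factor a b y x * swap_vars k f"
    have "(x - z) * (edge_factor a b z y * swap_vars (Suc k) (demazure k g)) =
        edge_factor a b z y * ((x - z) * swap_vars (Suc k) (demazure k g))"
      by (simp only: ac_simps)
    also have "\<dots> = edge_factor a b z y * (swap_vars (Suc k) (swap_vars k g) - swap_vars (Suc k) g)"
      by (simp only: x_def z_def swap_vars_Suc_cross)
    also have "\<dots> = edge_factor a b z y * edge_factor b a y x * swap_vars k (swap_vars (Suc k) (swap_vars k f))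
        - (edge_factor a b z y * edge_factor b a y z) * f"
      by (simp add: g_def swap_vars_simps swap_vars_edge_factor swap_vars_xyz swap_vars_braid algebra_simps)
    finally have 1: "(x - z) * (edge_factor a b z y * swap_vars (Suc k) (demazure k g)) =
        edge_factor a b z y * edge_factor b a y x * swap_vars k (swap_vars (Suc k) (swap_vars k f)) -
        bipoly_eval Const (Q a b) z y * f"
      using 4 by (simp add: edge_factor_mult)
    have "(x - z) * (edge_factor b a y x * swap_vars k (demazure (Suc k) h)) =
        edge_factor b a y x * ((x - z) * swap_vars k (demazure (Suc k) h))"
      by (simp only: ac_simps)
    also have "\<dots> = edge_factor b a y x * (swap_vars k (swap_vars (Suc k) h) - swap_vars k h)"
      by (simp only: x_def z_def swap_vars_Suc_cross)
    also have "\<dots> = edge_factor a b z y * edge_factor b a y x * swap_vars k (swap_vars (Suc k) (swap_vars k f))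
        - (edge_factor a b x y * edge_factor b a y x) * f"
      by (simp add: h_def swap_vars_simps swap_vars_edge_factor swap_vars_xyz algebra_simps)
    finally have 2: "(x - z) * (edge_factor b a y x * swap_vars k (demazure (Suc k) h)) =
        edge_factor a b z y * edge_factor b a y x * swap_vars k (swap_vars (Suc k) (swap_vars k f)) -
        bipoly_eval Const (Q a b) x y * f"
      using 4 by (simp add: edge_factor_mult)
    have dd: "(x - z) * bipoly_dd Const (Q a b) z x y =
        bipoly_eval Const (Q a b) x y - bipoly_eval Const (Q a b) z y"
      using bipoly_dd_eq[of z x Const "Q a b" y] by (simp add: algebra_simps)
    have "(x - z) * (edge_factor a b z y * swap_vars (Suc k) (demazure k g)
          - edge_factor b a y x * swap_vars k (demazure (Suc k) h)) =
        (bipoly_eval Const (Q a b) x y - bipoly_eval Const (Q a b) z y) * f"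
      using 1 2 by (simp add: right_diff_distrib left_diff_distrib)
    also have "\<dots> = (x - z) * (bipoly_dd Const (Q a b) z x y * f)"
      by (simp only: dd[symmetric] mult.assoc)
    finally have "edge_factor a b z y * swap_vars (Suc k) (demazure k g)
          - edge_factor b a y x * swap_vars k (demazure (Suc k) h) = bipoly_dd Const (Q a b) z x y * f"
      unfolding x_def z_def by (rule Var_diff_cancel[rotated]) simp
    then show ?thesis
      using 4 by (simp add: tau g_def h_def)
  next
    case 5
    then show ?thesis
      by (simp add: tau swap_vars_simps swap_vars_edge_factor swap_vars_xyz swap_vars_braid mult_ac)
  qed
qed

end

section \<open>Division by monic polynomials\<close>

lemma synthetic_div_add: "synthetic_div (p + q) a = synthetic_div p a + synthetic_div q a"
  by (induction p q rule: poly_induct2) simp_all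

lemma synthetic_div_smult: "synthetic_div (smult c p) a = smult c (synthetic_div p a)"
  by (induction p) simp_all

lemma synthetic_div_linear_mult:
  fixes p :: "'a::comm_ring_1 poly"
  shows "synthetic_div ([:- a, 1:] * p) a = p"
  using synthetic_div_unique[of "[:- a, 1:] * p" a p 0] by simp

text \<open>The Leibniz rule for divided differences, from p = (X - a) p' + p(a).\<close>

lemma synthetic_div_mult:
  fixes p :: "'a::comm_ring_1 poly"
  shows "synthetic_div (p * q) a = synthetic_div p a * q + smult (poly p a) (synthetic_div q a)"
proof -
  have "p * q = ([:- a, 1:] * synthetic_div p a + [:poly p a:]) * q"
    by (simp only: synthetic_div_correct')
  also have "\<dots> = [:- a, 1:] * (synthetic_div p a * q) + smult (poly p a) q"
    by (simp only: distrib_right mult.assoc) simp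
  finally show ?thesis
    by (simp only: synthetic_div_add synthetic_div_linear_mult synthetic_div_smult)
qed

lemma poly_synthetic_div:
  fixes p :: "'a::comm_ring_1 poly"
  shows "(b - a) * poly (synthetic_div p a) b = poly p b - poly p a"
proof -
  have "poly p b = poly ([:- a, 1:] * synthetic_div p a + [:poly p a:]) b"
    by (simp only: synthetic_div_correct')
  then show ?thesis by (simp add: algebra_simps)
qed

text \<open>Both sides stand for (p(b) - p(a)) / (b - a). As b - a may be a zero divisor, symmetry
  is proved by induction on p instead of by cancellation.\<close>

lemma poly_synthetic_div_commute:
  fixes p :: "'a::comm_ring_1 poly"
  shows "poly (synthetic_div p a) b = poly (synthetic_div p b) a"
proof (induction p)
  case (pCons c p)
  then show ?case
    using poly_synthetic_div[of b a p] by (simp add: algebra_simps)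
qed simp

lemma synthetic_div_commute:
  fixes p :: "'a::comm_ring_1 poly"
  shows "synthetic_div (synthetic_div p a) b = synthetic_div (synthetic_div p b) a"
  by (induction p) (simp_all add: poly_synthetic_div_commute[of _ a b])

section \<open>Unit leading coefficients and proper ideals\<close>

definition unit_monic :: "nat \<Rightarrow> 'a::comm_ring_1 poly \<Rightarrow> bool"
  where "unit_monic n p \<longleftrightarrow> degree p \<le> n \<and> coeff p n dvd 1"

lemma unit_monic_1: "unit_monic 0 1"
  by (simp add: unit_monic_def)

lemma unit_monic_synthetic_div:
  assumes "unit_monic (Suc n) p"
  shows "unit_monic n (synthetic_div p a)"
proof -
  have deg: "degree (synthetic_div p a) \<le> n"
    using assms by (auto simp: unit_monic_def degree_synthetic_div)
  have "coeff (p + smult a (synthetic_div p a)) (Suc n) = coeff (synthetic_div p a) n"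
    by (subst synthetic_div_correct) simp
  then show ?thesis
    using assms deg by (simp add: unit_monic_def coeff_eq_0)
qed

lemma coeff_mult_degree_le:
  assumes "degree q \<le> n"
  shows "coeff (p * q) (m + n) = coeff p m * coeff q n + (\<Sum>k\<in>{m<..m + n}. coeff p k * coeff q (m + n - k))"
proof -
  have "coeff (p * q) (m + n) = (\<Sum>k\<in>{m..m + n}. coeff p k * coeff q (m + n - k))"
    unfolding coeff_mult
    by (rule sum.mono_neutral_right) (use assms in \<open>auto simp: not_le coeff_eq_0\<close>)
  also have "{m..m + n} = insert m {m<..m + n}" by auto
  finally show ?thesis by simp
qed

lemma unit_monic_mult:
  assumes "unit_monic m p" "unit_monic n q"
  shows "unit_monic (m + n) (p * q)"
proof -
  have "coeff (p * q) (m + n) = coeff p m * coeff q n"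
    using assms by (simp add: coeff_mult_degree_le unit_monic_def coeff_eq_0)
  moreover have "coeff p m * coeff q n dvd 1 * 1"
    using assms by (intro mult_dvd_mono) (simp_all add: unit_monic_def)
  moreover have "degree (p * q) \<le> m + n"
    using assms by (auto simp: unit_monic_def intro: order_trans[OF degree_mult_le])
  ultimately show ?thesis by (simp add: unit_monic_def)
qed

text \<open>The ring as a module over itself, whose spans are the ideals generated by a set.\<close>

interpretation ideal_hull: module "(*) :: 'a::comm_ring_1 \<Rightarrow> 'a \<Rightarrow> 'a"
  by standard (simp_all add: algebra_simps)

lemma ideal_hull_mult_right:
  "a \<in> ideal_hull.span S \<Longrightarrow> a * b \<in> ideal_hull.span S"
  using ideal_hull.span_scale[of a S b] by (simp add: mult.commute)

text \<open>Modulo the ideal, g f = 1 with f of positive degree and unit leading coefficient. This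
  forces g to vanish from the top coefficient downwards, and then 1 = 0.\<close>

lemma one_in_ideal_of_unit_monic:
  fixes g f :: "'a::comm_ring_1 poly"
  assumes f: "unit_monic (Suc n) f" and I: "\<And>m. coeff (1 - g * f) m \<in> ideal_hull.span S"
  shows "1 \<in> ideal_hull.span S"
proof -
  let ?I = "ideal_hull.span S"
  have g: "coeff g m \<in> ?I" for m
  proof (induction "degree g - m" arbitrary: m rule: less_induct)
    case less
    show ?case
    proof (cases "m \<le> degree g")
      case False
      then show ?thesis by (simp add: coeff_eq_0 ideal_hull.span_zero)
    next
      case True
      have "coeff g k \<in> ?I" if "k > m" for k
      proof (cases "k \<le> degree g")
        case True
        then show ?thesis
          using that \<open>m \<le> degree g\<close> by (intro less) simp
      qed (simp add: coeff_eq_0 ideal_hull.span_zero)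
      then have "(\<Sum>k\<in>{m<..m + Suc n}. coeff g k * coeff f (m + Suc n - k)) \<in> ?I"
        by (intro ideal_hull.span_sum) (simp add: ideal_hull_mult_right)
      \<comment> \<open>The index m + Suc n is positive, so the constant 1 does not contribute: here
        the positive degree of f enters.\<close>
      moreover have "coeff (g * f) (m + Suc n) \<in> ?I"
        using ideal_hull.span_neg[OF I[of "m + Suc n"]] by simp
      moreover have "coeff (g * f) (m + Suc n) = coeff g m * coeff f (Suc n) +
          (\<Sum>k\<in>{m<..m + Suc n}. coeff g k * coeff f (m + Suc n - k))"
        using f by (intro coeff_mult_degree_le) (simp add: unit_monic_def)
      ultimately have top: "coeff g m * coeff f (Suc n) \<in> ?I"
        by (simp add: ideal_hull.span_add_eq2)
      obtain u where u: "1 = coeff f (Suc n) * u"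
        using f by (auto simp: unit_monic_def elim: dvdE)
      have "coeff g m = coeff g m * coeff f (Suc n) * u"
        by (simp only: mult.assoc u[symmetric] mult_1_right)
      then show ?thesis
        using ideal_hull_mult_right[OF top, of u] by simp
    qed
  qed
  have "coeff (g * f) 0 \<in> ?I"
    using g[of 0] by (simp add: coeff_mult ideal_hull_mult_right)
  then show ?thesis
    using ideal_hull.span_add[OF I[of 0] \<open>coeff (g * f) 0 \<in> ?I\<close>] by simp
qed

section \<open>The monic polynomials attached to a word\<close>

context klr_datum
begin

lemma half_norm_cartan: "half_norm form a * cartan form a b = pairing form a b"
proof -
  have "pairing form a a * cartan form a b = 2 * pairing form a b"
    using cartan_integral[of a b] by (simp add: cartan_def)
  moreover have "pairing form a a = 2 * half_norm form a"
    using norm_even[of a] by (simp add: half_norm_def)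
  ultimately show ?thesis by simp
qed

lemma half_norm_pos: "half_norm form a > 0"
  using norm_pos[of a] norm_even[of a] by (auto simp: half_norm_def elim!: evenE)

lemma cartan_diag: "cartan form a a = 2"
  using norm_pos[of a] by (simp add: cartan_def)

text \<open>A mixed term u^s v^r has d_a s + d_b r = d_a (-c_{a,b}), and r > 0 leaves s strictly
  below -c_{a,b}. Hence u^{-c_{a,b}} is the only term of top degree in u, and its coefficient is a
  unit.\<close>

lemma Q_monic:
  assumes "a \<noteq> b"
  defines "d \<equiv> nat (- cartan form a b)"
  shows "Poly_Mapping.lookup (Q a b) (d, 0) dvd 1"
    and "(s, r) \<in> Poly_Mapping.keys (Q a b) \<Longrightarrow> s < d \<or> s = d \<and> r = 0"
proof -
  have "Poly_Mapping.lookup (Q a b) (d, 0) dvd 1 \<and>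
    (\<forall>s r. (s, r) \<in> Poly_Mapping.keys (Q a b) \<longrightarrow> s < d \<or> s = d \<and> r = 0)"
  proof (cases "cartan form a b = 0")
    case True
    then show ?thesis
      using Q_zero[OF assms(1) True] by (auto simp: d_def split: if_splits)
  next
    case False
    with cartan_nonpos[OF assms(1)] have neg: "cartan form a b < 0" by simp
    then have d: "d > 0" and d': "int d = - cartan form a b" by (simp_all add: d_def)
    obtain R where t: "t a b dvd 1"
      and R: "Poly_Mapping.keys R \<subseteq> {(s, r). s > 0 \<and> r > 0 \<and>
                half_norm form a * int s + half_norm form b * int r = - pairing form a b}"
      and Q: "Q a b = Poly_Mapping.single (d, 0) (t a b)
                 + Poly_Mapping.single (0, nat (- cartan form b a)) (t b a) + R"
      using Q_neg[OF assms(1) neg] by (auto simp: d_def)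
    have R': "s < d \<and> r > 0" if "(s, r) \<in> Poly_Mapping.keys R" for s r
    proof -
      have r: "r > 0" and "half_norm form a * int s + half_norm form b * int r = half_norm form a * int d"
        using that R half_norm_cartan[of a b] by (auto simp: d')
      moreover have "half_norm form b * int r > 0"
        using half_norm_pos[of b] r by simp
      ultimately have "half_norm form a * int s < half_norm form a * int d"
        by simp
      then show ?thesis
        using half_norm_pos[of a] r by simp
    qed
    have "(d, 0) \<notin> Poly_Mapping.keys R"
      using R' by blast
    then have "Poly_Mapping.lookup (Q a b) (d, 0) = t a b"
      using d by (simp add: Q lookup_add lookup_single in_keys_iff)
    moreover have "Poly_Mapping.keys (Q a b) \<subseteq> {(d, 0), (0, nat (- cartan form b a))} \<union> Poly_Mapping.keys R"
      unfolding Q using keys_add[of "Poly_Mapping.single (d, 0) (t a b)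
                 + Poly_Mapping.single (0, nat (- cartan form b a)) (t b a)" R]
        keys_add[of "Poly_Mapping.single (d, 0) (t a b)"
           "Poly_Mapping.single (0, nat (- cartan form b a)) (t b a)"]
      by (auto split: if_splits)
    ultimately show ?thesis
      using t d R' by auto
  qed
  then show "Poly_Mapping.lookup (Q a b) (d, 0) dvd 1"
    and "(s, r) \<in> Poly_Mapping.keys (Q a b) \<Longrightarrow> s < d \<or> s = d \<and> r = 0"
    by auto
qed

definition strand_degree :: "'i \<Rightarrow> 'i list \<Rightarrow> nat \<Rightarrow> int"
  where "strand_degree i \<nu> l = (\<Sum>p<l. if \<nu> ! p = i then - 1 else - cartan form i (\<nu> ! p))"

lemma strand_degree_Suc:
  "strand_degree i \<nu> (Suc l) =
    strand_degree i \<nu> l + (if \<nu> ! l = i then - 1 else - cartan form i (\<nu> ! l))"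
  by (simp add: strand_degree_def)

definition edge_poly :: "'i \<Rightarrow> ('k \<Rightarrow> 'c::comm_ring_1) \<Rightarrow> 'i \<Rightarrow> 'c \<Rightarrow> 'c poly"
  where "edge_poly i h j a = bipoly_eval (\<lambda>c. [:h c:]) (Q i j) [:0, 1:] [:a:]"

text \<open>Coefficient map and values are parameters because the same polynomial is needed with
  permuted variables and over K[x][y]. List positions start at 0, so the letter
  \<open>\<nu> ! l\<close> belongs to the variable \<open>x (Suc l)\<close>.\<close>

primrec strand_poly ::
    "'i \<Rightarrow> ('k \<Rightarrow> 'c::comm_ring_1) \<Rightarrow> (nat \<Rightarrow> 'c) \<Rightarrow> 'i list \<Rightarrow> nat \<Rightarrow> 'c poly"
  where
    "strand_poly i h x \<nu> 0 = 1"
  | "strand_poly i h x \<nu> (Suc l) =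
      (if \<nu> ! l = i then synthetic_div (strand_poly i h x \<nu> l) (x (Suc l))
       else strand_poly i h x \<nu> l * edge_poly i h (\<nu> ! l) (x (Suc l)))"

lemma map_edge_poly:
  assumes "is_hom f"
  shows "map_poly f (edge_poly i h j a) = edge_poly i (\<lambda>c. f (h c)) j (f a)"
  by (simp add: edge_poly_def hom_bipoly_eval[OF is_hom_map_poly[OF assms]] map_poly_pCons
      is_hom_simps[OF assms])

lemma map_strand_poly:
  assumes "is_hom f"
  shows "map_poly f (strand_poly i h x \<nu> l) = strand_poly i (\<lambda>c. f (h c)) (\<lambda>p. f (x p)) \<nu> l"
  by (induction l) (simp_all add: map_poly_synthetic_div[OF assms] map_poly_mult_hom[OF assms]
      map_edge_poly[OF assms] is_hom_simps[OF assms])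

lemma strand_poly_cong:
  assumes "\<And>p. p < l \<Longrightarrow> x (Suc p) = x' (Suc p)" "\<And>p. p < l \<Longrightarrow> \<nu> ! p = \<nu>' ! p"
  shows "strand_poly i h x \<nu> l = strand_poly i h x' \<nu>' l"
  using assms by (induction l) simp_all

lemma edge_poly_eq:
  "edge_poly i h j a =
    (\<Sum>(s, r)\<in>Poly_Mapping.keys (Q i j). monom (h (Poly_Mapping.lookup (Q i j) (s, r)) * a ^ r) s)"
  unfolding edge_poly_def bipoly_eval_def
proof (rule sum.cong[OF refl], clarify)
  fix s r
  show "[:h (Poly_Mapping.lookup (Q i j) (s, r)):] * [:0, 1:] ^ s * [:a:] ^ r =
      monom (h (Poly_Mapping.lookup (Q i j) (s, r)) * a ^ r) s"
    by (simp add: monom_altdef poly_const_pow mult_ac)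
qed

lemma unit_monic_edge_poly:
  assumes "is_hom h" "i \<noteq> j"
  shows "unit_monic (nat (- cartan form i j)) (edge_poly i h j a)"
proof -
  let ?d = "nat (- cartan form i j)"
  have coeff: "coeff (edge_poly i h j a) n =
      (\<Sum>(s, r)\<in>Poly_Mapping.keys (Q i j). if s = n then h (Poly_Mapping.lookup (Q i j) (s, r)) * a ^ r else 0)" for n
    by (auto simp: edge_poly_eq coeff_sum intro!: sum.cong)
  have "coeff (edge_poly i h j a) n = 0" if "n > ?d" for n
    unfolding coeff using Q_monic(2)[OF assms(2)] that by (intro sum.neutral) fastforce
  then have deg: "degree (edge_poly i h j a) \<le> ?d"
    by (intro degree_le) auto
  have "coeff (edge_poly i h j a) ?d =
      (\<Sum>z\<in>Poly_Mapping.keys (Q i j). if z = (?d, 0) then h (Poly_Mapping.lookup (Q i j) (?d, 0)) else 0)"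
    unfolding coeff using Q_monic(2)[OF assms(2)] by (intro sum.cong) fastforce+
  also have "\<dots> = h (Poly_Mapping.lookup (Q i j) (?d, 0))"
    by (simp add: sum.delta in_keys_iff is_hom_simps[OF assms(1)])
  also have "\<dots> dvd 1"
  proof -
    obtain u where "1 = Poly_Mapping.lookup (Q i j) (?d, 0) * u"
      using Q_monic(1)[OF assms(2)] by (elim dvdE)
    then have "1 = h (Poly_Mapping.lookup (Q i j) (?d, 0)) * h u"
      using is_hom_simps[OF assms(1)] by metis
    then show ?thesis by (rule dvdI)
  qed
  finally show ?thesis
    using deg by (simp add: unit_monic_def)
qed

text \<open>Positivity at each letter i is what lets the divided difference lower the degree by one
  and keep the leading unit; a polynomial of degree 0 would be sent to 0.\<close>

lemma unit_monic_strand_poly: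
  assumes "is_hom h" "\<And>p. p < l \<Longrightarrow> \<nu> ! p = i \<Longrightarrow> strand_degree i \<nu> p > 0"
  shows "strand_degree i \<nu> l \<ge> 0 \<and> unit_monic (nat (strand_degree i \<nu> l)) (strand_poly i h x \<nu> l)"
  using assms(2)
proof (induction l)
  case 0
  then show ?case by (simp add: strand_degree_def unit_monic_1)
next
  case (Suc l)
  then have IH: "strand_degree i \<nu> l \<ge> 0" "unit_monic (nat (strand_degree i \<nu> l)) (strand_poly i h x \<nu> l)"
    by simp_all
  show ?case
  proof (cases "\<nu> ! l = i")
    case True
    then have pos: "strand_degree i \<nu> l > 0" using Suc.prems by simp
    then have "nat (strand_degree i \<nu> l) = Suc (nat (strand_degree i \<nu> l - 1))" by simp
    then show ?thesis
      using True pos IH(2) unit_monic_synthetic_div by (simp add: strand_degree_Suc)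
  next
    case False
    then have c: "cartan form i (\<nu> ! l) \<le> 0" using cartan_nonpos[of i "\<nu> ! l"] by auto
    then have "nat (strand_degree i \<nu> (Suc l)) = nat (strand_degree i \<nu> l) + nat (- cartan form i (\<nu> ! l))"
      using False IH(1) by (simp add: strand_degree_Suc)
    then show ?thesis
      using False c IH unit_monic_mult[OF IH(2) unit_monic_edge_poly[OF assms(1)]]
      by (simp add: strand_degree_Suc)
  qed
qed

end

section \<open>Exchange of two adjacent letters\<close>

context klr_datum
begin

text \<open>
  Exchanging a colour \<open>j \<noteq> i\<close> with \<open>i\<close> changes the later polynomials, but only by multiples of
  the generator at the earlier position.
\<close>

lemma strand_poly_swap:
  fixes x :: "nat \<Rightarrow> 'c::comm_ring_1"
  assumes p: "Suc p < length \<nu>" and l: "Suc (Suc p) \<le> l"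
    and ab: "\<nu> ! p \<noteq> i"
  defines "\<nu>' \<equiv> \<nu>[p := \<nu> ! Suc p, Suc p := \<nu> ! p]"
    and "x' \<equiv> (\<lambda>l. x (Transposition.transpose (Suc p) (Suc (Suc p)) l))"
  shows "\<exists>H. strand_poly i h x' \<nu> l =
    strand_poly i h x \<nu>' l + (if \<nu> ! Suc p = i then smult (poly (strand_poly i h x \<nu> p) (x (Suc p))) H else 0)"
  using l
proof (induction l rule: nat_induct_at_least)
  case base
  have x: "x' (Suc p) = x (Suc (Suc p))" "x' (Suc (Suc p)) = x (Suc p)"
    by (simp_all add: x'_def)
  have \<nu>': "\<nu>' ! p = \<nu> ! Suc p" "\<nu>' ! Suc p = \<nu> ! p"
    using p by (simp_all add: \<nu>'_def nth_list_update)
  have 1: "strand_poly i h x' \<nu> p = strand_poly i h x \<nu> p"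
    by (rule strand_poly_cong) (auto simp: x'_def Transposition.transpose_def)
  have 2: "strand_poly i h x \<nu>' p = strand_poly i h x \<nu> p"
    by (rule strand_poly_cong) (auto simp: \<nu>'_def)
  show ?case
  proof (cases "\<nu> ! Suc p = i")
    \<comment> \<open>Let F be the common polynomial before the two letters. By the Leibniz rule the
      divided difference of F Q is that of F, times Q, plus F(x_{p+1}) times that of Q; the last
      factor is the witness H.\<close>
    case True
    then show ?thesis
      using ab by (simp add: 1 2 x \<nu>' synthetic_div_mult) blast
  next
    case False
    then show ?thesis
      using ab by (simp add: 1 2 x \<nu>')
  qed
next
  case (Suc l)
  have [simp]: "x' (Suc l) = x (Suc l)"
    using Suc.hyps by (simp add: x'_def Transposition.transpose_def)
  have [simp]: "\<nu>' ! l = \<nu> ! l"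
    using Suc.hyps by (simp add: \<nu>'_def)
  from Suc.IH show ?case
    by (auto simp: synthetic_div_add synthetic_div_smult distrib_right)
qed

text \<open>Two equal letters enter symmetrically in their variables: iterated divided differences
  commute, and so do two multiplications. Later letters involve neither variable.\<close>

lemma strand_poly_swap_eq:
  fixes x :: "nat \<Rightarrow> 'c::comm_ring_1"
  assumes p: "Suc p < length \<nu>" and l: "Suc (Suc p) \<le> l"
    and eq: "\<nu> ! Suc p = \<nu> ! p"
  defines "x' \<equiv> (\<lambda>l. x (Transposition.transpose (Suc p) (Suc (Suc p)) l))"
  shows "strand_poly i h x' \<nu> l = strand_poly i h x \<nu> l"
  using l
proof (induction l rule: nat_induct_at_least)
  case base
  have x: "x' (Suc p) = x (Suc (Suc p))" "x' (Suc (Suc p)) = x (Suc p)"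
    by (simp_all add: x'_def)
  have 1: "strand_poly i h x' \<nu> p = strand_poly i h x \<nu> p"
    by (rule strand_poly_cong) (auto simp: x'_def Transposition.transpose_def)
  show ?case
  proof (cases "\<nu> ! p = i")
    case True
    then show ?thesis
      using synthetic_div_commute[of "strand_poly i h x \<nu> p" "x (Suc p)" "x (Suc (Suc p))"]
      by (simp add: 1 x eq)
  next
    case False
    then show ?thesis
      by (simp add: 1 x eq)
  qed
next
  case (Suc l)
  have [simp]: "x' (Suc l) = x (Suc l)"
    using Suc.hyps by (simp add: x'_def Transposition.transpose_def)
  from Suc.IH show ?case
    by simp
qed

end

section \<open>An invariant ideal for each word\<close>

context klr_rep
begin

definition strand_elem :: "'i list \<Rightarrow> nat \<Rightarrow> 'k mpoly"
  where "strand_elem \<nu> l = poly (strand_poly i Const Var \<nu> l) (Var (Suc l))"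

definition rep_ideal :: "'i list \<Rightarrow> 'k mpoly set"
  where "rep_ideal \<nu> = ideal_hull.span {strand_elem \<nu> l | l. l < length \<nu> \<and> \<nu> ! l = i}"

lemma rep_ideal_0: "0 \<in> rep_ideal \<nu>"
  by (simp add: rep_ideal_def ideal_hull.span_zero)

lemma rep_ideal_add: "f \<in> rep_ideal \<nu> \<Longrightarrow> g \<in> rep_ideal \<nu> \<Longrightarrow> f + g \<in> rep_ideal \<nu>"
  by (simp add: rep_ideal_def ideal_hull.span_add)

lemma rep_ideal_mult: "f \<in> rep_ideal \<nu> \<Longrightarrow> g * f \<in> rep_ideal \<nu>"
  by (simp add: rep_ideal_def ideal_hull.span_scale)

lemma strand_elem_in_rep_ideal: "l < length \<nu> \<Longrightarrow> \<nu> ! l = i \<Longrightarrow> strand_elem \<nu> l \<in> rep_ideal \<nu>"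
  unfolding rep_ideal_def by (rule ideal_hull.span_base) auto

lemma rep_ideal_UNIV:
  assumes "\<nu> \<noteq> []" "\<nu> ! 0 = i"
  shows "f \<in> rep_ideal \<nu>"
  using rep_ideal_mult[OF strand_elem_in_rep_ideal[of 0 \<nu>], of f] assms
  by (simp add: strand_elem_def)

lemma swap_vars_strand_elem:
  "swap_vars k (strand_elem \<nu> l) =
    poly (strand_poly i Const (\<lambda>l. Var (Transposition.transpose k (Suc k) l)) \<nu> l)
      (Var (Transposition.transpose k (Suc k) (Suc l)))"
  unfolding strand_elem_def
  by (subst poly_map_poly_hom[OF is_hom_swap_vars, symmetric])
    (simp add: map_strand_poly[OF is_hom_swap_vars] swap_vars_Var)

lemma swap_vars_strand_elem_less:
  assumes "l < p"
  shows "swap_vars (Suc p) (strand_elem \<nu> l) = strand_elem \<nu> l"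
proof -
  have "strand_poly i Const (\<lambda>l. Var (Transposition.transpose (Suc p) (Suc (Suc p)) l)) \<nu> l =
      strand_poly i Const Var \<nu> l"
    using assms by (intro strand_poly_cong) (auto simp: Transposition.transpose_def)
  then show ?thesis
    using assms unfolding swap_vars_strand_elem by (simp add: strand_elem_def Transposition.transpose_def)
qed

lemma strand_elem_cong:
  "(\<And>p. p < l \<Longrightarrow> \<nu> ! p = \<nu>' ! p) \<Longrightarrow> strand_elem \<nu> l = strand_elem \<nu>' l"
  unfolding strand_elem_def
  by (subst strand_poly_cong[of l Var Var \<nu> \<nu>']) simp_all

text \<open>Only the generator at the left one of two adjacent letters i is moved: its divided
  difference is, up to sign, the generator at the right one. All other generators are symmetric in
  x_{p+1} and x_{p+2}, so they are killed.\<close>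

lemma demazure_strand_elem:
  assumes p: "Suc p < length \<nu>" and l: "l < length \<nu>" "\<nu> ! l = i" and eq: "\<nu> ! Suc p = \<nu> ! p"
  shows "demazure (Suc p) (strand_elem \<nu> l) \<in> rep_ideal \<nu>"
proof -
  consider "l < p" | "l = p" | "l = Suc p" | "Suc (Suc p) \<le> l" by linarith
  then show ?thesis
  proof cases
    case 1
    then show ?thesis
      by (simp add: demazure_invariant swap_vars_strand_elem_less rep_ideal_0)
  next
    case 2
    have 1: "strand_poly i Const (\<lambda>l. Var (Transposition.transpose (Suc p) (Suc (Suc p)) l)) \<nu> p =
        strand_poly i Const Var \<nu> p"
      by (rule strand_poly_cong) (auto simp: Transposition.transpose_def)
    have "demazure (Suc p) (strand_elem \<nu> p) = - strand_elem \<nu> (Suc p)"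
    proof (rule demazure_eqI)
      show "(Var (Suc p) - Var (Suc (Suc p))) * - strand_elem \<nu> (Suc p) =
          swap_vars (Suc p) (strand_elem \<nu> p) - strand_elem \<nu> p"
        using l(2) 2 poly_synthetic_div[of "Var (Suc (Suc p))" "Var (Suc p)" "strand_poly i Const Var \<nu> p"]
        unfolding swap_vars_strand_elem 1 by (simp add: strand_elem_def algebra_simps)
    qed
    then show ?thesis
      using rep_ideal_mult[OF strand_elem_in_rep_ideal[OF p], of "- 1"] eq l 2 by simp
  next
    case 3
    have 1: "strand_poly i Const (\<lambda>l. Var (Transposition.transpose (Suc p) (Suc (Suc p)) l)) \<nu> p =
        strand_poly i Const Var \<nu> p"
      by (rule strand_poly_cong) (auto simp: Transposition.transpose_def)
    have "swap_vars (Suc p) (strand_elem \<nu> l) = strand_elem \<nu> l"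
      using l(2) 3 eq unfolding swap_vars_strand_elem
      by (simp add: 1 strand_elem_def poly_synthetic_div_commute[of _ "Var (Suc p)"])
    then show ?thesis
      by (simp add: demazure_invariant rep_ideal_0)
  next
    case 4
    have "swap_vars (Suc p) (strand_elem \<nu> l) = strand_elem \<nu> l"
      using 4 strand_poly_swap_eq[OF p 4 eq, of i Const Var] unfolding swap_vars_strand_elem
      by (simp add: strand_elem_def Transposition.transpose_def)
    then show ?thesis
      by (simp add: demazure_invariant rep_ideal_0)
  qed
qed

lemma edge_poly_eval:
  "poly (edge_poly i Const j a) b = bipoly_eval Const (Q i j) b a"
  unfolding edge_poly_def by (simp add: hom_bipoly_eval[OF is_hom_poly])

text \<open>
  Moving a strand \<open>i\<close> to the right over \<open>j\<close> multiplies by all of $Q_{i,j}$, because \<open>i\<close> is the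
  least colour; this is the factor by which the generator of the target exceeds that of the source.
\<close>

lemma edge_factor_swap_vars_strand_elem:
  assumes p: "Suc p < length \<nu>" and l: "l < length \<nu>" "\<nu> ! l = i" and neq: "\<nu> ! p \<noteq> \<nu> ! Suc p"
  defines "\<nu>' \<equiv> \<nu>[p := \<nu> ! Suc p, Suc p := \<nu> ! p]"
  shows "edge_factor (\<nu> ! p) (\<nu> ! Suc p) (Var (Suc (Suc p))) (Var (Suc p)) * swap_vars (Suc p) (strand_elem \<nu> l)
    \<in> rep_ideal \<nu>'"
proof -
  let ?x' = "\<lambda>l. Var (Transposition.transpose (Suc p) (Suc (Suc p)) l) :: 'k mpoly"
  have len: "length \<nu>' = length \<nu>" by (simp add: \<nu>'_def)
  have \<nu>': "\<nu>' ! p = \<nu> ! Suc p" "\<nu>' ! Suc p = \<nu> ! p" and rest: "\<And>q. q \<noteq> p \<Longrightarrow> q \<noteq> Suc p \<Longrightarrow> \<nu>' ! q = \<nu> ! q"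
    using p by (simp_all add: \<nu>'_def nth_list_update)
  have swap_back: "\<nu>'[p := \<nu> ! p, Suc p := \<nu> ! Suc p] = \<nu>"
    using p unfolding \<nu>'_def by (intro nth_equalityI) (auto simp: nth_list_update)
  have pre: "strand_poly i Const ?x' \<nu> p = strand_poly i Const Var \<nu> p"
    by (rule strand_poly_cong) (auto simp: Transposition.transpose_def)
  have pre': "strand_poly i Const Var \<nu>' p = strand_poly i Const Var \<nu> p"
    by (rule strand_poly_cong) (auto simp: rest)
  consider "l < p" | "l = p" | "l = Suc p" | "Suc (Suc p) \<le> l" by linarith
  then show ?thesis
  proof cases
    case 1
    then have "strand_elem \<nu> l = strand_elem \<nu>' l"
      by (intro strand_elem_cong) (simp add: rest)
    then show ?thesis
      using 1 strand_elem_in_rep_ideal[of l \<nu>'] l len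
      by (simp add: swap_vars_strand_elem_less rep_ideal_mult rest)
  next
    case 2
    have "edge_factor (\<nu> ! p) (\<nu> ! Suc p) (Var (Suc (Suc p))) (Var (Suc p)) * swap_vars (Suc p) (strand_elem \<nu> l) =
        strand_elem \<nu>' (Suc p)"
      using 2 l neq lt_least[of "\<nu> ! Suc p"] unfolding swap_vars_strand_elem
      by (simp add: pre strand_elem_def pre' \<nu>' edge_factor_def edge_poly_eval)
    then show ?thesis
      using strand_elem_in_rep_ideal[of "Suc p" \<nu>'] 2 l p \<nu>' len by simp
  next
    \<comment> \<open>The strand i moves left; the source generator already contains Q_{i,j}, so it
      is a multiple of the target generator.\<close>
    case 3
    have "swap_vars (Suc p) (strand_elem \<nu> l) =
        poly (edge_poly i Const (\<nu> ! p) (Var (Suc (Suc p)))) (Var (Suc p)) * strand_elem \<nu>' p"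
      using 3 l neq unfolding swap_vars_strand_elem
      by (simp add: pre strand_elem_def pre' mult.commute)
    then show ?thesis
      using strand_elem_in_rep_ideal[of p \<nu>'] 3 l p \<nu>' len by (simp add: rep_ideal_mult)
  next
    case 4
    have elem: "strand_elem \<nu>' l \<in> rep_ideal \<nu>'"
      using strand_elem_in_rep_ideal[of l \<nu>'] 4 l len by (simp add: rest)
    have var: "Transposition.transpose (Suc p) (Suc (Suc p)) (Suc l) = Suc l"
      using 4 by (simp add: Transposition.transpose_def)
    show ?thesis
    proof (cases "\<nu> ! p = i")
      case False
      obtain H where H: "strand_poly i Const ?x' \<nu> l = strand_poly i Const Var \<nu>' l +
          (if \<nu> ! Suc p = i then smult (poly (strand_poly i Const Var \<nu> p) (Var (Suc p))) H else 0)"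
        using strand_poly_swap[OF p 4 False, of Const Var] unfolding \<nu>'_def by blast
      have "swap_vars (Suc p) (strand_elem \<nu> l) = strand_elem \<nu>' l +
          (if \<nu> ! Suc p = i then poly H (Var (Suc l)) * strand_elem \<nu>' p else 0)"
        unfolding swap_vars_strand_elem H var by (simp add: strand_elem_def pre' mult.commute)
      then have "swap_vars (Suc p) (strand_elem \<nu> l) \<in> rep_ideal \<nu>'"
        using elem strand_elem_in_rep_ideal[of p \<nu>'] p \<nu>' len
        by (cases "\<nu> ! Suc p = i") (simp_all add: rep_ideal_add rep_ideal_mult)
      then show ?thesis by (rule rep_ideal_mult)
    next
      \<comment> \<open>The exchange lemma is now read from \<open>\<nu>'\<close> with permuted
        variables. Its error is a multiple of F_p(x_{p+2}), which by itself need not lie in the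
        ideal, but multiplied by the edge factor E it becomes the generator of \<open>\<nu>'\<close>
        at \<open>Suc p\<close>.\<close>
      case True
      then have neq': "\<nu>' ! p \<noteq> i" using neq \<nu>' by simp
      have p': "Suc p < length \<nu>'" using p len by simp
      obtain H where H: "strand_poly i Const Var \<nu>' l = strand_poly i Const ?x' \<nu> l +
          smult (poly (strand_poly i Const ?x' \<nu>' p) (Var (Suc (Suc p)))) H"
        using strand_poly_swap[OF p' 4 neq', of Const ?x'] True unfolding \<nu>' swap_back by auto
      have pre'': "strand_poly i Const ?x' \<nu>' p = strand_poly i Const Var \<nu> p"
        unfolding pre'[symmetric] by (rule strand_poly_cong) (auto simp: Transposition.transpose_def)
      define E where "E = edge_factor (\<nu> ! p) (\<nu> ! Suc p) (Var (Suc (Suc p))) (Var (Suc p))"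
      have gen: "strand_elem \<nu>' (Suc p) = poly (strand_poly i Const Var \<nu> p) (Var (Suc (Suc p))) * E"
        using True neq lt_least[of "\<nu> ! Suc p"] neq'
        by (simp add: E_def strand_elem_def edge_factor_def \<nu>' pre' edge_poly_eval)
      have "strand_elem \<nu>' l = swap_vars (Suc p) (strand_elem \<nu> l) +
          poly (strand_poly i Const Var \<nu> p) (Var (Suc (Suc p))) * poly H (Var (Suc l))"
        unfolding swap_vars_strand_elem var by (simp add: strand_elem_def H pre'')
      then have "E * swap_vars (Suc p) (strand_elem \<nu> l) =
          E * strand_elem \<nu>' l + (- poly H (Var (Suc l))) * strand_elem \<nu>' (Suc p)"
        unfolding gen by (simp add: distrib_left)
      moreover have "strand_elem \<nu>' (Suc p) \<in> rep_ideal \<nu>'"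
        using strand_elem_in_rep_ideal[OF p'] True \<nu>' by simp
      ultimately show ?thesis
        using elem unfolding E_def by (simp only: rep_ideal_add rep_ideal_mult)
    qed
  qed
qed

text \<open>The operator is not K[x]-linear. On a multiple c g the Leibniz rule, or the twist of c
  by the transposition, reduces the claim to the generator g.\<close>

lemma tau_op_rep_ideal:
  assumes p: "Suc p < length \<nu>" and f: "f \<in> rep_ideal \<nu>"
  shows "tau_op (Suc p) (\<nu> ! p) (\<nu> ! Suc p) f \<in> rep_ideal (\<nu>[p := \<nu> ! Suc p, Suc p := \<nu> ! p])"
  using f unfolding rep_ideal_def[of \<nu>]
proof (induction f rule: ideal_hull.span_induct_alt)
  case base
  then show ?case by (simp add: rep_ideal_0)
next
  case (step c g f)
  then obtain l where l: "l < length \<nu>" "\<nu> ! l = i" and g: "g = strand_elem \<nu> l" by auto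
  have "tau_op (Suc p) (\<nu> ! p) (\<nu> ! Suc p) (c * g) \<in> rep_ideal (\<nu>[p := \<nu> ! Suc p, Suc p := \<nu> ! p])"
  proof (cases "\<nu> ! p = \<nu> ! Suc p")
    case True
    then have "\<nu>[p := \<nu> ! Suc p, Suc p := \<nu> ! p] = \<nu>"
      by (metis list_update_id)
    then show ?thesis
      using True demazure_strand_elem[OF p l] strand_elem_in_rep_ideal[OF l]
      by (simp add: tau_op_def demazure_mult g rep_ideal_add rep_ideal_mult)
  next
    case False
    then have "tau_op (Suc p) (\<nu> ! p) (\<nu> ! Suc p) (c * g) = swap_vars (Suc p) c *
        (edge_factor (\<nu> ! p) (\<nu> ! Suc p) (Var (Suc (Suc p))) (Var (Suc p)) * swap_vars (Suc p) (strand_elem \<nu> l))"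
      by (simp only: tau_op_def swap_vars_simps g if_False ac_simps)
    then show ?thesis
      using rep_ideal_mult[OF edge_factor_swap_vars_strand_elem[OF p l False]] by simp
  qed
  then show ?case
    using step.IH by (simp add: tau_op_add rep_ideal_add)
qed

section \<open>Properness of the ideal of a word\<close>

lemma split_var_strand_elem_less:
  assumes "p < l"
  shows "split_var (Suc l) (strand_elem \<nu> p) = [:strand_elem \<nu> p:]"
proof -
  have 1: "strand_poly i (\<lambda>c. split_var (Suc l) (Const c)) (\<lambda>q. split_var (Suc l) (Var q)) \<nu> p =
      strand_poly i (\<lambda>c. [:Const c:]) (\<lambda>q. [:Var q:]) \<nu> p"
    using assms by (simp add: split_var_Const) (rule strand_poly_cong, auto simp: split_var_Var)
  have "split_var (Suc l) (strand_elem \<nu> p) =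
      poly (map_poly (\<lambda>c. [:c:]) (strand_poly i Const Var \<nu> p)) [:Var (Suc p):]"
    unfolding strand_elem_def
    by (subst poly_map_poly_hom[OF is_hom_split_var, symmetric])
      (simp only: map_strand_poly[OF is_hom_split_var] map_strand_poly[OF is_hom_const_poly] 1,
       use assms in \<open>simp add: split_var_Var\<close>)
  then show ?thesis
    by (simp add: poly_map_poly_hom[OF is_hom_const_poly] strand_elem_def)
qed

lemma split_var_strand_elem:
  "split_var (Suc l) (strand_elem \<nu> l) = strand_poly i Const Var \<nu> l"
proof -
  have 1: "strand_poly i (\<lambda>c. split_var (Suc l) (Const c)) (\<lambda>q. split_var (Suc l) (Var q)) \<nu> l =
      strand_poly i (\<lambda>c. [:Const c:]) (\<lambda>q. [:Var q:]) \<nu> l"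
    by (simp add: split_var_Const) (rule strand_poly_cong, auto simp: split_var_Var)
  have "split_var (Suc l) (strand_elem \<nu> l) =
      poly (map_poly (\<lambda>c. [:c:]) (strand_poly i Const Var \<nu> l)) [:0, 1:]"
    unfolding strand_elem_def
    by (subst poly_map_poly_hom[OF is_hom_split_var, symmetric])
      (simp only: map_strand_poly[OF is_hom_split_var] map_strand_poly[OF is_hom_const_poly] 1,
       simp add: split_var_Var)
  then show ?thesis
    by (simp add: pcompose_altdef[symmetric] pcompose_idR)
qed

text \<open>The generators are adjoined one at a time. Those before position l are free of x_{l+1},
  in which the new one has positive degree and a unit leading coefficient, so 1 cannot newly
  enter.\<close>

lemma rep_ideal_proper:
  assumes "\<And>l. l < length \<nu> \<Longrightarrow> \<nu> ! l = i \<Longrightarrow> strand_degree i \<nu> l > 0"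
  shows "1 \<notin> rep_ideal \<nu>"
proof -
  define J where "J l = {strand_elem \<nu> p | p. p < l \<and> \<nu> ! p = i}" for l
  have "1 \<notin> ideal_hull.span (J l)" if "l \<le> length \<nu>" for l
    using that
  proof (induction l)
    case 0
    then show ?case by (simp add: J_def)
  next
    case (Suc l)
    then have IH: "1 \<notin> ideal_hull.span (J l)" by simp
    show ?case
    proof (cases "\<nu> ! l = i")
      case False
      then have "J (Suc l) = J l"
        unfolding J_def by (metis less_Suc_eq)
      with IH show ?thesis by simp
    next
      case True
      have J: "J (Suc l) = insert (strand_elem \<nu> l) (J l)"
        unfolding J_def using True by (auto simp: less_Suc_eq)
      show ?thesis
      proof
        assume "1 \<in> ideal_hull.span (J (Suc l))"
        then obtain r where r: "1 - r * strand_elem \<nu> l \<in> ideal_hull.span (J l)"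
          unfolding J ideal_hull.span_breakdown_eq by blast
        \<comment> \<open>Since the earlier generators are constant in x_{l+1}, membership in their
          ideal passes to each coefficient.\<close>
        have coeffs: "coeff (split_var (Suc l) f) m \<in> ideal_hull.span (J l)"
          if "f \<in> ideal_hull.span (J l)" for f m
          using that
        proof (induction f rule: ideal_hull.span_induct_alt)
          case base
          then show ?case by (simp add: is_hom_simps[OF is_hom_split_var] ideal_hull.span_zero)
        next
          case (step c g f)
          then obtain p where p: "g = strand_elem \<nu> p" "p < l" by (auto simp: J_def)
          have "g \<in> ideal_hull.span (J l)" using step.hyps by (rule ideal_hull.span_base)
          then show ?case
            using step.IH p(2)
            by (simp add: is_hom_simps[OF is_hom_split_var] p(1) split_var_strand_elem_less
                ideal_hull.span_add ideal_hull_mult_right)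
        qed
        have pos: "strand_degree i \<nu> l > 0"
          using assms[of l] True Suc.prems by simp
        then have "nat (strand_degree i \<nu> l) = Suc (nat (strand_degree i \<nu> l - 1))" by simp
        moreover have "unit_monic (nat (strand_degree i \<nu> l)) (strand_poly i Const Var \<nu> l)"
          using unit_monic_strand_poly[OF is_hom_Const, of l \<nu> i Var] assms Suc.prems by simp
        ultimately have monic: "unit_monic (Suc (nat (strand_degree i \<nu> l - 1))) (strand_poly i Const Var \<nu> l)"
          by simp
        have "coeff (1 - split_var (Suc l) r * strand_poly i Const Var \<nu> l) m \<in> ideal_hull.span (J l)" for m
          using coeffs[OF r, of m]
          by (simp add: is_hom_simps[OF is_hom_split_var] split_var_strand_elem)
        then have "1 \<in> ideal_hull.span (J l)"
          by (rule one_in_ideal_of_unit_monic[OF monic])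
        with IH show False by simp
      qed
    qed
  qed
  from this[of "length \<nu>"] show ?thesis
    by (simp add: rep_ideal_def J_def)
qed

end

section \<open>The action of the free algebra\<close>

lemma entry_swap_entries:
  assumes "1 \<le> k" "k < length \<nu>" "1 \<le> l"
  shows "entry (swap_entries k \<nu>) l = entry \<nu> (Transposition.transpose k (Suc k) l)"
proof -
  obtain p q where "k = Suc p" "l = Suc q"
    using assms by (metis Suc_le_D One_nat_def)
  then show ?thesis
    using assms by (auto simp: swap_entries_def entry_def nth_list_update Transposition.transpose_def)
qed

text \<open>Turns identities between words into identities of transpositions of positions. Positions
  start at 1; at 0 truncated subtraction would repeat the first entry.\<close>

lemma list_eq_entryI:
  assumes "length \<nu> = length \<mu>" "\<And>l. 1 \<le> l \<Longrightarrow> entry \<nu> l = entry \<mu> l"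
  shows "\<nu> = \<mu>"
proof (rule nth_equalityI)
  fix l
  show "\<nu> ! l = \<mu> ! l"
    using assms(2)[of "Suc l"] by (simp add: entry_def)
qed (rule assms(1))

lemma swap_entries_swap_entries:
  "1 \<le> k \<Longrightarrow> k < length \<nu> \<Longrightarrow> swap_entries k (swap_entries k \<nu>) = \<nu>"
  by (rule list_eq_entryI)
    (auto simp: length_swap_entries entry_swap_entries Transposition.transpose_def)

lemma swap_entries_commute:
  assumes "1 \<le> k" "k < length \<nu>" "1 \<le> l" "l < length \<nu>" "Suc k < l \<or> Suc l < k"
  shows "swap_entries k (swap_entries l \<nu>) = swap_entries l (swap_entries k \<nu>)"
  by (rule list_eq_entryI)
    (use assms in \<open>auto simp: length_swap_entries entry_swap_entries Transposition.transpose_def\<close>)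

lemma swap_entries_braid:
  assumes "1 \<le> k" "Suc k < length \<nu>"
  shows "swap_entries (Suc k) (swap_entries k (swap_entries (Suc k) \<nu>)) =
    swap_entries k (swap_entries (Suc k) (swap_entries k \<nu>))"
  by (rule list_eq_entryI)
    (use assms in \<open>auto simp: length_swap_entries entry_swap_entries Transposition.transpose_def\<close>)

context klr_rep
begin

text \<open>Vectors are functions from words to polynomials. The component of tau_k v at \<nu> comes
  from the component of v at s_k(\<nu>), so the two colours are read off there.\<close>

definition act_gen ::
    "'i root_lattice \<Rightarrow> 'i klr_gen \<Rightarrow> ('i list \<Rightarrow> 'k mpoly) \<Rightarrow> 'i list \<Rightarrow> 'k mpoly"
  where "act_gen \<beta> g v \<nu> = (case g of
      Gen_e \<mu> \<Rightarrow> if \<nu> = \<mu> then v \<nu> else 0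
    | Gen_x k \<Rightarrow> Var k * v \<nu>
    | Gen_tau k \<Rightarrow> if \<nu> \<in> seqs \<beta> then
        tau_op k (entry (swap_entries k \<nu>) k) (entry (swap_entries k \<nu>) (k + 1)) (v (swap_entries k \<nu>))
        else 0)"

definition act_word ::
    "'i root_lattice \<Rightarrow> 'i klr_gen free_monoid \<Rightarrow> ('i list \<Rightarrow> 'k mpoly) \<Rightarrow> 'i list \<Rightarrow> 'k mpoly"
  where "act_word \<beta> w v = foldr (act_gen \<beta>) (letters w) v"

definition act ::
    "'i root_lattice \<Rightarrow> ('i klr_gen, 'k) free_alg \<Rightarrow> ('i list \<Rightarrow> 'k mpoly) \<Rightarrow> 'i list \<Rightarrow> 'k mpoly"
  where "act \<beta> p v \<nu> =
    (\<Sum>w\<in>Poly_Mapping.keys p. Const (Poly_Mapping.lookup p w) * act_word \<beta> w v \<nu>)"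

lemma act_gen_add: "act_gen \<beta> g (\<lambda>\<nu>. v \<nu> + u \<nu>) = (\<lambda>\<nu>. act_gen \<beta> g v \<nu> + act_gen \<beta> g u \<nu>)"
  by (auto simp: act_gen_def fun_eq_iff distrib_left tau_op_add split: klr_gen.split)

lemma act_gen_Const: "act_gen \<beta> g (\<lambda>\<nu>. Const c * v \<nu>) = (\<lambda>\<nu>. Const c * act_gen \<beta> g v \<nu>)"
  by (auto simp: act_gen_def fun_eq_iff tau_op_Const mult.left_commute split: klr_gen.split)

lemma act_word_add: "act_word \<beta> w (\<lambda>\<nu>. v \<nu> + u \<nu>) = (\<lambda>\<nu>. act_word \<beta> w v \<nu> + act_word \<beta> w u \<nu>)"
proof -
  have "foldr (act_gen \<beta>) gs (\<lambda>\<nu>. v \<nu> + u \<nu>) =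
      (\<lambda>\<nu>. foldr (act_gen \<beta>) gs v \<nu> + foldr (act_gen \<beta>) gs u \<nu>)" for gs
    by (induction gs) (simp_all add: act_gen_add)
  then show ?thesis by (simp add: act_word_def)
qed

lemma act_word_Const: "act_word \<beta> w (\<lambda>\<nu>. Const c * v \<nu>) = (\<lambda>\<nu>. Const c * act_word \<beta> w v \<nu>)"
proof -
  have "foldr (act_gen \<beta>) gs (\<lambda>\<nu>. Const c * v \<nu>) =
      (\<lambda>\<nu>. Const c * foldr (act_gen \<beta>) gs v \<nu>)" for gs
    by (induction gs) (simp_all add: act_gen_Const)
  then show ?thesis by (simp add: act_word_def)
qed

lemma act_word_mult: "act_word \<beta> (w + w') v = act_word \<beta> w (act_word \<beta> w' v)"
  by (simp add: act_word_def plus_free_monoid_def)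

lemmas Const_simps = is_hom_simps[OF is_hom_Const]

lemma act_single: "act \<beta> (Poly_Mapping.single w c) v = (\<lambda>\<nu>. Const c * act_word \<beta> w v \<nu>)"
  by (cases "c = 0") (auto simp: act_def fun_eq_iff Const_simps)

lemma act_0: "act \<beta> 0 v = (\<lambda>\<nu>. 0)"
  by (simp add: act_def fun_eq_iff)

lemma act_add: "act \<beta> (p + q) v = (\<lambda>\<nu>. act \<beta> p v \<nu> + act \<beta> q v \<nu>)"
  unfolding act_def
  by (rule ext, rule setsum_keys_plus_distrib) (simp_all add: Const_simps distrib_right)

lemma act_diff: "act \<beta> (p - q) v = (\<lambda>\<nu>. act \<beta> p v \<nu> - act \<beta> q v \<nu>)"
proof
  fix \<nu>
  have "act \<beta> p v \<nu> = act \<beta> (p - q) v \<nu> + act \<beta> q v \<nu>"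
    using act_add[of \<beta> "p - q" q v] by simp
  then show "act \<beta> (p - q) v \<nu> = act \<beta> p v \<nu> - act \<beta> q v \<nu>" by simp
qed

lemma act_uminus: "act \<beta> (- p) v = (\<lambda>\<nu>. - act \<beta> p v \<nu>)"
  using act_diff[of \<beta> 0 p v] by (simp add: act_0)

lemma act_sum: "act \<beta> (sum f A) v = (\<lambda>\<nu>. \<Sum>a\<in>A. act \<beta> (f a) v \<nu>)"
  by (induction A rule: infinite_finite_induct) (simp_all add: act_0 act_add)

lemma act_add_right: "act \<beta> p (\<lambda>\<nu>. v \<nu> + u \<nu>) = (\<lambda>\<nu>. act \<beta> p v \<nu> + act \<beta> p u \<nu>)"
  by (simp add: fun_eq_iff act_def act_word_add distrib_left sum.distrib)

lemma act_Const_right: "act \<beta> p (\<lambda>\<nu>. Const c * v \<nu>) = (\<lambda>\<nu>. Const c * act \<beta> p v \<nu>)"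
  by (simp only: fun_eq_iff act_def act_word_Const sum_distrib_left mult.left_commute) simp

lemma act_0_right: "act \<beta> p (\<lambda>\<nu>. 0) = (\<lambda>\<nu>. 0)"
  using act_Const_right[of \<beta> p 0 "\<lambda>\<nu>. 0"] by (simp add: Const_simps)

lemma act_sum_right: "act \<beta> p (\<lambda>\<nu>. \<Sum>a\<in>A. v a \<nu>) = (\<lambda>\<nu>. \<Sum>a\<in>A. act \<beta> p (v a) \<nu>)"
  by (induction A rule: infinite_finite_induct) (simp_all add: act_0_right act_add_right)

text \<open>By bilinearity two words suffice, and concatenation of words is composition of the
  operators.\<close>

lemma act_mult: "act \<beta> (p * q) v = act \<beta> p (act \<beta> q v)"
proof (induction p rule: poly_mapping_single_induct)
  case (single w c)
  show ?case
  proof (induction q rule: poly_mapping_single_induct)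
    case (single w' c')
    show ?case
      by (simp only: mult_single act_single act_word_mult act_word_Const Const_simps mult.assoc)
  next
    case (add q q')
    then show ?case
      by (simp only: distrib_left act_add act_add_right)
  qed (simp only: mult_zero_right act_0 act_0_right)
qed (simp_all add: act_0 distrib_right act_add)

lemma act_gen: "act \<beta> (gen g) v = act_gen \<beta> g v"
  by (simp add: act_single act_word_def Const_simps)

lemma act_scalar: "act \<beta> (scalar c) v = (\<lambda>\<nu>. Const c * v \<nu>)"
  by (simp add: act_single act_word_def zero_free_monoid_def)

lemma act_1: "act \<beta> 1 v = v"
  using act_scalar[of \<beta> 1 v] by (simp add: Const_simps)

section \<open>Vectors concentrated at one word, and the defining relations\<close>

definition delta :: "'i list \<Rightarrow> 'k mpoly \<Rightarrow> 'i list \<Rightarrow> 'k mpoly"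
  where "delta \<mu> f = (\<lambda>\<nu>. if \<nu> = \<mu> then f else 0)"

lemma delta_0: "delta \<mu> 0 = (\<lambda>\<nu>. 0)"
  by (simp add: delta_def)

lemma act_e: "act \<beta> (e_gen \<mu>) v = delta \<mu> (v \<mu>)"
  by (auto simp: act_gen act_gen_def delta_def)

lemma act_e_delta: "act \<beta> (e_gen \<nu>) (delta \<mu> f) = (if \<nu> = \<mu> then delta \<mu> f else (\<lambda>\<nu>. 0))"
  by (auto simp: act_e delta_def)

lemma act_x_delta: "act \<beta> (x_gen k) (delta \<mu> f) = delta \<mu> (Var k * f)"
  by (auto simp: act_gen act_gen_def delta_def)

lemma act_tau_delta:
  assumes "\<mu> \<in> seqs \<beta>" "1 \<le> k" "k < height \<beta>"
  shows "act \<beta> (tau_gen k) (delta \<mu> f) =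
    delta (swap_entries k \<mu>) (tau_op k (entry \<mu> k) (entry \<mu> (Suc k)) f)"
proof
  fix \<nu>
  have \<mu>: "swap_entries k (swap_entries k \<mu>) = \<mu>"
    using assms by (intro swap_entries_swap_entries) (auto simp: seqs_def)
  show "act \<beta> (tau_gen k) (delta \<mu> f) \<nu> =
      delta (swap_entries k \<mu>) (tau_op k (entry \<mu> k) (entry \<mu> (Suc k)) f) \<nu>"
  proof (cases "\<nu> \<in> seqs \<beta>")
    case True
    then have "swap_entries k (swap_entries k \<nu>) = \<nu>"
      using assms by (intro swap_entries_swap_entries) (auto simp: seqs_def)
    then have "swap_entries k \<nu> = \<mu> \<longleftrightarrow> \<nu> = swap_entries k \<mu>"
      using \<mu> by auto
    then show ?thesis
      using True \<mu> by (auto simp: act_gen act_gen_def delta_def)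
  next
    case False
    then show ?thesis
      using swap_entries_in_seqs[of \<mu> \<beta> k] assms by (auto simp: act_gen act_gen_def delta_def)
  qed
qed

lemma act_power_delta:
  assumes "\<And>f. act \<beta> p (delta \<mu> f) = delta \<mu> (g * f)"
  shows "act \<beta> (p ^ n) (delta \<mu> f) = delta \<mu> (g ^ n * f)"
proof (induction n arbitrary: f)
  case (Suc n)
  then show ?case
    by (simp only: power_Suc act_mult assms mult.assoc)
qed (simp add: act_1)

lemma act_scalar_delta: "act \<beta> (scalar c) (delta \<mu> f) = delta \<mu> (Const c * f)"
  by (auto simp: act_scalar delta_def)

lemma delta_arith:
  "delta \<mu> (f + g) \<nu> = delta \<mu> f \<nu> + delta \<mu> g \<nu>" "delta \<mu> (- f) \<nu> = - delta \<mu> f \<nu>"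
  by (simp_all add: delta_def)

lemma delta_sum: "(\<lambda>\<nu>. \<Sum>a\<in>A. delta \<mu> (g a) \<nu>) = delta \<mu> (\<Sum>a\<in>A. g a)"
  by (auto simp: delta_def)

lemma act_bipoly_eval_delta:
  "act \<beta> (bipoly_eval scalar q (x_gen k) (x_gen l)) (delta \<mu> f) =
    delta \<mu> (bipoly_eval Const q (Var k) (Var l) * f)"
  unfolding bipoly_eval_def
  by (simp only: act_sum act_mult act_power_delta[OF act_x_delta] act_scalar_delta case_prod_unfold
      delta_sum sum_distrib_right mult.assoc)

lemma act_bipoly_dd_delta:
  "act \<beta> (bipoly_dd scalar q (x_gen k) (x_gen l) (x_gen m)) (delta \<mu> f) =
    delta \<mu> (bipoly_dd Const q (Var k) (Var l) (Var m) * f)"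
proof -
  define D :: "nat \<Rightarrow> ('i klr_gen, 'k) free_alg"
    where "D s = (\<Sum>a<s. x_gen l ^ (s - Suc a) * x_gen k ^ a)" for s
  have "act \<beta> (D s) (delta \<mu> f) = delta \<mu> ((\<Sum>a<s. Var l ^ (s - Suc a) * Var k ^ a) * f)" for s f
    unfolding D_def
    by (simp only: act_sum act_mult act_power_delta[OF act_x_delta] delta_sum sum_distrib_right mult.assoc)
  then have "act \<beta> (bipoly_dd scalar q (x_gen k) (x_gen l) (x_gen m)) (delta \<mu> f) =
      delta \<mu> (\<Sum>z\<in>Poly_Mapping.keys q. Const (Poly_Mapping.lookup q (fst z, snd z)) *
        ((\<Sum>a<fst z. Var l ^ (fst z - Suc a) * Var k ^ a) * (Var m ^ snd z * f)))"
    unfolding bipoly_dd_def D_def[symmetric]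
    by (simp only: act_sum act_mult act_power_delta[OF act_x_delta] act_scalar_delta case_prod_unfold
        delta_sum)
  also have "\<dots> = delta \<mu> (bipoly_dd Const q (Var k) (Var l) (Var m) * f)"
    unfolding bipoly_dd_def by (subst sum_distrib_right) (simp only: case_prod_unfold mult.assoc)
  finally show ?thesis .
qed

lemma act_eq_0I:
  assumes "\<And>\<mu> f. \<mu> \<in> seqs \<beta> \<Longrightarrow> act \<beta> p (delta \<mu> f) = (\<lambda>\<nu>. 0)"
    and v: "\<And>\<nu>. \<nu> \<notin> seqs \<beta> \<Longrightarrow> v \<nu> = 0"
  shows "act \<beta> p v = (\<lambda>\<nu>. 0)"
proof -
  have "v = (\<lambda>\<nu>. \<Sum>\<mu>\<in>seqs \<beta>. delta \<mu> (v \<mu>) \<nu>)"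
    using v by (auto simp: delta_def finite_seqs fun_eq_iff)
  then have "act \<beta> p v = act \<beta> p (\<lambda>\<nu>. \<Sum>\<mu>\<in>seqs \<beta>. delta \<mu> (v \<mu>) \<nu>)"
    by (rule arg_cong)
  also have "\<dots> = (\<lambda>\<nu>. \<Sum>\<mu>\<in>seqs \<beta>. act \<beta> p (delta \<mu> (v \<mu>)) \<nu>)"
    by (rule act_sum_right)
  also have "\<dots> = (\<lambda>\<nu>. 0)"
    using assms(1) by simp
  finally show ?thesis .
qed

lemma swap_entries_inj:
  assumes "\<mu> \<in> seqs \<beta>" "\<nu> \<in> seqs \<beta>" "1 \<le> k" "k < height \<beta>"
  shows "swap_entries k \<mu> = swap_entries k \<nu> \<longleftrightarrow> \<mu> = \<nu>"
proof -
  have "swap_entries k (swap_entries k \<rho>) = \<rho>" if "\<rho> \<in> seqs \<beta>" for \<rho>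
    using that assms(3,4) by (intro swap_entries_swap_entries) (auto simp: seqs_def)
  from this[OF assms(1)] this[OF assms(2)] show ?thesis by metis
qed

text \<open>A supported vector is a finite sum of vectors concentrated at one word, where each
  relation is an identity of operators on polynomials. Outside \<open>seqs \<beta>\<close> the sum
  of the idempotents minus 1 acts as -1, hence the condition on v.\<close>

lemma act_relator:
  assumes "p \<in> klr_relators Q \<beta>" and v: "\<And>\<nu>. \<nu> \<notin> seqs \<beta> \<Longrightarrow> v \<nu> = 0"
  shows "act \<beta> p v = (\<lambda>\<nu>. 0)"
proof (rule act_eq_0I[OF _ v])
  fix \<mu> and f :: "'k mpoly"
  assume \<mu>: "\<mu> \<in> seqs \<beta>"
  then have len: "length \<mu> = height \<beta>" by (simp add: seqs_def)
  have swap: "swap_entries k \<nu> \<in> seqs \<beta>" if "\<nu> \<in> seqs \<beta>" "1 \<le> k" "k < height \<beta>" for k \<nu>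
    using that by (intro swap_entries_in_seqs) auto
  note act = act_diff act_uminus act_mult act_e_delta act_x_delta act_0_right act_0
  show "act \<beta> p (delta \<mu> f) = (\<lambda>\<nu>. 0)"
    using assms(1)
  proof cases
    case (idem_orth \<nu> \<nu>')
    then show ?thesis by (auto simp: act)
  next
    case idem_sum
    have "act \<beta> (\<Sum>\<nu>\<in>seqs \<beta>. e_gen \<nu>) (delta \<mu> f) = delta \<mu> f"
      using \<mu> by (auto simp: act_sum act_e fun_eq_iff delta_def finite_seqs)
    then show ?thesis
      using idem_sum by (simp add: act_diff act_1)
  next
    case (x_idem \<nu> k)
    then show ?thesis by (auto simp: act)
  next
    case (tau_idem \<nu> k)
    then show ?thesis
      using \<mu> by (auto simp: act act_tau_delta swap swap_entries_inj)
  next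
    case (x_comm k l)
    then show ?thesis by (auto simp: act mult.commute[of "Var k" "Var l"])
  next
    case (tau_square \<nu> k)
    have "act \<beta> (tau_gen k ^ 2) (delta \<mu> f) =
        act \<beta> (bipoly_eval scalar (Q (entry \<mu> k) (entry \<mu> (k + 1))) (x_gen k) (x_gen (k + 1))) (delta \<mu> f)"
      using tau_square \<mu> len
      by (simp add: power2_eq_square act_mult act_tau_delta swap entry_swap_entries
          tau_op_square act_bipoly_eval_delta swap_entries_swap_entries)
    then show ?thesis
      using tau_square by (auto simp: act_diff act_mult act_e_delta act_0_right)
  next
    case (tau_x \<nu> k l)
    show ?thesis
    proof (cases "\<nu> = \<mu>")
      case True
      \<comment> \<open>With equal neighbours the crossing stays in the summand of \<mu>, where the
        correction term lies.\<close>
      have eq: "swap_entries k \<mu> = \<mu>" if "entry \<mu> k = entry \<mu> (Suc k)"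
        using tau_x len that
        by (intro list_eq_entryI)
          (auto simp: length_swap_entries entry_swap_entries Transposition.transpose_def)
      show ?thesis
        using tau_x \<mu> eq unfolding True
        by (auto simp: act act_tau_delta tau_op_Var fun_eq_iff delta_arith delta_0)
    next
      case False
      then show ?thesis
        using tau_x by (auto simp: act)
    qed
  next
    case (tau_comm k l)
    then have kl: "Suc k < l \<or> Suc l < k" by auto
    have ent: "entry (swap_entries l \<mu>) k = entry \<mu> k" "entry (swap_entries l \<mu>) (Suc k) = entry \<mu> (Suc k)"
      "entry (swap_entries k \<mu>) l = entry \<mu> l" "entry (swap_entries k \<mu>) (Suc l) = entry \<mu> (Suc l)"
      using tau_comm kl len by (auto simp: entry_swap_entries Transposition.transpose_def)
    have "swap_entries k (swap_entries l \<mu>) = swap_entries l (swap_entries k \<mu>)"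
      using tau_comm kl len by (intro swap_entries_commute) auto
    then show ?thesis
      using tau_comm \<mu> by (simp add: act act_tau_delta swap ent tau_op_commute[OF kl])
  next
    case (tau_braid \<nu> k)
    show ?thesis
    proof (cases "\<nu> = \<mu>")
      case True
      define a b c where "a = entry \<mu> k" and "b = entry \<mu> (Suc k)" and "c = entry \<mu> (Suc (Suc k))"
      have ent: "entry (swap_entries k \<nu>') (Suc (Suc k)) = entry \<nu>' (Suc (Suc k))"
        "entry (swap_entries k \<nu>') (Suc k) = entry \<nu>' k"
        "entry (swap_entries k \<nu>') k = entry \<nu>' (Suc k)"
        "entry (swap_entries (Suc k) \<nu>') (Suc (Suc k)) = entry \<nu>' (Suc k)"
        "entry (swap_entries (Suc k) \<nu>') (Suc k) = entry \<nu>' (Suc (Suc k))"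
        "entry (swap_entries (Suc k) \<nu>') k = entry \<nu>' k"
        if "length \<nu>' = height \<beta>" for \<nu>'
        using tau_braid that by (auto simp: entry_swap_entries Transposition.transpose_def)
      have 1: "act \<beta> (tau_gen (k + 1) * tau_gen k * tau_gen (k + 1)) (delta \<mu> f) =
          delta (swap_entries (Suc k) (swap_entries k (swap_entries (Suc k) \<mu>)))
            (tau_op (Suc k) a b (tau_op k a c (tau_op (Suc k) b c f)))"
        using tau_braid \<mu> len
        by (simp add: act_mult act_tau_delta swap ent length_swap_entries a_def b_def c_def)
      have 2: "act \<beta> (tau_gen k * tau_gen (k + 1) * tau_gen k) (delta \<mu> f) =
          delta (swap_entries (Suc k) (swap_entries k (swap_entries (Suc k) \<mu>)))
            (tau_op k b c (tau_op (Suc k) a c (tau_op k a b f)))"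
        using tau_braid \<mu> len swap_entries_braid[of k \<mu>]
        by (simp add: act_mult act_tau_delta swap ent length_swap_entries a_def b_def c_def)
      \<comment> \<open>The correction is present only for equal outer colours, and then reversing
        the three letters returns the word \<mu>.\<close>
      have 3: "swap_entries (Suc k) (swap_entries k (swap_entries (Suc k) \<mu>)) = \<mu>" if "a = c"
      proof (rule list_eq_entryI)
        fix l :: nat
        assume "1 \<le> l"
        then show "entry (swap_entries (Suc k) (swap_entries k (swap_entries (Suc k) \<mu>))) l = entry \<mu> l"
          using tau_braid len that
          by (auto simp: entry_swap_entries length_swap_entries Transposition.transpose_def a_def c_def)
      qed (simp add: length_swap_entries)
      have "act \<beta> (tau_gen (k + 1) * tau_gen k * tau_gen (k + 1) - tau_gen k * tau_gen (k + 1) * tau_gen k)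
          (delta \<mu> f) =
          delta (swap_entries (Suc k) (swap_entries k (swap_entries (Suc k) \<mu>)))
            (if a = c then bipoly_dd Const (Q a b) (Var (Suc (Suc k))) (Var k) (Var (Suc k)) * f else 0)"
        unfolding act_diff 1 2 tau_op_braid[symmetric] by (auto simp: delta_def)
      also have "\<dots> = act \<beta> (if a = c
         then bipoly_dd scalar (Q a b) (x_gen (k + 2)) (x_gen k) (x_gen (k + 1)) else 0) (delta \<mu> f)"
        using 3 by (simp add: act_bipoly_dd_delta delta_0 act_0)
      finally show ?thesis
        using True tau_braid(1)
        by (auto simp: act_diff act_mult act_e_delta act_0 a_def b_def c_def)
    next
      case False
      then show ?thesis
        using tau_braid(1) by (auto simp: act)
    qed
  qed
qed

section \<open>The submodule and the annihilator of the quotient module\<close>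

definition supported :: "'i root_lattice \<Rightarrow> ('i list \<Rightarrow> 'k mpoly) set"
  where "supported \<beta> = {v. \<forall>\<nu>. \<nu> \<notin> seqs \<beta> \<longrightarrow> v \<nu> = 0}"

definition rep_submodule :: "'i root_lattice \<Rightarrow> ('i list \<Rightarrow> 'k mpoly) set"
  where "rep_submodule \<beta> = {v \<in> supported \<beta>. \<forall>\<nu>\<in>seqs \<beta>. v \<nu> \<in> rep_ideal \<nu>}"

lemma act_gen_closed:
  assumes "g \<in> klr_gens \<beta>"
  shows "v \<in> supported \<beta> \<Longrightarrow> act_gen \<beta> g v \<in> supported \<beta>"
    and "v \<in> rep_submodule \<beta> \<Longrightarrow> act_gen \<beta> g v \<in> rep_submodule \<beta>"
proof -
  show supp: "act_gen \<beta> g v \<in> supported \<beta>" if "v \<in> supported \<beta>" for v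
    using that by (auto simp: supported_def act_gen_def split: klr_gen.split)
  assume v: "v \<in> rep_submodule \<beta>"
  have "act_gen \<beta> g v \<nu> \<in> rep_ideal \<nu>" if \<nu>: "\<nu> \<in> seqs \<beta>" for \<nu>
  proof (cases g)
    case (Gen_e \<mu>)
    then show ?thesis
      using v \<nu> by (auto simp: act_gen_def rep_submodule_def rep_ideal_0)
  next
    case (Gen_x k)
    then show ?thesis
      using v \<nu> by (auto simp: act_gen_def rep_submodule_def rep_ideal_mult)
  next
    case (Gen_tau k)
    then have k: "k \<in> {1..<height \<beta>}"
      using assms by (auto simp: klr_gens_def)
    then obtain p where p: "k = Suc p" by (cases k) auto
    let ?\<mu> = "swap_entries k \<nu>"
    have \<mu>: "?\<mu> \<in> seqs \<beta>" using \<nu> k by (rule swap_entries_in_seqs)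
    then have "v ?\<mu> \<in> rep_ideal ?\<mu>" using v by (simp add: rep_submodule_def)
    moreover have "Suc p < length ?\<mu>" using \<mu> k p by (auto simp: seqs_def)
    ultimately have "tau_op k (entry ?\<mu> k) (entry ?\<mu> (k + 1)) (v ?\<mu>) \<in> rep_ideal (swap_entries k ?\<mu>)"
      using tau_op_rep_ideal[of p ?\<mu> "v ?\<mu>"] by (simp add: p swap_entries_def entry_def)
    moreover have "swap_entries k ?\<mu> = \<nu>"
      using \<nu> k by (intro swap_entries_swap_entries) (auto simp: seqs_def)
    ultimately show ?thesis
      using Gen_tau \<nu> by (simp add: act_gen_def)
  qed
  then show "act_gen \<beta> g v \<in> rep_submodule \<beta>"
    using supp v by (auto simp: rep_submodule_def)
qed

lemma act_word_closed:
  assumes "set (letters w) \<subseteq> klr_gens \<beta>"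
  shows "v \<in> supported \<beta> \<Longrightarrow> act_word \<beta> w v \<in> supported \<beta>"
    and "v \<in> rep_submodule \<beta> \<Longrightarrow> act_word \<beta> w v \<in> rep_submodule \<beta>"
proof -
  have "(v \<in> supported \<beta> \<longrightarrow> foldr (act_gen \<beta>) gs v \<in> supported \<beta>) \<and>
      (v \<in> rep_submodule \<beta> \<longrightarrow> foldr (act_gen \<beta>) gs v \<in> rep_submodule \<beta>)"
    if "set gs \<subseteq> klr_gens \<beta>" for gs
    using that by (induction gs) (auto intro: act_gen_closed)
  from this[OF assms] show "v \<in> supported \<beta> \<Longrightarrow> act_word \<beta> w v \<in> supported \<beta>"
    and "v \<in> rep_submodule \<beta> \<Longrightarrow> act_word \<beta> w v \<in> rep_submodule \<beta>"
    by (simp_all add: act_word_def)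
qed

lemma act_closed:
  assumes p: "p \<in> carrier (free_algebra (klr_gens \<beta>))"
  shows "v \<in> supported \<beta> \<Longrightarrow> act \<beta> p v \<in> supported \<beta>"
    and "v \<in> rep_submodule \<beta> \<Longrightarrow> act \<beta> p v \<in> rep_submodule \<beta>"
proof -
  have w: "set (letters w) \<subseteq> klr_gens \<beta>" if "w \<in> Poly_Mapping.keys p" for w
    using p that by (auto simp: free_algebra_def)
  show supp: "act \<beta> p v \<in> supported \<beta>" if "v \<in> supported \<beta>" for v
    using act_word_closed(1)[OF w that] by (auto simp: supported_def act_def intro!: sum.neutral)
  assume v: "v \<in> rep_submodule \<beta>"
  have "act \<beta> p v \<nu> \<in> rep_ideal \<nu>" if "\<nu> \<in> seqs \<beta>" for \<nu>
    unfolding act_def rep_ideal_def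
    using act_word_closed(2)[OF w v] that
    by (intro ideal_hull.span_sum ideal_hull.span_scale) (auto simp: rep_submodule_def rep_ideal_def)
  then show "act \<beta> p v \<in> rep_submodule \<beta>"
    using supp v by (auto simp: rep_submodule_def)
qed

text \<open>The annihilator of \<open>supported \<beta>\<close> modulo
  \<open>rep_submodule \<beta>\<close>, described without forming the quotient module.\<close>

definition rep_annihilator :: "'i root_lattice \<Rightarrow> ('i klr_gen, 'k) free_alg set"
  where "rep_annihilator \<beta> =
    {p \<in> carrier (free_algebra (klr_gens \<beta>)). \<forall>v\<in>supported \<beta>. act \<beta> p v \<in> rep_submodule \<beta>}"

lemma rep_submodule_closed:
  "(\<lambda>\<nu>. 0) \<in> rep_submodule \<beta>"
  "v \<in> rep_submodule \<beta> \<Longrightarrow> u \<in> rep_submodule \<beta> \<Longrightarrow> (\<lambda>\<nu>. v \<nu> + u \<nu>) \<in> rep_submodule \<beta>"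
  "v \<in> rep_submodule \<beta> \<Longrightarrow> (\<lambda>\<nu>. - v \<nu>) \<in> rep_submodule \<beta>"
  using rep_ideal_mult[of "v _" _ "- 1"]
  by (auto simp: rep_submodule_def supported_def rep_ideal_0 rep_ideal_add)

lemma relators_annihilator: "klr_relators Q \<beta> \<subseteq> rep_annihilator \<beta>"
  using klr_relators_carrier[of Q \<beta>] act_relator[of _ \<beta>]
  by (auto simp: rep_annihilator_def supported_def rep_submodule_closed(1))

lemma idem_annihilator:
  "(\<Sum>\<nu> | \<nu> \<in> seqs \<beta> \<and> \<nu> \<noteq> [] \<and> entry \<nu> 1 = i. e_gen \<nu>) \<in> rep_annihilator \<beta>"
proof -
  let ?S = "{\<nu> \<in> seqs \<beta>. \<nu> \<noteq> [] \<and> entry \<nu> 1 = i}"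
  have fin: "finite ?S" by (rule finite_subset[OF _ finite_seqs]) auto
  have "sum e_gen ?S \<in> carrier (free_algebra (klr_gens \<beta>))"
    by (intro free_algebra_sum free_algebra_gen) (auto simp: klr_gens_def)
  moreover have "act \<beta> (sum e_gen ?S) v \<in> rep_submodule \<beta>" if v: "v \<in> supported \<beta>" for v
  proof -
    have "act \<beta> (sum e_gen ?S) v = (\<lambda>\<nu>. if \<nu> \<in> ?S then v \<nu> else 0)"
      using fin by (auto simp: act_sum act_e delta_def fun_eq_iff)
    moreover have "v \<nu> \<in> rep_ideal \<nu>" if "\<nu> \<in> ?S" for \<nu>
      using that by (intro rep_ideal_UNIV) (auto simp: entry_def)
    ultimately show ?thesis
      using v by (auto simp: rep_submodule_def supported_def rep_ideal_0)
  qed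
  ultimately show ?thesis
    by (simp add: rep_annihilator_def)
qed

text \<open>Stability of the submodule gives closure under left multiplication, stability of the
  supported vectors closure under right multiplication.\<close>

lemma ideal_rep_annihilator: "ideal (rep_annihilator \<beta>) (free_algebra (klr_gens \<beta>))"
proof (rule idealI)
  let ?F = "free_algebra (klr_gens \<beta>) :: ('i klr_gen, 'k) free_alg ring"
  interpret ring ?F by (rule free_algebra_ring)
  show "ring ?F" by (rule free_algebra_ring)
  show "subgroup (rep_annihilator \<beta>) (add_monoid ?F)"
  proof (rule add.subgroupI)
    show "rep_annihilator \<beta> \<noteq> {}"
      using idem_annihilator by blast
    fix p assume p: "p \<in> rep_annihilator \<beta>"
    then have "- p \<in> carrier ?F" "- p \<in> rep_annihilator \<beta>"
      by (auto simp: rep_annihilator_def act_uminus rep_submodule_closed(3) intro: free_algebra_closed)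
    moreover have "\<ominus>\<^bsub>?F\<^esub> p = - p"
      using p \<open>- p \<in> carrier ?F\<close>
      by (intro minus_equality) (auto simp: rep_annihilator_def free_algebra_def)
    ultimately show "\<ominus>\<^bsub>?F\<^esub> p \<in> rep_annihilator \<beta>" by simp
  next
    fix p q assume "p \<in> rep_annihilator \<beta>" "q \<in> rep_annihilator \<beta>"
    then have "p + q \<in> rep_annihilator \<beta>"
      by (auto simp: rep_annihilator_def act_add rep_submodule_closed(2) intro: free_algebra_closed)
    then show "p \<oplus>\<^bsub>?F\<^esub> q \<in> rep_annihilator \<beta>"
      by (simp add: free_algebra_def)
  qed (auto simp: rep_annihilator_def)
  fix p q assume "p \<in> rep_annihilator \<beta>" "q \<in> carrier ?F"
  then have "q * p \<in> rep_annihilator \<beta>" "p * q \<in> rep_annihilator \<beta>"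
    by (auto simp: rep_annihilator_def act_mult act_closed intro: free_algebra_closed)
  then show "q \<otimes>\<^bsub>?F\<^esub> p \<in> rep_annihilator \<beta>" "p \<otimes>\<^bsub>?F\<^esub> q \<in> rep_annihilator \<beta>"
    by (simp_all add: free_algebra_def)
qed

lemma one_notin_rep_annihilator:
  assumes "\<nu> \<in> seqs \<beta>" "\<And>l. l < length \<nu> \<Longrightarrow> \<nu> ! l = i \<Longrightarrow> strand_degree i \<nu> l > 0"
  shows "1 \<notin> rep_annihilator \<beta>"
proof
  assume "1 \<in> rep_annihilator \<beta>"
  moreover have "delta \<nu> 1 \<in> supported \<beta>"
    using assms(1) by (auto simp: delta_def supported_def)
  ultimately have "delta \<nu> 1 \<in> rep_submodule \<beta>"
    by (auto simp: rep_annihilator_def act_1)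
  then have "1 \<in> rep_ideal \<nu>"
    using assms(1) by (auto simp: rep_submodule_def delta_def)
  with rep_ideal_proper[OF assms(2)] show False by blast
qed

end

section \<open>Vanishing of the quotient\<close>

text \<open>Ideals of a whole type, so that calculations modulo J carry no membership
  conditions.\<close>

locale two_sided_ideal =
  fixes J :: "'a::ring_1 set"
  assumes zero_mem: "0 \<in> J"
    and add_mem: "a \<in> J \<Longrightarrow> b \<in> J \<Longrightarrow> a + b \<in> J"
    and mult_left_mem: "a \<in> J \<Longrightarrow> b * a \<in> J"
    and mult_right_mem: "a \<in> J \<Longrightarrow> a * b \<in> J"
begin

definition cong_ideal :: "'a \<Rightarrow> 'a \<Rightarrow> bool"  (infix "\<approx>" 50)
  where "a \<approx> b \<longleftrightarrow> a - b \<in> J"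

lemma cong_refl [simp, intro!]: "a \<approx> a"
  by (simp add: cong_ideal_def zero_mem)

lemma cong_sym: "a \<approx> b \<Longrightarrow> b \<approx> a"
  using mult_left_mem[of "a - b" "- 1"] by (simp add: cong_ideal_def)

lemma cong_trans [trans]: "a \<approx> b \<Longrightarrow> b \<approx> c \<Longrightarrow> a \<approx> c"
  using add_mem[of "a - b" "b - c"] by (simp add: cong_ideal_def)

lemma cong_add: "a \<approx> b \<Longrightarrow> c \<approx> d \<Longrightarrow> a + c \<approx> b + d"
  using add_mem[of "a - b" "c - d"] by (simp add: cong_ideal_def algebra_simps)

lemma cong_mult_left: "a \<approx> b \<Longrightarrow> c * a \<approx> c * b"
  using mult_left_mem[of "a - b" c] by (simp add: cong_ideal_def algebra_simps)

lemma cong_mult_right: "a \<approx> b \<Longrightarrow> a * c \<approx> b * c"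
  using mult_right_mem[of "a - b" c] by (simp add: cong_ideal_def algebra_simps)

lemma cong_diff: "a \<approx> b \<Longrightarrow> c \<approx> d \<Longrightarrow> a - c \<approx> b - d"
  using cong_add[OF _ cong_mult_left[of c d "- 1"]] by simp

lemma cong_sum: "(\<And>s. s \<in> S \<Longrightarrow> f s \<approx> g s) \<Longrightarrow> sum f S \<approx> sum g S"
  by (induction S rule: infinite_finite_induct) (auto intro: cong_add)

section \<open>Commutation modulo the ideal\<close>

definition comm :: "'a \<Rightarrow> 'a \<Rightarrow> bool"
  where "comm a b \<longleftrightarrow> a * b \<approx> b * a"

lemma comm_sym: "comm a b \<Longrightarrow> comm b a"
  by (simp add: comm_def cong_sym)

lemma comm_refl: "comm a a"
  by (simp add: comm_def)

lemma comm_0: "comm 0 a" and comm_1: "comm 1 a"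
  by (simp_all add: comm_def)

lemma comm_add: "comm a c \<Longrightarrow> comm b c \<Longrightarrow> comm (a + b) c"
  by (simp add: comm_def distrib_left distrib_right cong_add)

lemma comm_mult: "comm a c \<Longrightarrow> comm b c \<Longrightarrow> comm (a * b) c"
proof -
  assume "comm a c" "comm b c"
  then have "a * (b * c) \<approx> a * (c * b)" "(a * c) * b \<approx> (c * a) * b"
    unfolding comm_def by (auto intro: cong_mult_left cong_mult_right)
  then show ?thesis
    unfolding comm_def mult.assoc by (rule cong_trans)
qed

lemma comm_power: "comm a c \<Longrightarrow> comm (a ^ n) c"
  by (induction n) (simp_all add: comm_1 comm_mult)

lemma comm_sum: "(\<And>s. s \<in> S \<Longrightarrow> comm (f s) c) \<Longrightarrow> comm (sum f S) c"
  by (induction S rule: infinite_finite_induct) (simp_all add: comm_0 comm_add)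

text \<open>For commuting x and y this is (x^l - y^l) / (x - y). Powers of x stand on the left and a
  new y is appended on the right, just as they arise when tau is moved past y^l.\<close>

primrec complete_sym :: "'a \<Rightarrow> 'a \<Rightarrow> nat \<Rightarrow> 'a"
  where
    "complete_sym x y 0 = 0"
  | "complete_sym x y (Suc l) = x ^ l + complete_sym x y l * y"

lemma complete_sym_Suc_eq: "complete_sym x y (Suc l) = (\<Sum>a\<le>l. x ^ (l - a) * y ^ a)"
proof (induction l)
  case (Suc l)
  have "complete_sym x y (Suc (Suc l)) = x ^ Suc l + (\<Sum>a\<le>l. x ^ (l - a) * y ^ a) * y"
    by (subst complete_sym.simps(2)) (simp only: Suc)
  also have "(\<Sum>a\<le>l. x ^ (l - a) * y ^ a) * y = (\<Sum>a\<le>l. x ^ (Suc l - Suc a) * y ^ Suc a)"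
    by (simp add: sum_distrib_right mult.assoc power_commutes)
  also have "x ^ Suc l + \<dots> = (\<Sum>a\<le>Suc l. x ^ (Suc l - a) * y ^ a)"
    by (subst sum.atMost_Suc_shift) simp
  finally show ?case .
qed simp

lemma comm_complete_sym: "comm x c \<Longrightarrow> comm y c \<Longrightarrow> comm (complete_sym x y l) c"
  by (induction l) (simp_all add: comm_0 comm_add comm_mult comm_power)

text \<open>
  Let $G$ be the divided difference of $F$. Then $\tau F(y) e = F(x) \tau e + G e = G e$, so
  $\tau G e = \tau^2 F(y) e = 0$, and $G e = (\tau y - x \tau) G e = 0$.
\<close>

lemma divided_difference_cong_0:
  assumes comm_xe: "comm x e" and comm_ye: "comm y e" and comm_te: "comm \<tau> e" and comm_xy: "comm x y"
    and cross: "\<tau> * y * e \<approx> (x * \<tau> + 1) * e" and square: "\<tau> * \<tau> * e \<approx> 0"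
    and comm_c: "\<And>l. l \<le> n \<Longrightarrow> comm (c l) e \<and> comm (c l) y \<and> comm (c l) \<tau>"
    and zero: "(\<Sum>l\<le>n. c l * x ^ l) * e \<approx> 0"
  shows "(\<Sum>l\<le>n. c l * complete_sym x y l) * e \<approx> 0"
proof -
  define F where "F z = (\<Sum>l\<le>n. c l * z ^ l)" for z
  define G where "G = (\<Sum>l\<le>n. c l * complete_sym x y l)"
  have Fe: "comm (F y) e" and Ge: "comm G e" and Gy: "comm G y"
    unfolding F_def G_def using comm_c comm_xe comm_ye comm_xy comm_refl
    by (auto intro!: comm_sum comm_mult comm_power comm_complete_sym)
  \<comment> \<open>The crossing relation is known only next to e, so e is moved past the last y
    before the induction hypothesis is applied, and back afterwards.\<close>
  have 1: "\<tau> * y ^ l * e \<approx> (x ^ l * \<tau> + complete_sym x y l) * e" for l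
  proof (induction l)
    case (Suc l)
    have "\<tau> * y ^ Suc l * e = \<tau> * y ^ l * (y * e)"
      by (simp only: power_Suc2 mult.assoc)
    also have "\<dots> \<approx> \<tau> * y ^ l * (e * y)"
      using comm_ye unfolding comm_def by (rule cong_mult_left)
    also have "\<tau> * y ^ l * (e * y) = (\<tau> * y ^ l * e) * y" by (simp only: mult.assoc)
    also have "\<dots> \<approx> (x ^ l * \<tau> + complete_sym x y l) * e * y"
      by (rule cong_mult_right) (rule Suc)
    also have "(x ^ l * \<tau> + complete_sym x y l) * e * y = (x ^ l * \<tau> + complete_sym x y l) * (e * y)"
      by (simp only: mult.assoc)
    also have "\<dots> \<approx> (x ^ l * \<tau> + complete_sym x y l) * (y * e)"
      using comm_sym[OF comm_ye] unfolding comm_def by (rule cong_mult_left)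
    also have "(x ^ l * \<tau> + complete_sym x y l) * (y * e) =
        x ^ l * (\<tau> * y * e) + complete_sym x y l * y * e"
      by (simp only: distrib_right mult.assoc)
    also have "\<dots> \<approx> x ^ l * ((x * \<tau> + 1) * e) + complete_sym x y l * y * e"
      by (intro cong_add cong_mult_left cross cong_refl)
    also have "x ^ l * ((x * \<tau> + 1) * e) + complete_sym x y l * y * e =
        (x ^ Suc l * \<tau> + complete_sym x y (Suc l)) * e"
      by (simp only: power_Suc2 complete_sym.simps distrib_right distrib_left mult.assoc mult_1_left add.assoc)
    finally show ?case .
  qed simp
  have 2: "\<tau> * (c l * y ^ l) * e \<approx> (c l * x ^ l) * \<tau> * e + c l * complete_sym x y l * e" if "l \<le> n" for l
  proof -
    have "\<tau> * (c l * y ^ l) * e = (\<tau> * c l) * (y ^ l * e)" by (simp only: mult.assoc)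
    also have "\<dots> \<approx> (c l * \<tau>) * (y ^ l * e)"
      using comm_c[OF that] by (intro cong_mult_right) (simp add: comm_def cong_sym)
    also have "(c l * \<tau>) * (y ^ l * e) = c l * (\<tau> * y ^ l * e)" by (simp only: mult.assoc)
    also have "\<dots> \<approx> c l * ((x ^ l * \<tau> + complete_sym x y l) * e)" by (intro cong_mult_left 1)
    finally show ?thesis by (simp only: distrib_left distrib_right mult.assoc)
  qed
  have "\<tau> * F y * e \<approx> F x * \<tau> * e + G * e"
    using cong_sum[of "{..n}" "\<lambda>l. \<tau> * (c l * y ^ l) * e", OF 2]
    by (simp add: F_def G_def sum_distrib_left sum_distrib_right sum.distrib)
  also have "F x * \<tau> * e + G * e = F x * (\<tau> * e) + G * e" by (simp only: mult.assoc)
  also have "\<dots> \<approx> F x * (e * \<tau>) + G * e"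
    using comm_te by (intro cong_add cong_mult_left) (simp_all add: comm_def)
  also have "F x * (e * \<tau>) + G * e = (F x * e) * \<tau> + G * e" by (simp only: mult.assoc)
  also have "\<dots> \<approx> 0 * \<tau> + G * e"
    using zero by (intro cong_add cong_mult_right) (simp_all add: F_def)
  finally have G: "G * e \<approx> \<tau> * F y * e" by (simp add: cong_sym)
  have "\<tau> * (G * e) \<approx> \<tau> * (\<tau> * F y * e)" using G by (rule cong_mult_left)
  also have "\<tau> * (\<tau> * F y * e) = \<tau> * \<tau> * (F y * e)" by (simp only: mult.assoc)
  also have "\<dots> \<approx> \<tau> * \<tau> * (e * F y)" using Fe unfolding comm_def by (rule cong_mult_left)
  also have "\<tau> * \<tau> * (e * F y) = \<tau> * \<tau> * e * F y" by (simp only: mult.assoc)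
  also have "\<dots> \<approx> 0 * F y" using square by (rule cong_mult_right)
  finally have tG: "\<tau> * (G * e) \<approx> 0" by simp
  have "G * e \<approx> e * G" using Ge by (simp add: comm_def)
  also have "e * G = (x * \<tau> + 1) * e * G - x * \<tau> * (e * G)" by (simp add: algebra_simps)
  also have "\<dots> \<approx> \<tau> * y * e * G - x * \<tau> * (G * e)"
    by (rule cong_diff[OF cong_mult_right[OF cong_sym[OF cross]] cong_mult_left[OF comm_sym[OF Ge, unfolded comm_def]]])
  also have "\<tau> * y * e * G - x * \<tau> * (G * e) = \<tau> * y * (e * G) - x * (\<tau> * (G * e))"
    by (simp only: mult.assoc)
  also have "\<dots> \<approx> \<tau> * y * (G * e) - x * 0"
    by (rule cong_diff[OF cong_mult_left[OF comm_sym[OF Ge, unfolded comm_def]] cong_mult_left[OF tG]])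
  also have "\<tau> * y * (G * e) - x * 0 = \<tau> * (y * G) * e" by (simp add: mult.assoc)
  also have "\<dots> \<approx> \<tau> * (G * y) * e"
    using Gy by (intro cong_mult_right cong_mult_left) (simp add: comm_def cong_sym)
  also have "\<tau> * (G * y) * e = \<tau> * G * (y * e)" by (simp only: mult.assoc)
  also have "\<dots> \<approx> \<tau> * G * (e * y)" using comm_ye by (intro cong_mult_left) (simp add: comm_def)
  also have "\<tau> * G * (e * y) = \<tau> * (G * e) * y" by (simp only: mult.assoc)
  also have "\<dots> \<approx> 0 * y" using tG by (rule cong_mult_right)
  finally show ?thesis by (simp add: G_def)
qed

text \<open>Here e belongs to a word and e' to the word with two letters exchanged. With F(x) e' =
  0, F(y) q e = F(y) tau tau e = F(y) tau e' tau = tau F(x) e' tau = 0.\<close>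

lemma quadratic_cong_0:
  assumes comm_xe: "comm x e'"
    and te: "\<tau> * e \<approx> e' * \<tau>" and square: "\<tau> * \<tau> * e \<approx> q * e" and cross: "\<tau> * x * e' \<approx> y * \<tau> * e'"
    and comm_c: "\<And>l. l \<le> n \<Longrightarrow> comm (c l) \<tau>"
    and zero: "(\<Sum>l\<le>n. c l * x ^ l) * e' \<approx> 0"
  shows "(\<Sum>l\<le>n. c l * y ^ l) * q * e \<approx> 0"
proof -
  define F where "F z = (\<Sum>l\<le>n. c l * z ^ l)" for z
  have 1: "\<tau> * x ^ l * e' \<approx> y ^ l * \<tau> * e'" for l
  proof (induction l)
    case (Suc l)
    have "\<tau> * x ^ Suc l * e' = \<tau> * x ^ l * (x * e')"
      by (simp only: power_Suc2 mult.assoc)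
    also have "\<dots> \<approx> \<tau> * x ^ l * (e' * x)"
      using comm_xe unfolding comm_def by (rule cong_mult_left)
    also have "\<tau> * x ^ l * (e' * x) = (\<tau> * x ^ l * e') * x" by (simp only: mult.assoc)
    also have "\<dots> \<approx> y ^ l * \<tau> * e' * x" by (rule cong_mult_right) (rule Suc)
    also have "y ^ l * \<tau> * e' * x = y ^ l * \<tau> * (e' * x)" by (simp only: mult.assoc)
    also have "\<dots> \<approx> y ^ l * \<tau> * (x * e')"
      using comm_sym[OF comm_xe] unfolding comm_def by (rule cong_mult_left)
    also have "y ^ l * \<tau> * (x * e') = y ^ l * (\<tau> * x * e')" by (simp only: mult.assoc)
    also have "\<dots> \<approx> y ^ l * (y * \<tau> * e')" using cross by (rule cong_mult_left)
    finally show ?case by (simp only: power_Suc2 mult.assoc)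
  qed simp
  have 2: "c l * y ^ l * \<tau> * e' \<approx> \<tau> * (c l * x ^ l) * e'" if "l \<le> n" for l
  proof -
    have "c l * (y ^ l * \<tau> * e') \<approx> c l * (\<tau> * x ^ l * e')"
      by (intro cong_mult_left cong_sym[OF 1])
    also have "c l * (\<tau> * x ^ l * e') = (c l * \<tau>) * (x ^ l * e')" by (simp only: mult.assoc)
    also have "\<dots> \<approx> (\<tau> * c l) * (x ^ l * e')"
      using comm_c[OF that] by (intro cong_mult_right) (simp add: comm_def)
    finally show ?thesis by (simp only: mult.assoc)
  qed
  have 3: "F y * \<tau> * e' \<approx> \<tau> * F x * e'"
    unfolding F_def sum_distrib_left sum_distrib_right by (intro cong_sum 2) simp
  have "F y * q * e = F y * (q * e)" by (simp only: mult.assoc)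
  also have "\<dots> \<approx> F y * (\<tau> * \<tau> * e)" by (rule cong_mult_left[OF cong_sym[OF square]])
  also have "F y * (\<tau> * \<tau> * e) = F y * \<tau> * (\<tau> * e)" by (simp only: mult.assoc)
  also have "\<dots> \<approx> F y * \<tau> * (e' * \<tau>)" using te by (rule cong_mult_left)
  also have "F y * \<tau> * (e' * \<tau>) = F y * \<tau> * e' * \<tau>" by (simp only: mult.assoc)
  also have "\<dots> \<approx> \<tau> * F x * e' * \<tau>" using 3 by (rule cong_mult_right)
  also have "\<tau> * F x * e' * \<tau> = \<tau> * (F x * e') * \<tau>" by (simp only: mult.assoc)
  also have "\<dots> \<approx> \<tau> * 0 * \<tau>" using zero by (intro cong_mult_right cong_mult_left) (simp add: F_def)
  finally show ?thesis by (simp add: F_def)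
qed

end


lemma scalar_central:
  fixes p :: "('g, 'k::comm_ring_1) free_alg"
  shows "scalar c * p = p * scalar c"
  by (induction p rule: poly_mapping_single_induct)
    (simp_all add: mult_single mult.commute[of c] distrib_left distrib_right)

section \<open>Monic relations on the idempotents\<close>

locale klr_vanishing = klr_datum form t Q + two_sided_ideal J
  for form :: "'i lattice_form" and t :: "'i \<Rightarrow> 'i \<Rightarrow> 'k::comm_ring_1" and Q
    and J :: "('i klr_gen, 'k) free_alg set" +
  fixes i :: 'i and \<beta> :: "'i root_lattice"
  assumes relators_mem: "klr_relators Q \<beta> \<subseteq> J"
    and idem_mem: "(\<Sum>\<nu> | \<nu> \<in> seqs \<beta> \<and> \<nu> \<noteq> [] \<and> entry \<nu> 1 = i. e_gen \<nu>) \<in> J"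
begin

lemma relator_cong: "a - b \<in> klr_relators Q \<beta> \<Longrightarrow> a \<approx> b"
  using relators_mem by (auto simp: cong_ideal_def)

lemma cong_0I: "a \<in> J \<Longrightarrow> a \<approx> 0"
  by (simp add: cong_ideal_def)

lemma idem_cong_0:
  assumes "\<nu> \<in> seqs \<beta>" "\<nu> \<noteq> []" "entry \<nu> 1 = i"
  shows "e_gen \<nu> \<approx> 0"
proof -
  let ?S = "{\<nu>. \<nu> \<in> seqs \<beta> \<and> \<nu> \<noteq> [] \<and> entry \<nu> 1 = i}"
  have fin: "finite ?S" by (rule finite_subset[OF _ finite_seqs]) auto
  have "e_gen \<nu> = (\<Sum>\<mu>\<in>?S. if \<nu> = \<mu> then e_gen \<nu> else 0)"
    using fin assms by (subst sum.delta') auto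
  also have "\<dots> \<approx> (\<Sum>\<mu>\<in>?S. e_gen \<nu> * e_gen \<mu>)"
    by (intro cong_sum cong_sym[OF relator_cong] klr_relators.idem_orth) (use assms in auto)
  also have "(\<Sum>\<mu>\<in>?S. e_gen \<nu> * e_gen \<mu>) = e_gen \<nu> * (\<Sum>\<mu>\<in>?S. e_gen \<mu>)"
    by (simp only: sum_distrib_left)
  also have "\<dots> \<approx> 0"
    by (intro cong_0I mult_left_mem idem_mem)
  finally show ?thesis .
qed

text \<open>The idempotents sum to 1. This removes the idempotent from relations that are only given
  after multiplication by one.\<close>

lemma cong_on_idemI:
  assumes "\<And>\<nu>. \<nu> \<in> seqs \<beta> \<Longrightarrow> a * e_gen \<nu> \<approx> b * e_gen \<nu>"
  shows "a \<approx> b"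
proof -
  let ?E = "\<Sum>\<nu>\<in>seqs \<beta>. e_gen \<nu> :: ('i klr_gen, 'k) free_alg"
  have E: "?E \<approx> 1" by (rule relator_cong) (rule klr_relators.idem_sum)
  have "a * 1 \<approx> a * ?E" by (rule cong_mult_left) (rule cong_sym[OF E])
  also have "a * ?E = (\<Sum>\<nu>\<in>seqs \<beta>. a * e_gen \<nu>)" by (simp only: sum_distrib_left)
  also have "\<dots> \<approx> (\<Sum>\<nu>\<in>seqs \<beta>. b * e_gen \<nu>)" by (rule cong_sum) (rule assms)
  also have "(\<Sum>\<nu>\<in>seqs \<beta>. b * e_gen \<nu>) = b * ?E" by (simp only: sum_distrib_left)
  also have "\<dots> \<approx> b * 1" by (rule cong_mult_left) (rule E)
  finally show ?thesis by simp
qed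

text \<open>The generators that every polynomial in x_1, ..., x_{k-1} commutes with. A tau of
  smaller index would move these variables.\<close>

definition cen_gens :: "nat \<Rightarrow> ('i klr_gen, 'k) free_alg set"
  where "cen_gens k = e_gen ` seqs \<beta> \<union> x_gen ` {1..height \<beta>} \<union> tau_gen ` {k..<height \<beta>}"

definition cen :: "nat \<Rightarrow> ('i klr_gen, 'k) free_alg \<Rightarrow> bool"
  where "cen k c \<longleftrightarrow> (\<forall>g\<in>cen_gens k. comm c g)"

lemma cen_mono: "cen k c \<Longrightarrow> k \<le> l \<Longrightarrow> cen l c"
  by (auto simp: cen_def cen_gens_def)

lemma cen_mult: "cen k a \<Longrightarrow> cen k b \<Longrightarrow> cen k (a * b)"
  by (simp add: cen_def comm_mult)

lemma cen_power: "cen k a \<Longrightarrow> cen k (a ^ n)"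
  by (simp add: cen_def comm_power)

lemma cen_sum: "(\<And>s. s \<in> S \<Longrightarrow> cen k (f s)) \<Longrightarrow> cen k (sum f S)"
  by (simp add: cen_def comm_sum)

lemma cen_scalar: "cen k (scalar c)"
  by (simp add: cen_def comm_def scalar_central[of c])

lemma cen_0: "cen k 0"
  by (simp add: cen_def comm_0)

lemma cen_comm:
  assumes "cen k c"
  shows "\<nu> \<in> seqs \<beta> \<Longrightarrow> comm c (e_gen \<nu>)" "1 \<le> l \<Longrightarrow> l \<le> height \<beta> \<Longrightarrow> comm c (x_gen l)"
    "k \<le> l \<Longrightarrow> l < height \<beta> \<Longrightarrow> comm c (tau_gen l)"
  using assms by (auto simp: cen_def cen_gens_def)

lemma comm_x_e: "1 \<le> l \<Longrightarrow> l \<le> height \<beta> \<Longrightarrow> \<nu> \<in> seqs \<beta> \<Longrightarrow> comm (x_gen l) (e_gen \<nu>)"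
  unfolding comm_def by (intro relator_cong klr_relators.x_idem) auto

lemma comm_x_x: "1 \<le> l \<Longrightarrow> l \<le> height \<beta> \<Longrightarrow> 1 \<le> k \<Longrightarrow> k \<le> height \<beta> \<Longrightarrow> comm (x_gen l) (x_gen k)"
  unfolding comm_def by (intro relator_cong klr_relators.x_comm) auto

lemma tau_x_cong:
  assumes "\<nu> \<in> seqs \<beta>" "1 \<le> k" "k < height \<beta>" "1 \<le> l" "l \<le> height \<beta>"
  shows "tau_gen k * x_gen l * e_gen \<nu> \<approx>
    x_gen (Transposition.transpose k (k + 1) l) * tau_gen k * e_gen \<nu> +
    (if l = k + 1 \<and> entry \<nu> k = entry \<nu> (k + 1) then e_gen \<nu>
     else if l = k \<and> entry \<nu> k = entry \<nu> (k + 1) then - e_gen \<nu> else 0)"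
proof -
  let ?r = "if l = k + 1 \<and> entry \<nu> k = entry \<nu> (k + 1) then e_gen \<nu>
     else if l = k \<and> entry \<nu> k = entry \<nu> (k + 1) then - e_gen \<nu> else 0 :: ('i klr_gen, 'k) free_alg"
  let ?x = "x_gen (Transposition.transpose k (k + 1) l)"
  have "(tau_gen k * x_gen l - ?x * tau_gen k) * e_gen \<nu> - ?r \<in> klr_relators Q \<beta>"
    using assms by (intro klr_relators.tau_x) auto
  moreover have "(tau_gen k * x_gen l - ?x * tau_gen k) * e_gen \<nu> - ?r =
      tau_gen k * x_gen l * e_gen \<nu> - (?x * tau_gen k * e_gen \<nu> + ?r)"
    by (simp only: left_diff_distrib diff_diff_eq)
  ultimately show ?thesis
    by (intro relator_cong) (simp only:)
qed

lemma cen_x: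
  assumes "1 \<le> l" "l < k" "l \<le> height \<beta>"
  shows "cen k (x_gen l)"
proof -
  have "comm (x_gen l) (tau_gen m)" if m: "k \<le> m" "m < height \<beta>" for m
  proof -
    have "tau_gen m * x_gen l \<approx> x_gen l * tau_gen m"
    proof (rule cong_on_idemI)
      fix \<nu> assume \<nu>: "\<nu> \<in> seqs \<beta>"
      have "Transposition.transpose m (m + 1) l = l"
        using m assms by (simp add: Transposition.transpose_def)
      then show "tau_gen m * x_gen l * e_gen \<nu> \<approx> x_gen l * tau_gen m * e_gen \<nu>"
        using tau_x_cong[OF \<nu>, of m l] m assms by simp
    qed
    then show ?thesis by (simp add: comm_def cong_sym)
  qed
  then show ?thesis
    using assms comm_x_e comm_x_x by (auto simp: cen_def cen_gens_def)
qed

text \<open>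
  A monic relation of degree \<open>n\<close> for $x_k 1_\nu$, whose coefficients are polynomials in
  $x_1, \dots, x_{k-1}$; only their commutation with the generators to the right is recorded.
\<close>

definition monic_rel :: "nat \<Rightarrow> nat \<Rightarrow> 'i list \<Rightarrow> bool"
  where "monic_rel k n \<nu> \<longleftrightarrow> (\<exists>c u. (\<forall>l. cen k (c l)) \<and> c n = scalar u \<and> u dvd 1 \<and>
    (\<Sum>l\<le>n. c l * x_gen k ^ l) * e_gen \<nu> \<approx> 0)"

lemma monic_rel_0:
  assumes "monic_rel k 0 \<nu>"
  shows "e_gen \<nu> \<approx> 0"
proof -
  obtain u where u: "u dvd 1" "scalar u * e_gen \<nu> \<approx> 0"
    using assms by (auto simp: monic_rel_def)
  obtain w where w: "1 = u * w" using u(1) by (elim dvdE)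
  have "scalar w * (scalar u * e_gen \<nu>) \<approx> scalar w * 0"
    using u(2) by (rule cong_mult_left)
  moreover have "scalar w * (scalar u * e_gen \<nu>) = e_gen \<nu>"
    using w by (simp add: mult.assoc[symmetric] mult_single mult.commute[of w])
  ultimately show ?thesis by simp
qed

lemma monic_rel_trivial:
  assumes "e_gen \<nu> \<approx> 0"
  shows "monic_rel k n \<nu>"
  unfolding monic_rel_def
  using cong_mult_left[OF assms, of "\<Sum>l\<le>n. scalar 1 * x_gen k ^ l"]
  by (intro exI[of _ "\<lambda>_. scalar 1"] exI[of _ 1]) (simp add: cen_scalar del: single_one)

text \<open>Two equal letters make the square of tau vanish, so the nil-Hecke argument applies: the
  divided difference of a relation for x_k is a relation for x_{k+1}, of degree one less.\<close>

lemma monic_rel_same: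
  assumes \<nu>: "\<nu> \<in> seqs \<beta>" and k: "1 \<le> k" "k < height \<beta>" and eq: "entry \<nu> k = entry \<nu> (Suc k)"
    and rel: "monic_rel k (Suc n) \<nu>"
  shows "monic_rel (Suc k) n \<nu>"
proof -
  obtain c u where c: "\<And>l. cen k (c l)" and top: "c (Suc n) = scalar u" "u dvd 1"
    and zero: "(\<Sum>l\<le>Suc n. c l * x_gen k ^ l) * e_gen \<nu> \<approx> 0"
    using rel unfolding monic_rel_def by blast
  let ?x = "x_gen k" and ?y = "x_gen (Suc k)" and ?\<tau> = "tau_gen k" and ?e = "e_gen \<nu>"
  have swap: "swap_entries k \<nu> = \<nu>"
    using k eq \<nu> by (intro list_eq_entryI)
      (auto simp: length_swap_entries entry_swap_entries Transposition.transpose_def seqs_def)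
  have "?\<tau> * ?e \<approx> e_gen (swap_entries k \<nu>) * ?\<tau>"
    using \<nu> k by (intro relator_cong klr_relators.tau_idem) auto
  then have te: "comm ?\<tau> ?e" by (simp add: comm_def swap)
  have cross: "?\<tau> * ?y * ?e \<approx> (?x * ?\<tau> + 1) * ?e"
    using tau_x_cong[OF \<nu> k, of "Suc k"] k eq by (simp add: distrib_right)
  have "?\<tau> ^ 2 * ?e - bipoly_eval scalar (Q (entry \<nu> k) (entry \<nu> (k + 1))) (x_gen k) (x_gen (k + 1)) * ?e
      \<in> klr_relators Q \<beta>"
    using \<nu> k by (intro klr_relators.tau_square) auto
  then have square: "?\<tau> * ?\<tau> * ?e \<approx> 0"
    using relators_mem eq by (auto simp: Q_diag bipoly_eval_def cong_ideal_def power2_eq_square)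
  \<comment> \<open>The coefficient of x_{k+1}^a in the expanded divided difference. It contains
    x_k, hence only \<open>cen (Suc k)\<close> can be claimed; for a = n the single summand c_{n+1}
    = u is left.\<close>
  define c' where "c' a = (\<Sum>l\<in>{l\<in>{..n}. a \<le> l}. c (Suc l) * ?x ^ (l - a))" for a
  have "(\<Sum>l\<le>Suc n. c l * complete_sym ?x ?y l) * ?e \<approx> 0"
    by (rule divided_difference_cong_0[OF _ _ te _ cross square _ zero])
      (use \<nu> k cen_comm[OF c] in \<open>auto intro: comm_x_e comm_x_x\<close>)
  also have "(\<Sum>l\<le>Suc n. c l * complete_sym ?x ?y l) =
      (\<Sum>l\<le>n. \<Sum>a\<in>{a\<in>{..n}. a \<le> l}. c (Suc l) * ?x ^ (l - a) * ?y ^ a)"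
  proof -
    have "{a\<in>{..n}. a \<le> l} = {..l}" if "l \<le> n" for l
      using that by auto
    then have "(\<Sum>l\<le>n. c (Suc l) * complete_sym ?x ?y (Suc l)) =
        (\<Sum>l\<le>n. \<Sum>a\<in>{a\<in>{..n}. a \<le> l}. c (Suc l) * ?x ^ (l - a) * ?y ^ a)"
      by (intro sum.cong) (simp_all only: complete_sym_Suc_eq sum_distrib_left mult.assoc atMost_iff)
    then show ?thesis
      by (subst sum.atMost_Suc_shift) simp
  qed
  also have "\<dots> = (\<Sum>a\<le>n. \<Sum>l\<in>{l\<in>{..n}. a \<le> l}. c (Suc l) * ?x ^ (l - a) * ?y ^ a)"
    by (rule sum.swap_restrict) simp_all
  also have "\<dots> = (\<Sum>a\<le>n. c' a * ?y ^ a)"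
    by (simp only: c'_def sum_distrib_right)
  finally have zero': "(\<Sum>a\<le>n. c' a * ?y ^ a) * ?e \<approx> 0" .
  have "{l\<in>{..n}. n \<le> l} = {n}" by auto
  then have "c' n = scalar u"
    using top by (simp add: c'_def)
  moreover have "cen (Suc k) (c' a)" for a
    unfolding c'_def using c k
    by (intro cen_sum cen_mult cen_power cen_x) (auto intro: cen_mono[of k])
  ultimately show ?thesis
    unfolding monic_rel_def using top(2) zero' by blast
qed

text \<open>The relation for x_k at the exchanged word, where i stands first, becomes after
  multiplication by Q_{j,i}(x_k, x_{k+1}) one for x_{k+1} at \<nu>. The degree in x_{k+1} grows by
  -c_{i,j}.\<close>

lemma monic_rel_swap:
  assumes \<nu>: "\<nu> \<in> seqs \<beta>" and k: "1 \<le> k" "k < height \<beta>"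
    and i: "entry \<nu> k \<noteq> i" "entry \<nu> (Suc k) = i"
    and rel: "monic_rel k n (swap_entries k \<nu>)"
  shows "monic_rel (Suc k) (n + nat (- cartan form i (entry \<nu> k))) \<nu>"
proof -
  let ?x = "x_gen k" and ?y = "x_gen (Suc k)" and ?\<tau> = "tau_gen k" and ?e = "e_gen \<nu>"
    and ?e' = "e_gen (swap_entries k \<nu>)"
  define j d where "j = entry \<nu> k" and "d = nat (- cartan form i j)"
  define K where "K = Poly_Mapping.keys (Q j i)"
  define q where "q z = Poly_Mapping.lookup (Q j i) z" for z
  have ij: "i \<noteq> j" using i by (simp add: j_def)
  obtain c u where c: "\<And>l. cen k (c l)" and top: "c n = scalar u" "u dvd 1"
    and zero: "(\<Sum>l\<le>n. c l * ?x ^ l) * ?e' \<approx> 0"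
    using rel by (auto simp: monic_rel_def)
  have len: "length \<nu> = height \<beta>" using \<nu> by (simp add: seqs_def)
  have \<mu>: "swap_entries k \<nu> \<in> seqs \<beta>" using \<nu> k by (intro swap_entries_in_seqs) auto
  have ent: "entry (swap_entries k \<nu>) k = i" "entry (swap_entries k \<nu>) (Suc k) = j"
    using k i len by (simp_all add: entry_swap_entries j_def)
  have te: "?\<tau> * ?e \<approx> ?e' * ?\<tau>"
    using \<nu> k by (intro relator_cong klr_relators.tau_idem) auto
  have "?\<tau> ^ 2 * ?e - bipoly_eval scalar (Q (entry \<nu> k) (entry \<nu> (k + 1))) (x_gen k) (x_gen (k + 1)) * ?e
      \<in> klr_relators Q \<beta>"
    using \<nu> k by (intro klr_relators.tau_square) auto
  then have square: "?\<tau> * ?\<tau> * ?e \<approx> bipoly_eval scalar (Q j i) ?x ?y * ?e"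
    using i by (intro relator_cong) (simp add: power2_eq_square j_def)
  have cross: "?\<tau> * ?x * ?e' \<approx> ?y * ?\<tau> * ?e'"
    using tau_x_cong[OF \<mu> k, of k] k ij ent by simp
  have "(\<Sum>l\<le>n. c l * ?y ^ l) * bipoly_eval scalar (Q j i) ?x ?y * ?e \<approx> 0"
    by (rule quadratic_cong_0[OF _ te square cross _ zero])
      (use \<mu> k c in \<open>auto intro: comm_x_e cen_comm\<close>)
  \<comment> \<open>The coefficient of x_{k+1}^m in the product of the relation with Q_{j,i}; the
    pair z holds the exponents of x_k and x_{k+1}.\<close>
  define c' where "c' m = (\<Sum>l\<le>n. \<Sum>z\<in>K. if l + snd z = m then c l * (scalar (q z) * ?x ^ fst z) else 0)" for m
  have key: "r < d \<or> r = d \<and> s = 0" if "(s, r) \<in> K" for s r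
    using that Q_monic(2)[OF ij, of r s] Q_sym[of j i s r] by (simp add: K_def d_def in_keys_iff)
  have cen_c': "cen (Suc k) (c' m)" for m
  proof -
    have "cen (Suc k) (c l * (scalar (q z) * ?x ^ fst z))" for l z
      using c k by (intro cen_mult cen_power cen_x cen_scalar) (auto intro: cen_mono[of k])
    then show ?thesis
      unfolding c'_def by (intro cen_sum) (simp add: cen_0)
  qed
  have "(\<Sum>m\<le>n + d. c' m * ?y ^ m) =
      (\<Sum>m\<le>n + d. \<Sum>l\<le>n. \<Sum>z\<in>K. if l + snd z = m then c l * (scalar (q z) * ?x ^ fst z) * ?y ^ m else 0)"
    unfolding c'_def sum_distrib_right by (intro sum.cong refl) auto
  also have "\<dots> =
      (\<Sum>l\<le>n. \<Sum>z\<in>K. \<Sum>m\<le>n + d. if l + snd z = m then c l * (scalar (q z) * ?x ^ fst z) * ?y ^ m else 0)"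
    by (subst sum.swap, rule sum.cong[OF refl], rule sum.swap)
  also have "\<dots> = (\<Sum>l\<le>n. \<Sum>z\<in>K. c l * (scalar (q z) * ?x ^ fst z) * ?y ^ (l + snd z))"
  proof (intro sum.cong refl)
    fix l z assume "l \<in> {..n}" "z \<in> K"
    then have "l + snd z \<le> n + d" using key[of "fst z" "snd z"] by auto
    then show "(\<Sum>m\<le>n + d. if l + snd z = m then c l * (scalar (q z) * ?x ^ fst z) * ?y ^ m else 0) =
        c l * (scalar (q z) * ?x ^ fst z) * ?y ^ (l + snd z)"
      by (subst sum.delta') auto
  qed
  \<comment> \<open>From here on equality holds only modulo J: the power of x_{k+1} is moved past
    the power of x_k.\<close>
  also have "\<dots> \<approx> (\<Sum>l\<le>n. \<Sum>z\<in>K. c l * ?y ^ l * (scalar (q z) * ?x ^ fst z * ?y ^ snd z))"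
  proof (intro cong_sum)
    fix l z
    have "cen (Suc k) (scalar (q z) * ?x ^ fst z)"
      using k by (intro cen_mult cen_power cen_x cen_scalar) auto
    then have "comm (?y ^ l) (scalar (q z) * ?x ^ fst z)"
      using k by (intro comm_power comm_sym[OF cen_comm(2)]) auto
    then have "c l * ((scalar (q z) * ?x ^ fst z) * ?y ^ l * ?y ^ snd z) \<approx>
        c l * (?y ^ l * (scalar (q z) * ?x ^ fst z) * ?y ^ snd z)"
      by (intro cong_mult_left cong_mult_right) (simp add: comm_def cong_sym)
    then show "c l * (scalar (q z) * ?x ^ fst z) * ?y ^ (l + snd z) \<approx>
        c l * ?y ^ l * (scalar (q z) * ?x ^ fst z * ?y ^ snd z)"
      by (simp only: power_add mult.assoc)
  qed
  also have "(\<Sum>l\<le>n. \<Sum>z\<in>K. c l * ?y ^ l * (scalar (q z) * ?x ^ fst z * ?y ^ snd z)) =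
      (\<Sum>l\<le>n. c l * ?y ^ l) * bipoly_eval scalar (Q j i) ?x ?y"
    unfolding bipoly_eval_def K_def q_def
    by (simp only: sum_product case_prod_unfold prod.collapse)
  finally have "(\<Sum>m\<le>n + d. c' m * ?y ^ m) * ?e \<approx>
      (\<Sum>l\<le>n. c l * ?y ^ l) * bipoly_eval scalar (Q j i) ?x ?y * ?e"
    by (rule cong_mult_right)
  also note \<open>\<dots> \<approx> 0\<close>
  finally have zero': "(\<Sum>m\<le>n + d. c' m * ?y ^ m) * ?e \<approx> 0" .
  have unit: "q (0, d) dvd 1"
    using Q_monic(1)[OF ij] Q_sym[of j i 0 d] by (simp add: q_def d_def)
  \<comment> \<open>The power of x_{k+1} in Q_{j,i} is at most d, and d is reached only by z = (0,
    d); so n + d arises from l = n and this z alone, and the top coefficient is a product of two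
    units.\<close>
  have "c' (n + d) = (\<Sum>l\<le>n. \<Sum>z\<in>K. if l = n then if z = (0, d) then scalar (u * q (0, d)) else 0 else 0)"
    unfolding c'_def
  proof (intro sum.cong refl)
    fix l z assume "l \<in> {..n}" "z \<in> K"
    moreover obtain s r where "z = (s, r)" by (cases z)
    ultimately show "(if l + snd z = n + d then c l * (scalar (q z) * ?x ^ fst z) else 0) =
        (if l = n then if z = (0, d) then scalar (u * q (0, d)) else 0 else 0)"
      using key[of s r] top(1) by (auto simp: mult_single)
  qed
  also have "\<dots> = (\<Sum>z\<in>K. if z = (0, d) then scalar (u * q (0, d)) else 0)"
    by (subst sum.swap) simp
  also have "\<dots> = scalar (u * q (0, d))"
    by (simp add: K_def q_def in_keys_iff)
  finally have "c' (n + d) = scalar (u * q (0, d))" .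
  moreover have "u * q (0, d) dvd 1"
    using mult_dvd_mono[OF top(2) unit] by simp
  ultimately show ?thesis
    unfolding monic_rel_def j_def[symmetric] d_def[symmetric] using cen_c' zero' by blast
qed

lemma strand_degree_cong:
  "(\<And>p. p < l \<Longrightarrow> \<nu> ! p = \<nu>' ! p) \<Longrightarrow> strand_degree i \<nu> l = strand_degree i \<nu>' l"
  by (auto simp: strand_degree_def intro!: sum.cong)

text \<open>Both claims are proved together, for all words at once: passing a letter other than i
  uses the relation at the exchanged word. At p = 0 the relation is the vanishing of the idempotents
  with first letter i.\<close>

lemma strand_degree_vanishing:
  assumes "\<nu> \<in> seqs \<beta>" "p \<le> height \<beta>"
  shows "(strand_degree i \<nu> p < 0 \<longrightarrow> e_gen \<nu> \<approx> 0) \<and>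
    (strand_degree i \<nu> p \<ge> 0 \<longrightarrow> p < height \<beta> \<longrightarrow> \<nu> ! p = i \<longrightarrow>
      monic_rel (Suc p) (nat (strand_degree i \<nu> p)) \<nu>)"
  using assms
proof (induction p arbitrary: \<nu>)
  case 0
  have "e_gen \<nu> \<approx> 0" if "0 < height \<beta>" "\<nu> ! 0 = i"
    using 0 that by (intro idem_cong_0) (auto simp: seqs_def entry_def)
  then show ?case
    by (auto simp: strand_degree_def intro: monic_rel_trivial)
next
  case (Suc p)
  then have IH: "strand_degree i \<mu> p < 0 \<Longrightarrow> e_gen \<mu> \<approx> 0"
    "strand_degree i \<mu> p \<ge> 0 \<Longrightarrow> \<mu> ! p = i \<Longrightarrow> monic_rel (Suc p) (nat (strand_degree i \<mu> p)) \<mu>"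
    if "\<mu> \<in> seqs \<beta>" for \<mu>
    using that by auto
  note \<nu> = \<open>\<nu> \<in> seqs \<beta>\<close>
  have ent: "entry \<nu> (Suc p) = \<nu> ! p" "entry \<nu> (Suc (Suc p)) = \<nu> ! Suc p"
    by (simp_all add: entry_def)
  \<comment> \<open>A letter i met at degree 0 falls under the first alternative, because its
    relation of degree 0 says that a unit times the idempotent vanishes.\<close>
  consider "e_gen \<nu> \<approx> 0" | "strand_degree i \<nu> p > 0" "\<nu> ! p = i"
    | "strand_degree i \<nu> p \<ge> 0" "\<nu> ! p \<noteq> i"
    using IH[OF \<nu>] monic_rel_0[of "Suc p" \<nu>]
    by (metis linorder_less_linear nat_0 order_le_less not_less)
  then show ?case
  proof cases
    case 1
    then show ?thesis by (auto intro: monic_rel_trivial)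
  next
    case 2
    have "monic_rel (Suc (Suc p)) (nat (strand_degree i \<nu> p - 1)) \<nu>" if "Suc p < height \<beta>" "\<nu> ! Suc p = i"
    proof (rule monic_rel_same[OF \<nu>])
      have "nat (strand_degree i \<nu> p) = Suc (nat (strand_degree i \<nu> p - 1))" using 2 by simp
      then show "monic_rel (Suc p) (Suc (nat (strand_degree i \<nu> p - 1))) \<nu>"
        using IH(2)[OF \<nu>] 2 by simp
    qed (use that 2 in \<open>simp_all add: ent\<close>)
    then show ?thesis
      using 2 by (auto simp: strand_degree_Suc)
  next
    case 3
    have c: "cartan form i (\<nu> ! p) \<le> 0" using 3 cartan_nonpos[of i "\<nu> ! p"] by auto
    have "monic_rel (Suc (Suc p)) (nat (strand_degree i \<nu> p) + nat (- cartan form i (\<nu> ! p))) \<nu>"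
      if p: "Suc p < height \<beta>" "\<nu> ! Suc p = i"
    proof -
      let ?\<mu> = "swap_entries (Suc p) \<nu>"
      have \<mu>: "?\<mu> \<in> seqs \<beta>" using \<nu> p by (intro swap_entries_in_seqs) auto
      have len: "length \<nu> = height \<beta>" using \<nu> by (simp add: seqs_def)
      have "?\<mu> ! p = i" using p len by (simp add: swap_entries_def entry_def nth_list_update)
      \<comment> \<open>The exchange touches positions p and p + 1 only, so the first p letters and
        their degree are unchanged.\<close>
      moreover have "strand_degree i ?\<mu> p = strand_degree i \<nu> p"
        by (rule strand_degree_cong) (simp add: swap_entries_def entry_def)
      ultimately have "monic_rel (Suc p) (nat (strand_degree i \<nu> p)) ?\<mu>"
        using IH(2)[OF \<mu>] 3 by simp
      then show ?thesis
        using monic_rel_swap[OF \<nu>, of "Suc p"] p 3 by (simp add: ent)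
    qed
    then show ?thesis
      using 3 c by (auto simp: strand_degree_Suc nat_add_distrib[symmetric])
  qed
qed

lemma one_mem:
  assumes "\<And>\<nu>. \<nu> \<in> seqs \<beta> \<Longrightarrow> strand_degree i \<nu> (height \<beta>) < 0"
  shows "1 \<in> J"
proof -
  have "e_gen \<nu> \<approx> 0" if "\<nu> \<in> seqs \<beta>" for \<nu>
    using strand_degree_vanishing[OF that, of "height \<beta>"] assms[OF that] by simp
  then have "1 * e_gen \<nu> \<approx> 0 * e_gen \<nu>" if "\<nu> \<in> seqs \<beta>" for \<nu>
    using that by simp
  then have "1 \<approx> 0"
    by (rule cong_on_idemI)
  then show ?thesis by (simp add: cong_ideal_def)
qed

end

section \<open>Vanishing of iterated quotients\<close>

lemma (in ring) quot_trivial_iff: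
  assumes "ideal I R"
  shows "carrier (R Quot I) = {\<zero>\<^bsub>R Quot I\<^esub>} \<longleftrightarrow> \<one> \<in> I"
proof -
  interpret ideal I R by (rule assms)
  have zero: "\<zero>\<^bsub>R Quot I\<^esub> = I" and carr: "carrier (R Quot I) = (+>) I ` carrier R"
    by (auto simp: FactRing_def A_RCOSETS_def')
  show ?thesis
  proof
    assume "carrier (R Quot I) = {\<zero>\<^bsub>R Quot I\<^esub>}"
    then have "I +> \<one> = I" unfolding zero carr by auto
    then show "\<one> \<in> I" using a_rcos_self[OF one_closed] by simp
  next
    assume "\<one> \<in> I"
    then have "carrier R = I" by (simp add: one_imp_carrier)
    then have "I +> r = I" if "r \<in> carrier R" for r
      using that a_rcos_const by simp
    then show "carrier (R Quot I) = {\<zero>\<^bsub>R Quot I\<^esub>}"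
      unfolding zero carr by auto
  qed
qed

text \<open>Ideals correspond under the quotient map. The two nested quotients disappear and only
  ideals of the ring itself remain.\<close>

lemma (in ring) quot_quot_trivial_iff:
  fixes S s
  assumes S: "S \<subseteq> carrier R" and s: "s \<in> carrier R"
  defines "I \<equiv> Idl S"
  defines "A \<equiv> R Quot I"
  shows "carrier (A Quot Idl\<^bsub>A\<^esub> {I +> s}) = {\<zero>\<^bsub>A Quot Idl\<^bsub>A\<^esub> {I +> s}\<^esub>} \<longleftrightarrow>
    (\<forall>J. ideal J R \<longrightarrow> S \<subseteq> J \<longrightarrow> s \<in> J \<longrightarrow> \<one> \<in> J)"
proof -
  have idealI: "ideal I R" unfolding I_def using S by (rule genideal_ideal)
  interpret I: ideal I R by (rule idealI)
  have ringA: "ring A" unfolding A_def by (rule I.quotient_is_ring)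
  interpret A: ring A by (rule ringA)
  interpret h: ring_hom_ring R A "(+>) I" unfolding A_def by (rule I.rcos_ring_hom_ring)
  have s_A: "{I +> s} \<subseteq> carrier A" using s h.hom_closed by simp
  let ?K = "Idl\<^bsub>A\<^esub> {I +> s}"
  have idealK: "ideal ?K A" using s_A by (rule A.genideal_ideal)
  have sK: "I +> s \<in> ?K" using A.genideal_self[OF s_A] by simp
  have "carrier (A Quot ?K) = {\<zero>\<^bsub>A Quot ?K\<^esub>} \<longleftrightarrow> I +> \<one> \<in> ?K"
    using A.quot_trivial_iff[OF idealK] by simp
  also have "\<dots> \<longleftrightarrow> (\<forall>J. ideal J R \<longrightarrow> S \<subseteq> J \<longrightarrow> s \<in> J \<longrightarrow> \<one> \<in> J)"
  proof
    assume one: "I +> \<one> \<in> ?K"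
    show "\<forall>J. ideal J R \<longrightarrow> S \<subseteq> J \<longrightarrow> s \<in> J \<longrightarrow> \<one> \<in> J"
    proof (intro allI impI)
      fix J assume J: "ideal J R" "S \<subseteq> J" "s \<in> J"
      interpret J: ideal J R by (rule J(1))
      have IJ: "I \<subseteq> J" unfolding I_def using J by (intro genideal_minimal)
      have "ideal ((+>) I ` J) A"
        unfolding A_def using idealI J(1) by (rule ring_ideal_imp_quot_ideal)
      then have "?K \<subseteq> (+>) I ` J"
        using J(3) by (intro A.genideal_minimal) auto
      then obtain p where p: "p \<in> J" "I +> \<one> = I +> p" using one by auto
      \<comment> \<open>1 and p differ by an element of I, which is contained in J.\<close>
      then have "\<one> \<in> I +> p" using I.a_rcos_self[OF one_closed] by simp
      then have "\<one> \<ominus> p \<in> J"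
        using IJ p(1) I.a_rcos_module_minus[OF ring_axioms, of p \<one>] by auto
      then have "\<one> \<ominus> p \<oplus> p \<in> J" using p(1) by simp
      then show "\<one> \<in> J" using p(1) by (simp add: minus_eq a_assoc l_neg)
    qed
  next
    assume *: "\<forall>J. ideal J R \<longrightarrow> S \<subseteq> J \<longrightarrow> s \<in> J \<longrightarrow> \<one> \<in> J"
    \<comment> \<open>The preimage of the second ideal is the smallest candidate for J, so the
      assumption is applied to it.\<close>
    let ?J = "{r \<in> carrier R. I +> r \<in> ?K}"
    have "S \<subseteq> ?J"
    proof
      fix r assume "r \<in> S"
      then have "r \<in> I" unfolding I_def using genideal_self[OF S] by auto
      then have "I +> r = I" by (rule I.a_rcos_const)
      then have "I +> r = \<zero>\<^bsub>A\<^esub>" by (simp only: A_def FactRing_def ring_record_simps)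
      moreover have "\<zero>\<^bsub>A\<^esub> \<in> ?K"
        by (rule additive_subgroup.zero_closed[OF ideal.axioms(1)[OF idealK]])
      ultimately show "r \<in> ?J" using \<open>r \<in> S\<close> S by auto
    qed
    moreover have "ideal ?J R" using idealK by (rule h.ideal_vimage)
    ultimately have "\<one> \<in> ?J" using * s sK by blast
    then show "I +> \<one> \<in> ?K" by simp
  qed
  finally show ?thesis .
qed

text \<open>
  Restricting to words in \<open>G\<close> pulls an ideal of the carrier back to an ideal of the whole type,
  where no carrier conditions have to be tracked.
\<close>

definition restrict_gens :: "'g set \<Rightarrow> ('g, 'k::comm_ring_1) free_alg \<Rightarrow> ('g, 'k) free_alg"
  where "restrict_gens G p = (\<Sum>w\<in>Poly_Mapping.keys p.
    if set (letters w) \<subseteq> G then Poly_Mapping.single w (Poly_Mapping.lookup p w) else 0)"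

lemma restrict_gens_single:
  "restrict_gens G (Poly_Mapping.single w c) = (if set (letters w) \<subseteq> G then Poly_Mapping.single w c else 0)"
  by (cases "c = 0") (simp_all add: restrict_gens_def)

lemma restrict_gens_0: "restrict_gens G 0 = 0"
  by (simp add: restrict_gens_def)

lemma restrict_gens_add: "restrict_gens G (p + q) = restrict_gens G p + restrict_gens G q"
  unfolding restrict_gens_def
  by (rule setsum_keys_plus_distrib) (simp_all add: single_add)

lemma restrict_gens_mult: "restrict_gens G (p * q) = restrict_gens G p * restrict_gens G q"
proof (induction p rule: poly_mapping_single_induct)
  case (single w c)
  show ?case
  proof (induction q rule: poly_mapping_single_induct)
    case (single w' c')
    show ?case
      by (simp add: mult_single restrict_gens_single plus_free_monoid_def)
  qed (simp_all add: restrict_gens_0 distrib_left restrict_gens_add)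
qed (simp_all add: restrict_gens_0 distrib_right restrict_gens_add)

lemma restrict_gens_closed: "restrict_gens G p \<in> carrier (free_algebra G)"
  unfolding restrict_gens_def
  by (intro free_algebra_sum) (auto simp: free_algebra_def)

lemma restrict_gens_id:
  assumes "p \<in> carrier (free_algebra G)"
  shows "restrict_gens G p = p"
proof (rule poly_mapping_eqI)
  fix w
  have "restrict_gens G p = (\<Sum>w\<in>Poly_Mapping.keys p. Poly_Mapping.single w (Poly_Mapping.lookup p w))"
    unfolding restrict_gens_def using assms by (intro sum.cong) (auto simp: free_algebra_def)
  then show "Poly_Mapping.lookup (restrict_gens G p) w = Poly_Mapping.lookup p w"
    by (simp add: lookup_sum lookup_single when_def in_keys_iff)
qed

lemma two_sided_ideal_vimage:
  fixes J :: "('g, 'k::comm_ring_1) free_alg set"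
  assumes "ideal J (free_algebra G)"
  shows "two_sided_ideal {p. restrict_gens G p \<in> J}"
proof
  interpret ideal J "free_algebra G" by (rule assms)
  show "0 \<in> {p. restrict_gens G p \<in> J}"
    using additive_subgroup.zero_closed[OF ideal.axioms(1)[OF assms]]
    by (simp add: restrict_gens_0 free_algebra_def)
  fix a b :: "('g, 'k) free_alg"
  show "a \<in> {p. restrict_gens G p \<in> J} \<Longrightarrow> b \<in> {p. restrict_gens G p \<in> J} \<Longrightarrow>
      a + b \<in> {p. restrict_gens G p \<in> J}"
    using additive_subgroup.a_closed[OF ideal.axioms(1)[OF assms], of "restrict_gens G a" "restrict_gens G b"]
    by (simp add: restrict_gens_add free_algebra_def)
  show "a \<in> {p. restrict_gens G p \<in> J} \<Longrightarrow> b * a \<in> {p. restrict_gens G p \<in> J}"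
    using I_l_closed[of "restrict_gens G a" "restrict_gens G b"] restrict_gens_closed[of G b]
    by (simp add: restrict_gens_mult free_algebra_def)
  show "a \<in> {p. restrict_gens G p \<in> J} \<Longrightarrow> a * b \<in> {p. restrict_gens G p \<in> J}"
    using I_r_closed[of "restrict_gens G a" "restrict_gens G b"] restrict_gens_closed[of G b]
    by (simp add: restrict_gens_mult free_algebra_def)
qed

section \<open>Words of a given weight\<close>

definition extend_linear :: "('i \<Rightarrow> int) \<Rightarrow> 'i root_lattice \<Rightarrow> int"
  where "extend_linear f \<beta> = (\<Sum>j\<in>Poly_Mapping.keys \<beta>. Poly_Mapping.lookup \<beta> j * f j)"

lemma extend_linear_add: "extend_linear f (\<alpha> + \<beta>) = extend_linear f \<alpha> + extend_linear f \<beta>"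
  unfolding extend_linear_def
  by (rule setsum_keys_plus_distrib) (simp_all add: distrib_right)

lemma extend_linear_weight: "extend_linear f (\<Sum>j\<leftarrow>\<nu>. simple_root j) = (\<Sum>j\<leftarrow>\<nu>. f j)"
  by (induction \<nu>) (simp_all add: extend_linear_add, simp_all add: extend_linear_def)

text \<open>The height is the linear extension of the constant 1, so the weight of a word determines
  its length.\<close>

lemma seqs_iff: "\<nu> \<in> seqs \<beta> \<longleftrightarrow> (\<Sum>j\<leftarrow>\<nu>. simple_root j) = \<beta>"
proof -
  have "length \<nu> = height (\<Sum>j\<leftarrow>\<nu>. simple_root j)"
    using extend_linear_weight[of "\<lambda>_. 1" \<nu>]
    by (simp add: height_def extend_linear_def sum_list_triv)
  then show ?thesis by (auto simp: seqs_def)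
qed

lemma ex_weight:
  assumes "finite A" "\<beta> \<in> Q_plus"
  shows "\<exists>\<gamma>. set \<gamma> \<subseteq> A \<and> (\<Sum>j\<leftarrow>\<gamma>. simple_root j) = (\<Sum>j\<in>A. Poly_Mapping.single j (Poly_Mapping.lookup \<beta> j))"
  using assms(1)
proof (induction A)
  case (insert a A)
  then obtain \<gamma> where "set \<gamma> \<subseteq> A"
    "(\<Sum>j\<leftarrow>\<gamma>. simple_root j) = (\<Sum>j\<in>A. Poly_Mapping.single j (Poly_Mapping.lookup \<beta> j))"
    by blast
  moreover have "(\<Sum>j\<leftarrow>replicate n a. simple_root j) = Poly_Mapping.single a (int n)" for n
    by (induction n) (simp_all add: single_add[symmetric] add.commute)
  moreover have "0 \<le> Poly_Mapping.lookup \<beta> a"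
    using assms(2) by (simp add: Q_plus_def)
  ultimately show ?case
    using insert.hyps
    by (intro exI[of _ "replicate (nat (Poly_Mapping.lookup \<beta> a)) a @ \<gamma>"]) auto
qed simp

context klr_datum
begin

text \<open>The degree is a sum over letters and so depends only on the weight.\<close>

lemma strand_degree_total:
  assumes "\<nu> \<in> seqs \<beta>"
  shows "strand_degree i \<nu> (length \<nu>) = Poly_Mapping.lookup (simple_reflection form i \<beta>) i"
proof -
  define f where "f j = (if j = i then - 1 else - cartan form i j)" for j
  have "strand_degree i \<nu> (length \<nu>) = (\<Sum>j\<leftarrow>\<nu>. f j)"
    by (simp add: strand_degree_def f_def sum_list_sum_nth atLeast0LessThan)
  also have "\<dots> = extend_linear f \<beta>"
    using assms extend_linear_weight[of f \<nu>] by (simp add: seqs_iff)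
  also have "\<dots> = (\<Sum>j\<in>Poly_Mapping.keys \<beta>. (if j = i then Poly_Mapping.lookup \<beta> i else 0)
      - Poly_Mapping.lookup \<beta> j * cartan form i j)"
    \<comment> \<open>As c_{i,i} = 2, the value -1 at the letter i is 1 - c_{i,i}; in both cases f
      is the Kronecker delta minus c_{i,j}.\<close>
    unfolding extend_linear_def by (intro sum.cong) (auto simp: f_def cartan_diag)
  also have "\<dots> = Poly_Mapping.lookup \<beta> i - coroot form i \<beta>"
    by (simp add: sum_subtractf coroot_def in_keys_iff)
  finally show ?thesis
    by (simp add: simple_reflection_def lookup_minus)
qed

text \<open>The reflection changes no coefficient except that of i.\<close>

lemma simple_reflection_in_Q_plus_iff:
  assumes "\<beta> \<in> Q_plus"
  shows "simple_reflection form i \<beta> \<in> Q_plus \<longleftrightarrow> 0 \<le> Poly_Mapping.lookup (simple_reflection form i \<beta>) i"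
  using assms by (auto simp: Q_plus_def simple_reflection_def lookup_minus lookup_single when_def)

lemma ex_seq_positive_degree:
  assumes "\<beta> \<in> Q_plus" "0 \<le> Poly_Mapping.lookup (simple_reflection form i \<beta>) i"
  shows "\<exists>\<nu>\<in>seqs \<beta>. \<forall>l < length \<nu>. \<nu> ! l = i \<longrightarrow> strand_degree i \<nu> l > 0"
proof -
  let ?A = "Poly_Mapping.keys \<beta> - {i}" and ?m = "nat (Poly_Mapping.lookup \<beta> i)"
  obtain \<gamma> where \<gamma>: "set \<gamma> \<subseteq> ?A"
    "(\<Sum>j\<leftarrow>\<gamma>. simple_root j) = (\<Sum>j\<in>?A. Poly_Mapping.single j (Poly_Mapping.lookup \<beta> j))"
    using ex_weight[of ?A \<beta>] assms(1) by auto
  obtain \<iota> where \<iota>: "set \<iota> \<subseteq> {i}" "(\<Sum>j\<leftarrow>\<iota>. simple_root j) = Poly_Mapping.single i (Poly_Mapping.lookup \<beta> i)"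
    using ex_weight[of "{i}" \<beta>] assms(1) by auto
  let ?\<nu> = "\<gamma> @ \<iota>"
  have "(\<Sum>j\<leftarrow>?\<nu>. simple_root j) = \<beta>"
    by (rule poly_mapping_eqI)
      (simp add: \<gamma>(2) \<iota>(2) lookup_add lookup_sum lookup_single when_def in_keys_iff)
  then have seq: "?\<nu> \<in> seqs \<beta>" by (simp add: seqs_iff)
  have "strand_degree i ?\<nu> l > 0" if l: "l < length ?\<nu>" "?\<nu> ! l = i" for l
  proof -
    have ge: "length \<gamma> \<le> l"
    proof (rule ccontr)
      assume "\<not> length \<gamma> \<le> l"
      then have "?\<nu> ! l \<in> set \<gamma>" by (simp add: nth_append)
      then show False using l(2) \<gamma>(1) by auto
    qed
    \<comment> \<open>From the first i on every letter is i. Before a letter i the degree exceeds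
      the nonnegative total by the number of letters still to come, that one included.\<close>
    have "strand_degree i ?\<nu> n = strand_degree i ?\<nu> l - int (n - l)" if "l \<le> n" "n \<le> length ?\<nu>" for n
      using that
    proof (induction n rule: dec_induct)
      case (step n)
      then have "?\<nu> ! n \<in> set \<iota>"
        using ge by (simp add: nth_append)
      then have "?\<nu> ! n = i" using \<iota>(1) by auto
      then show ?case using step by (simp add: strand_degree_Suc)
    qed simp
    from this[of "length ?\<nu>"] show ?thesis
      using l(1) assms(2) strand_degree_total[OF seq, of i] by simp
  qed
  with seq show ?thesis by blast
qed

end

theorem proposition4p24:
  fixes form :: "'i lattice_form"
    and t :: "'i \<Rightarrow> 'i \<Rightarrow> 'k::comm_ring_1"
    and Q :: "'i \<Rightarrow> 'i \<Rightarrow> 'k bipoly"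
    and i :: 'i
    and \<beta> :: "'i root_lattice"
  assumes "klr_datum form t Q"
    and "\<beta> \<in> Q_plus"
  shows "carrier (klr_quotient Q \<beta> i) = {\<zero>\<^bsub>klr_quotient Q \<beta> i\<^esub>} \<longleftrightarrow>
    simple_reflection form i \<beta> \<notin> Q_plus"
proof -
  interpret klr_datum form t Q by (rule assms(1))
  let ?F = "free_algebra (klr_gens \<beta>) :: ('i klr_gen, 'k) free_alg ring"
  let ?s = "\<Sum>\<nu> | \<nu> \<in> seqs \<beta> \<and> \<nu> \<noteq> [] \<and> entry \<nu> 1 = i. e_gen \<nu> :: ('i klr_gen, 'k) free_alg"
  interpret F: ring ?F by (rule free_algebra_ring)
  have s: "?s \<in> carrier ?F"
    by (intro free_algebra_sum free_algebra_gen) (auto simp: klr_gens_def)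
  have one: "\<one>\<^bsub>?F\<^esub> = 1" by (simp add: free_algebra_def)
  have "carrier (klr_quotient Q \<beta> i) = {\<zero>\<^bsub>klr_quotient Q \<beta> i\<^esub>} \<longleftrightarrow>
      (\<forall>J. ideal J ?F \<longrightarrow> klr_relators Q \<beta> \<subseteq> J \<longrightarrow> ?s \<in> J \<longrightarrow> 1 \<in> J)"
    using F.quot_quot_trivial_iff[OF klr_relators_carrier s]
    unfolding one klr_quotient_def klr_algebra_def klr_idem_def klr_ideal_def .
  also have "\<dots> \<longleftrightarrow> simple_reflection form i \<beta> \<notin> Q_plus"
  proof (intro iffI allI impI notI)
    assume J: "\<forall>J. ideal J ?F \<longrightarrow> klr_relators Q \<beta> \<subseteq> J \<longrightarrow> ?s \<in> J \<longrightarrow> 1 \<in> J"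
      and "simple_reflection form i \<beta> \<in> Q_plus"
    then have "0 \<le> Poly_Mapping.lookup (simple_reflection form i \<beta>) i"
      using simple_reflection_in_Q_plus_iff[OF assms(2)] by simp
    then obtain \<nu> where \<nu>: "\<nu> \<in> seqs \<beta>" "\<And>l. l < length \<nu> \<Longrightarrow> \<nu> ! l = i \<Longrightarrow> strand_degree i \<nu> l > 0"
      using ex_seq_positive_degree[OF assms(2)] by blast
    \<comment> \<open>The index type is arbitrary, so a total order has to come from the
      well-ordering theorem; \<open>lt\<close> is its strict part with i moved to the
      bottom.\<close>
    obtain r :: "'i rel" where r: "Well_order r \<and> Field r = UNIV"
      using well_ordering ..
    define lt where "lt a b \<longleftrightarrow> a \<noteq> b \<and> (a = i \<or> b \<noteq> i \<and> (a, b) \<in> r)" for a b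
    interpret klr_rep form t Q i lt
    proof
      fix a b :: 'i
      have "(a, b) \<in> r \<longleftrightarrow> (b, a) \<notin> r" if "a \<noteq> b"
      proof -
        have "total_on (Field r) r" "antisym r" "Field r = UNIV"
          using r by (auto simp only: order_on_defs)
        then have "total_on UNIV r" "antisym r"
          by simp_all
        then show ?thesis
          using that unfolding total_on_def antisym_def by blast
      qed
      then show "lt a b \<longleftrightarrow> \<not> lt b a" if "a \<noteq> b"
        using that by (auto simp: lt_def)
      show "lt i a" if "a \<noteq> i"
        using that by (simp add: lt_def)
    qed
    \<comment> \<open>The annihilator is an ideal containing the relators and the idempotent but not
      1.\<close>
    show False
      using J ideal_rep_annihilator relators_annihilator idem_annihilator
        one_notin_rep_annihilator[OF \<nu>] by blast
  next
    fix J
    assume neg: "simple_reflection form i \<beta> \<notin> Q_plus"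
      and J: "ideal J ?F" "klr_relators Q \<beta> \<subseteq> J" "?s \<in> J"
    \<comment> \<open>The pulled-back ideal agrees with J on the carrier, where the relators, the
      idempotent and 1 all lie.\<close>
    interpret klr_vanishing form t Q "{p. restrict_gens (klr_gens \<beta>) p \<in> J}" i \<beta>
    proof (intro klr_vanishing.intro klr_vanishing_axioms.intro two_sided_ideal_vimage J(1) assms(1))
      show "klr_relators Q \<beta> \<subseteq> {p. restrict_gens (klr_gens \<beta>) p \<in> J}"
      proof
        fix p assume "p \<in> klr_relators Q \<beta>"
        then have "p \<in> J" "restrict_gens (klr_gens \<beta>) p = p"
          using J(2) klr_relators_carrier[of Q \<beta>] by (blast, blast intro: restrict_gens_id)
        then show "p \<in> {p. restrict_gens (klr_gens \<beta>) p \<in> J}" by simp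
      qed
      show "?s \<in> {p. restrict_gens (klr_gens \<beta>) p \<in> J}"
        using J(3) restrict_gens_id[OF s] by simp
    qed
    have total_neg: "Poly_Mapping.lookup (simple_reflection form i \<beta>) i < 0"
      using neg simple_reflection_in_Q_plus_iff[OF assms(2), of i] by linarith
    have "strand_degree i \<nu> (height \<beta>) < 0" if \<nu>: "\<nu> \<in> seqs \<beta>" for \<nu>
    proof -
      have "height \<beta> = length \<nu>" using \<nu> by (simp add: seqs_def)
      then show ?thesis
        using total_neg by (simp only: strand_degree_total[OF \<nu>])
    qed
    then have "1 \<in> {p. restrict_gens (klr_gens \<beta>) p \<in> J}"
      by (rule one_mem)
    then show "1 \<in> J"
      by (simp add: restrict_gens_id[OF free_algebra_one])
  qed
  finally show ?thesis .
qed

end
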